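(* Let $\mathscr{C}$ be a polyhedral complex in $\mathbb{R}^r$. Then the real vector space $H^k_d(|\mathscr{C}|)$ is finite dimensional for all $k\in\mathbb{N}_0$.
   Context: A polyhedron in $\mathbb{R}^r$ is a finite intersection of closed affine half-spaces (no rationality assumption). A polyhedral complex $\mathscr{C}$ in $\mathbb{R}^r$ is a finite set of polyhedra such that every face of a member is a member and the intersection of two members is a face of both (the empty set counts as a face). Its support $|\mathscr{C}|$ is the union of its members, with the subspace topology. For a polyhedron $\sigma$, $\mathbb{L}_\sigma\subset\mathbb{R}^r$ is the linear subspace parallel to its affine span. Superforms on open $U\subset\mathbb{R}^r$: $A^{p,q}(U):=A^p(U)\otimes_{C^\infty(U)}A^q(U)=A^p(U)\otimes_{\mathbb{R}}\Lambda^q(\mathbb{R}^r)^*=\Lambda^p(\mathbb{R}^r)^*\otimes_{\mathbb{R}}A^q(U)$, where $A^p(U)$ is the space of smooth real $p$-forms. With $D$ the exterior derivative, $d':=D\otimes\mathrm{id}:A^{p,q}(U)\to A^{p+1,q}(U)$ (on $A^p(U)\otimes_{\mathbb{R}}\Lambda^q(\mathbb{R}^r)^*$), $d'':=(-1)^p\,\mathrm{id}\otimes D:A^{p,q}(U)\to A^{p,q+1}(U)$ (on $\Lambda^p(\mathbb{R}^r)^*\otimes_{\mathbb{R}}A^q(U)$), and $d:=d'+d''$. Then $d'd''=-d''d'$ and $d\circ d=0$. $\langle\alpha(x);v_1,\dots,v_p,w_1,\dots,w_q\rangle$ denotes evaluation at $x$ of the first factor on the $v_i$ and of the second factor on the $w_j$.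 Superforms on open $\Omega\subset|\mathscr{C}|$: an element of $A^{p,q}(\Omega)$ is given by some $\alpha'\in A^{p,q}(V)$ with $V\subset\mathbb{R}^r$ open and $V\cap|\mathscr{C}|=\Omega$; $\alpha'\in A^{p,q}(V)$ and $\alpha''\in A^{p,q}(W)$ define the same element iff for all $\sigma\in\mathscr{C}$, $x\in\sigma\cap\Omega$, and $v_i,w_j\in\mathbb{L}_\sigma$ one has $\langle\alpha'(x);v_1,\dots,v_p,w_1,\dots,w_q\rangle=\langle\alpha''(x);v_1,\dots,v_p,w_1,\dots,w_q\rangle$. The operators $d',d'',d$ are induced by those on representatives. $A^k(\Omega):=\bigoplus_{p+q=k}A^{p,q}(\Omega)$, and $H^k_d(\Omega)$ is the $k$-th cohomology of the complex $(A^\bullet(\Omega),d)$. *)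

theory Defs
  imports "HOL-Analysis.Analysis" "Jordan_Normal_Form.Missing_VectorSpace"
begin

section \<open>Linear algebra\<close>

definition real_ring :: "real ring" where
  "real_ring = \<lparr>carrier = UNIV, mult = (*), one = 1, zero = 0, add = (+)\<rparr>"

text \<open>Quotient of a module by an equivalence relation on its carrier that is compatible with
  addition and scalar multiplication. The ring operations of the record type are meaningless
  for a module.\<close>

definition quotient_module ::
    "('r, 'b, 'm) module_scheme \<Rightarrow> ('b \<times> 'b) set \<Rightarrow> ('r, 'b set) module" where
  "quotient_module M E = \<lparr>
     carrier = carrier M // E,
     mult = undefined,
     one = undefined,
     zero = E `` {\<zero>\<^bsub>M\<^esub>},
     add = (\<lambda>X Y. E `` {x \<oplus>\<^bsub>M\<^esub> y | x y. x \<in> X \<and> y \<in> Y}),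
     smult = (\<lambda>c X. E `` {c \<odot>\<^bsub>M\<^esub> x | x. x \<in> X})\<rparr>"

text \<open>Used for finite index sets only, where the direct sum is the full product.\<close>

definition finite_direct_sum ::
    "'i set \<Rightarrow> ('i \<Rightarrow> ('r, 'b, 'm) module_scheme) \<Rightarrow> ('r, 'i \<Rightarrow> 'b) module" where
  "finite_direct_sum I M = \<lparr>
     carrier = (\<Pi>\<^sub>E i\<in>I. carrier (M i)),
     mult = undefined,
     one = undefined,
     zero = (\<lambda>i\<in>I. \<zero>\<^bsub>M i\<^esub>),
     add = (\<lambda>a b. \<lambda>i\<in>I. a i \<oplus>\<^bsub>M i\<^esub> b i),
     smult = (\<lambda>c a. \<lambda>i\<in>I. c \<odot>\<^bsub>M i\<^esub> a i)\<rparr>"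

text \<open>Multilinear forms take the list of their arguments; nothing is required of the value on
  lists whose length is not \<open>n\<close>.\<close>

definition alternating_form :: "nat \<Rightarrow> ('a::real_vector list \<Rightarrow> real) \<Rightarrow> bool" where
  "alternating_form n f \<longleftrightarrow>
     (\<forall>vs i. length vs = n \<and> i < n \<longrightarrow> linear (\<lambda>u. f (vs[i := u]))) \<and>
     (\<forall>vs i j. length vs = n \<and> i < j \<and> j < n \<and> vs ! i = vs ! j \<longrightarrow> f vs = 0)"


section \<open>Polyhedral complexes\<close>

text \<open>Note that \<open>{} face_of S\<close> holds for every \<open>S\<close>, so a nonempty complex contains \<open>{}\<close>.\<close>

definition polyhedral_complex :: "'a::euclidean_space set set \<Rightarrow> bool" where
  "polyhedral_complex C \<longleftrightarrow>
     finite C \<and>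
     (\<forall>\<sigma>\<in>C. polyhedron \<sigma>) \<and>
     (\<forall>\<sigma>\<in>C. \<forall>\<tau>. \<tau> face_of \<sigma> \<longrightarrow> \<tau> \<in> C) \<and>
     (\<forall>\<sigma>\<in>C. \<forall>\<tau>\<in>C. (\<sigma> \<inter> \<tau>) face_of \<sigma> \<and> (\<sigma> \<inter> \<tau>) face_of \<tau>)"

abbreviation support :: "'a set set \<Rightarrow> 'a set" where
  "support C \<equiv> \<Union>C"

definition parallel_space :: "'a::real_vector set \<Rightarrow> 'a set" where
  "parallel_space \<sigma> = {y - x | x y. x \<in> affine hull \<sigma> \<and> y \<in> affine hull \<sigma>}"


section \<open>Superforms on open subsets of Euclidean space\<close>

primrec Ck_on :: "nat \<Rightarrow> 'a::real_normed_vector set \<Rightarrow> ('a \<Rightarrow> real) \<Rightarrow> bool" where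
  "Ck_on 0 U f \<longleftrightarrow> continuous_on U f"
| "Ck_on (Suc k) U f \<longleftrightarrow>
     (\<forall>x\<in>U. f differentiable (at x)) \<and>
     (\<forall>v. Ck_on k U (\<lambda>x. frechet_derivative f (at x) v))"

definition smooth_on :: "'a::real_normed_vector set \<Rightarrow> ('a \<Rightarrow> real) \<Rightarrow> bool" where
  "smooth_on U f \<longleftrightarrow> (\<forall>k. Ck_on k U f)"

text \<open>An element of \<open>\<Lambda>\<^sup>p \<otimes> \<Lambda>\<^sup>q\<close> of the dual space is the same thing as its evaluation: a function
  of \<open>p + q\<close> vectors that is multilinear and alternating in the first \<open>p\<close> and in the last \<open>q\<close> of
  them. Thus \<open>\<alpha> x vs ws\<close> is \<open>\<langle>\<alpha>(x); v\<^sub>1,\<dots>,v\<^sub>p,w\<^sub>1,\<dots>,w\<^sub>q\<rangle>\<close>. Only the values for \<open>x\<close> in the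
  domain and argument lists of lengths \<open>p\<close> and \<open>q\<close> matter.\<close>

type_synonym 'a superform = "'a \<Rightarrow> 'a list \<Rightarrow> 'a list \<Rightarrow> real"

definition superforms :: "nat \<Rightarrow> nat \<Rightarrow> 'a::euclidean_space set \<Rightarrow> 'a superform set" where
  "superforms p q U = {\<alpha>.
     (\<forall>x\<in>U. \<forall>ws. length ws = q \<longrightarrow> alternating_form p (\<lambda>vs. \<alpha> x vs ws)) \<and>
     (\<forall>x\<in>U. \<forall>vs. length vs = p \<longrightarrow> alternating_form q (\<lambda>ws. \<alpha> x vs ws)) \<and>
     (\<forall>vs ws. length vs = p \<and> length ws = q \<longrightarrow> smooth_on U (\<lambda>x. \<alpha> x vs ws))}"

definition omit :: "nat \<Rightarrow> 'a list \<Rightarrow> 'a list" where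
  "omit i xs = take i xs @ drop (Suc i) xs"

text \<open>The exterior derivative of a \<open>p\<close>-form \<open>\<omega>\<close> is
  \<open>D \<omega> (x; v\<^sub>0,\<dots>,v\<^sub>p) = \<Sum>i. (-1)^i \<partial>\<^bsub>v i\<^esub> \<omega> (x; v\<^sub>0,\<dots>,v\<^sub>p without v i)\<close>. On a form of type
  \<open>(p, q)\<close> the operator \<open>d'\<close> applies it to the first factor, and \<open>d''\<close> to the second one with
  the sign \<open>(-1)^p\<close>; there \<open>p\<close> is the length of the first argument list.\<close>

definition d_prime :: "'a::euclidean_space superform \<Rightarrow> 'a superform" where
  "d_prime \<alpha> x vs ws =
     (\<Sum>i<length vs. (-1)^i * frechet_derivative (\<lambda>y. \<alpha> y (omit i vs) ws) (at x) (vs ! i))"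

definition d_second :: "'a::euclidean_space superform \<Rightarrow> 'a superform" where
  "d_second \<alpha> x vs ws = (-1)^length vs *
     (\<Sum>j<length ws. (-1)^j * frechet_derivative (\<lambda>y. \<alpha> y vs (omit j ws)) (at x) (ws ! j))"


section \<open>Superforms on open subsets of the support of a polyhedral complex\<close>

text \<open>The open set \<open>V\<close> need not be recorded with a representative: equality of superforms on
  \<open>\<Omega>\<close> and the derivatives at points of \<open>\<Omega>\<close> do not depend on it.\<close>

definition representatives ::
    "'a::euclidean_space set set \<Rightarrow> 'a set \<Rightarrow> nat \<Rightarrow> nat \<Rightarrow> (real, 'a superform) module" where
  "representatives C \<Omega> p q = \<lparr>
     carrier = {\<alpha>. \<exists>V. open V \<and> V \<inter> support C = \<Omega> \<and> \<alpha> \<in> superforms p q V},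
     mult = undefined,
     one = undefined,
     zero = (\<lambda>x vs ws. 0),
     add = (\<lambda>\<alpha> \<beta> x vs ws. \<alpha> x vs ws + \<beta> x vs ws),
     smult = (\<lambda>c \<alpha> x vs ws. c * \<alpha> x vs ws)\<rparr>"

definition same_superform ::
    "'a::euclidean_space set set \<Rightarrow> 'a set \<Rightarrow> nat \<Rightarrow> nat \<Rightarrow> ('a superform \<times> 'a superform) set" where
  "same_superform C \<Omega> p q = {(\<alpha>, \<beta>).
     \<alpha> \<in> carrier (representatives C \<Omega> p q) \<and>
     \<beta> \<in> carrier (representatives C \<Omega> p q) \<and>
     (\<forall>\<sigma>\<in>C. \<forall>x\<in>\<sigma> \<inter> \<Omega>. \<forall>vs ws.
        length vs = p \<and> set vs \<subseteq> parallel_space \<sigma> \<and>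
        length ws = q \<and> set ws \<subseteq> parallel_space \<sigma> \<longrightarrow>
        \<alpha> x vs ws = \<beta> x vs ws)}"

definition superforms_on ::
    "'a::euclidean_space set set \<Rightarrow> 'a set \<Rightarrow> nat \<Rightarrow> nat \<Rightarrow> (real, 'a superform set) module" where
  "superforms_on C \<Omega> p q =
     quotient_module (representatives C \<Omega> p q) (same_superform C \<Omega> p q)"

text \<open>The operators induced on classes; \<open>(p, q)\<close> is the type of the argument.\<close>

definition d_prime_on ::
    "'a::euclidean_space set set \<Rightarrow> 'a set \<Rightarrow> nat \<Rightarrow> nat \<Rightarrow> 'a superform set \<Rightarrow> 'a superform set" where
  "d_prime_on C \<Omega> p q X = same_superform C \<Omega> (Suc p) q `` (d_prime ` X)"

definition d_second_on ::
    "'a::euclidean_space set set \<Rightarrow> 'a set \<Rightarrow> nat \<Rightarrow> nat \<Rightarrow> 'a superform set \<Rightarrow> 'a superform set" where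
  "d_second_on C \<Omega> p q X = same_superform C \<Omega> p (Suc q) `` (d_second ` X)"


section \<open>The total complex and its cohomology\<close>

definition total_superforms ::
    "'a::euclidean_space set set \<Rightarrow> 'a set \<Rightarrow> nat \<Rightarrow> (real, nat \<times> nat \<Rightarrow> 'a superform set) module" where
  "total_superforms C \<Omega> k =
     finite_direct_sum {(p, q). p + q = k} (\<lambda>(p, q). superforms_on C \<Omega> p q)"

definition total_d ::
    "'a::euclidean_space set set \<Rightarrow> 'a set \<Rightarrow> nat \<Rightarrow>
     (nat \<times> nat \<Rightarrow> 'a superform set) \<Rightarrow> (nat \<times> nat \<Rightarrow> 'a superform set)" where
  "total_d C \<Omega> k a = (\<lambda>(p, q)\<in>{(p, q). p + q = Suc k}.
     (case p of 0 \<Rightarrow> \<zero>\<^bsub>superforms_on C \<Omega> p q\<^esub> | Suc p' \<Rightarrow> d_prime_on C \<Omega> p' q (a (p', q)))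
     \<oplus>\<^bsub>superforms_on C \<Omega> p q\<^esub>
     (case q of 0 \<Rightarrow> \<zero>\<^bsub>superforms_on C \<Omega> p q\<^esub> | Suc q' \<Rightarrow> d_second_on C \<Omega> p q' (a (p, q'))))"

definition cocycles ::
    "'a::euclidean_space set set \<Rightarrow> 'a set \<Rightarrow> nat \<Rightarrow> (nat \<times> nat \<Rightarrow> 'a superform set) set" where
  "cocycles C \<Omega> k = {a \<in> carrier (total_superforms C \<Omega> k).
     total_d C \<Omega> k a = \<zero>\<^bsub>total_superforms C \<Omega> (Suc k)\<^esub>}"

definition coboundaries ::
    "'a::euclidean_space set set \<Rightarrow> 'a set \<Rightarrow> nat \<Rightarrow> (nat \<times> nat \<Rightarrow> 'a superform set) set" where
  "coboundaries C \<Omega> k = (case k of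
     0 \<Rightarrow> {\<zero>\<^bsub>total_superforms C \<Omega> 0\<^esub>}
   | Suc j \<Rightarrow> total_d C \<Omega> j ` carrier (total_superforms C \<Omega> j))"

definition cohomology ::
    "'a::euclidean_space set set \<Rightarrow> 'a set \<Rightarrow> nat \<Rightarrow>
     (real, (nat \<times> nat \<Rightarrow> 'a superform set) set) module" where
  "cohomology C \<Omega> k = quotient_module
     ((total_superforms C \<Omega> k)\<lparr>carrier := cocycles C \<Omega> k\<rparr>)
     {(z, z'). z \<in> cocycles C \<Omega> k \<and> z' \<in> cocycles C \<Omega> k \<and>
        (\<exists>b\<in>coboundaries C \<Omega> k. z = z' \<oplus>\<^bsub>total_superforms C \<Omega> k\<^esub> b)}"

end

theory Submission
  imports Defs "HOL-Library.Function_Algebras"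
begin

text \<open>For fixed \<open>q\<close> the operator \<open>d'\<close> is the de Rham differential with values in \<open>q\<close>-forms. The star of a
  point \<open>x\<close>, i.e. the set of points all of whose cells contain \<open>x\<close>, is contracted to \<open>x\<close> along straight
  segments that stay inside the cells; pulling back in the first factor only is compatible with the
  restriction to cells, so the \<open>d'\<close>-cohomology of a star vanishes for \<open>p > 0\<close> and embeds into the
  forms at \<open>x\<close> for \<open>p = 0\<close>. There are finitely many stars, they cover the support, and two stars that meet
  intersect in the star of the midpoint of their centres. As stars are cut out by
  smooth inequalities, cutoff functions exist and a Mayer-Vietoris induction shows that the
  \<open>d'\<close>-cohomology of the support is finite dimensional in every bidegree. Filtering the total complex
  by \<open>q\<close> gives the theorem.\<close>

hide_const (open) VectorSpace.subspace

section \<open>Finite codimension\<close>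

instantiation "fun" :: (type, real_vector) real_vector
begin

definition scaleR_fun :: "real \<Rightarrow> ('a \<Rightarrow> 'b) \<Rightarrow> 'a \<Rightarrow> 'b" where
  "scaleR_fun c f = (\<lambda>x. c *\<^sub>R f x)"

instance
  by standard (auto simp: scaleR_fun_def fun_eq_iff algebra_simps)

end

lemma scaleR_apply [simp]: "(c *\<^sub>R f) x = c *\<^sub>R f x"
  by (simp add: scaleR_fun_def)

text \<open>Phrasing finite codimension by linear dependence rather than by a spanning set makes it
  transfer along linear relations without any choice of complements.\<close>

definition fin_codim :: "'v::real_vector set \<Rightarrow> 'v set \<Rightarrow> bool" where
  "fin_codim M N \<longleftrightarrow> (\<exists>n::nat. \<forall>v. (\<forall>i<n. v i \<in> M) \<longrightarrow>
     (\<exists>c. (\<exists>i<n. c i \<noteq> 0) \<and> (\<Sum>i<n. c i *\<^sub>R v i) \<in> N))"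

lemma fin_codim_pullback:
  assumes "fin_codim M' N'"
    and ex: "\<And>m. m \<in> M \<Longrightarrow> \<exists>m'\<in>M'. P m m'"
    and zero: "P 0 0"
    and add: "\<And>x x' y y'. P x x' \<Longrightarrow> P y y' \<Longrightarrow> P (x + y) (x' + y')"
    and scale: "\<And>c x x'. P x x' \<Longrightarrow> P (c *\<^sub>R x) (c *\<^sub>R x')"
    and mem: "\<And>m m'. P m m' \<Longrightarrow> m' \<in> N' \<Longrightarrow> m \<in> N"
  shows "fin_codim M N"
proof -
  obtain n :: nat where n: "\<And>v. (\<forall>i<n. v i \<in> M') \<Longrightarrow>
      (\<exists>c. (\<exists>i<n. c i \<noteq> 0) \<and> (\<Sum>i<n. c i *\<^sub>R v i) \<in> N')"
    using assms(1) unfolding fin_codim_def by blast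
  show ?thesis unfolding fin_codim_def
  proof (rule exI[of _ n], intro allI impI)
    fix v assume v: "\<forall>i<n. v i \<in> M"
    then have "\<forall>i. \<exists>w. i < n \<longrightarrow> w \<in> M' \<and> P (v i) w" using ex by blast
    then obtain w where w: "\<And>i. i < n \<Longrightarrow> w i \<in> M' \<and> P (v i) (w i)" by metis
    obtain c where c: "\<exists>i<n. c i \<noteq> 0" "(\<Sum>i<n. c i *\<^sub>R w i) \<in> N'" using n[of w] w by blast
    have "k \<le> n \<Longrightarrow> P (\<Sum>i<k. c i *\<^sub>R v i) (\<Sum>i<k. c i *\<^sub>R w i)" for k
      by (induction k) (use zero add scale w in auto)
    then have "(\<Sum>i<n. c i *\<^sub>R v i) \<in> N" using mem c(2) by blast
    then show "\<exists>c. (\<exists>i<n. c i \<noteq> 0) \<and> (\<Sum>i<n. c i *\<^sub>R v i) \<in> N" using c(1) by blast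
  qed
qed

lemma fin_codim_mono:
  assumes "fin_codim M' N'" "M \<subseteq> M'" "N' \<subseteq> N"
  shows "fin_codim M N"
  by (rule fin_codim_pullback[OF assms(1), where P = "\<lambda>m m'. m = m'"]) (use assms in auto)

lemma fin_codim_trans:
  assumes "fin_codim M K" "fin_codim K N"
  shows "fin_codim M N"
proof -
  obtain n :: nat where n: "\<And>v. (\<forall>i<n. v i \<in> M) \<Longrightarrow>
      (\<exists>c. (\<exists>i<n. c i \<noteq> 0) \<and> (\<Sum>i<n. c i *\<^sub>R v i) \<in> K)"
    using assms(1) unfolding fin_codim_def by blast
  obtain m :: nat where m: "\<And>v. (\<forall>i<m. v i \<in> K) \<Longrightarrow>
      (\<exists>c. (\<exists>i<m. c i \<noteq> 0) \<and> (\<Sum>i<m. c i *\<^sub>R v i) \<in> N)"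
    using assms(2) unfolding fin_codim_def by blast
  show ?thesis unfolding fin_codim_def
  proof (rule exI[of _ "m * n"], intro allI impI)
    fix v :: "nat \<Rightarrow> 'a" assume v: "\<forall>i<m * n. v i \<in> M"
    have "\<exists>c. i < m \<longrightarrow> (\<exists>j<n. c j \<noteq> 0) \<and> (\<Sum>j<n. c j *\<^sub>R v (i * n + j)) \<in> K" for i
    proof (cases "i < m")
      case True
      have "i * n + j < m * n" if "j < n" for j
      proof -
        have "i * n + j < Suc i * n" using that by simp
        also have "\<dots> \<le> m * n" using True by (intro mult_le_mono1) auto
        finally show ?thesis .
      qed
      then show ?thesis using n[of "\<lambda>j. v (i * n + j)"] v by blast
    qed auto
    then obtain c where c: "\<And>i. i < m \<Longrightarrow> (\<exists>j<n. c i j \<noteq> (0::real)) \<and>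
        (\<Sum>j<n. c i j *\<^sub>R v (i * n + j)) \<in> K" by metis
    obtain d where d: "\<exists>i<m. d i \<noteq> 0" "(\<Sum>i<m. d i *\<^sub>R (\<Sum>j<n. c i j *\<^sub>R v (i * n + j))) \<in> N"
      using m[of "\<lambda>i. \<Sum>j<n. c i j *\<^sub>R v (i * n + j)"] c by blast
    let ?e = "\<lambda>l. d (l div n) * c (l div n) (l mod n)"
    obtain i j where ij: "i < m" "d i \<noteq> 0" "j < n" "c i j \<noteq> 0" using d(1) c by blast
    have "i * n + j < Suc i * n" using ij by simp
    also have "\<dots> \<le> m * n" using ij by (intro mult_le_mono1) auto
    finally have "\<exists>l<m * n. ?e l \<noteq> 0" using ij by (intro exI[of _ "i * n + j"]) auto
    moreover have "(\<Sum>l<m * n. ?e l *\<^sub>R v l) = (\<Sum>i<m. d i *\<^sub>R (\<Sum>j<n. c i j *\<^sub>R v (i * n + j)))"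
    proof -
      have "(\<Sum>l<m * n. ?e l *\<^sub>R v l) = (\<Sum>i<m. \<Sum>l=i*n..<i*n+n. ?e l *\<^sub>R v l)"
        by (rule sum.nat_group[symmetric])
      also have "\<dots> = (\<Sum>i<m. \<Sum>j<n. ?e (i * n + j) *\<^sub>R v (i * n + j))"
        using sum.shift_bounds_nat_ivl[of "\<lambda>l. ?e l *\<^sub>R v l" 0 "i * n" n for i]
        by (simp add: atLeast0LessThan add.commute)
      also have "\<dots> = (\<Sum>i<m. \<Sum>j<n. (d i * c i j) *\<^sub>R v (i * n + j))"
        by (intro sum.cong refl) auto
      finally show ?thesis by (simp add: scaleR_sum_right)
    qed
    ultimately show "\<exists>c. (\<exists>i<m * n. c i \<noteq> 0) \<and> (\<Sum>i<m * n. c i *\<^sub>R v i) \<in> N"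
      using d(2) by (intro exI[of _ ?e]) auto
  qed
qed

lemma fin_codim_self:
  assumes "subspace M"
  shows "fin_codim M M"
  unfolding fin_codim_def
  by (rule exI[of _ 1], intro allI impI exI[of _ "\<lambda>_. 1"]) auto

lemma fin_codim_kernel:
  fixes f :: "'v::real_vector \<Rightarrow> real"
  assumes "subspace M"
    and "\<And>x y. x \<in> M \<Longrightarrow> y \<in> M \<Longrightarrow> f (x + y) = f x + f y"
    and "\<And>c x. x \<in> M \<Longrightarrow> f (c *\<^sub>R x) = c * f x"
  shows "fin_codim M {m \<in> M. f m = 0}"
  unfolding fin_codim_def
proof (rule exI[of _ 2], intro allI impI)
  fix v :: "nat \<Rightarrow> 'v" assume v: "\<forall>i<2. v i \<in> M"
  have M: "v 0 \<in> M" "v 1 \<in> M" using v by auto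
  define c where "c = (if f (v 0) = 0 then (\<lambda>i. if i = 0 then 1 else 0)
    else (\<lambda>i::nat. if i = 0 then f (v 1) else - f (v 0)))"
  have "(\<Sum>i<2. c i *\<^sub>R v i) = c 0 *\<^sub>R v 0 + c 1 *\<^sub>R v 1" by (simp add: numeral_2_eq_2)
  moreover have "\<dots> \<in> M" using M assms(1) by (simp add: subspace_add subspace_mul)
  moreover have "f (c 0 *\<^sub>R v 0 + c 1 *\<^sub>R v 1) = c 0 * f (v 0) + c 1 * f (v 1)"
    using assms M by (simp add: subspace_mul)
  moreover have "\<dots> = 0" by (simp add: c_def)
  moreover have "\<exists>i<2. c i \<noteq> 0"
  proof (cases "f (v 0) = 0")
    case True
    then show ?thesis by (intro exI[of _ 0]) (simp add: c_def)
  next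
    case False
    then show ?thesis by (intro exI[of _ 1]) (simp add: c_def)
  qed
  ultimately show "\<exists>c. (\<exists>i<2. c i \<noteq> 0) \<and> (\<Sum>i<2. c i *\<^sub>R v i) \<in> {m \<in> M. f m = 0}"
    by (intro exI[of _ c]) auto
qed

lemma fin_codim_kernels:
  fixes f :: "'i \<Rightarrow> 'v::real_vector \<Rightarrow> real"
  assumes "finite I" "subspace M"
    and add: "\<And>i x y. x \<in> M \<Longrightarrow> y \<in> M \<Longrightarrow> f i (x + y) = f i x + f i y"
    and scale: "\<And>i c x. x \<in> M \<Longrightarrow> f i (c *\<^sub>R x) = c * f i x"
  shows "fin_codim M {m \<in> M. \<forall>i\<in>I. f i m = 0}"
  using assms(1)
proof induction
  case empty
  then show ?case using fin_codim_self assms(2) by simp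
next
  case (insert i I)
  let ?K = "{m \<in> M. \<forall>i\<in>I. f i m = 0}"
  have f0: "f j 0 = 0" for j using scale[of 0 j 0] assms(2) by (simp add: subspace_0)
  have "subspace ?K" using assms(2) add scale f0 by (auto simp: real_vector.subspace_def)
  then have "fin_codim ?K {m \<in> ?K. f i m = 0}"
    by (rule fin_codim_kernel) (auto simp: add scale)
  then have "fin_codim M {m \<in> ?K. f i m = 0}" using insert.IH fin_codim_trans by blast
  moreover have "{m \<in> ?K. f i m = 0} = {m \<in> M. \<forall>i\<in>insert i I. f i m = 0}" by auto
  ultimately show ?case by simp
qed

lemma fin_codim_spanning:
  assumes "fin_codim M N" "subspace N"
  obtains n :: nat and v where "\<And>i. i < n \<Longrightarrow> v i \<in> M"
    and "\<And>m. m \<in> M \<Longrightarrow> \<exists>c. m - (\<Sum>i<n. c i *\<^sub>R v i) \<in> N"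
proof -
  define P where "P k \<longleftrightarrow> (\<exists>v. (\<forall>i<k. v i \<in> M) \<and>
    (\<forall>c. (\<Sum>i<k. c i *\<^sub>R v i) \<in> N \<longrightarrow> (\<forall>i<k. c i = 0)))" for k :: nat
  obtain n :: nat where n: "\<And>v. (\<forall>i<n. v i \<in> M) \<Longrightarrow>
      (\<exists>c. (\<exists>i<n. c i \<noteq> 0) \<and> (\<Sum>i<n. c i *\<^sub>R v i) \<in> N)"
    using assms(1) unfolding fin_codim_def by blast
  have "\<not> P n" unfolding P_def using n by blast
  moreover have "P 0" by (simp add: P_def)
  ultimately obtain k where k: "P k" "\<not> P (Suc k)" using nat_induct[of P n] by blast
  then obtain v where v: "\<forall>i<k. v i \<in> M"
      "\<And>c. (\<Sum>i<k. c i *\<^sub>R v i) \<in> N \<Longrightarrow> (\<forall>i<k. c i = 0)"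
    unfolding P_def by blast
  show ?thesis
  proof (rule that[of k v])
    fix m assume m: "m \<in> M"
    define w where "w = v(k := m)"
    have "\<forall>i<Suc k. w i \<in> M" using v(1) m by (auto simp: w_def less_Suc_eq)
    then obtain c where c: "(\<Sum>i<Suc k. c i *\<^sub>R w i) \<in> N" "\<exists>i<Suc k. c i \<noteq> 0"
      using k(2) unfolding P_def by blast
    have s: "(\<Sum>i<Suc k. c i *\<^sub>R w i) = (\<Sum>i<k. c i *\<^sub>R v i) + c k *\<^sub>R m"
      by (simp add: w_def)
    have ck: "c k \<noteq> 0"
    proof
      assume "c k = 0"
      then have "\<forall>i<k. c i = 0" using c(1) s v(2)[of c] by simp
      then show False using c(2) \<open>c k = 0\<close> by (auto simp: less_Suc_eq)
    qed
    have "(1 / c k) *\<^sub>R ((\<Sum>i<k. c i *\<^sub>R v i) + c k *\<^sub>R m) \<in> N"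
      using c(1) s assms(2) by (metis subspace_mul)
    moreover have "(1 / c k) *\<^sub>R ((\<Sum>i<k. c i *\<^sub>R v i) + c k *\<^sub>R m)
        = m - (\<Sum>i<k. (- c i / c k) *\<^sub>R v i)"
      using ck by (simp add: scaleR_add_right scaleR_sum_right sum_negf)
    ultimately show "\<exists>c. m - (\<Sum>i<k. c i *\<^sub>R v i) \<in> N"
      by (intro exI[of _ "\<lambda>i. - c i / c k"]) simp
  qed (use v in auto)
qed

section \<open>Maps that are linear modulo a subspace\<close>

definition linear_mod :: "'v::real_vector set \<Rightarrow> 'w::real_vector set \<Rightarrow> ('v \<Rightarrow> 'w) \<Rightarrow> bool" where
  "linear_mod M N D \<longleftrightarrow> (\<forall>a\<in>M. \<forall>b\<in>M. D (a + b) - (D a + D b) \<in> N) \<and>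
     (\<forall>c. \<forall>a\<in>M. D (c *\<^sub>R a) - c *\<^sub>R D a \<in> N)"

lemma linear_mod_add: "linear_mod M N D \<Longrightarrow> a \<in> M \<Longrightarrow> b \<in> M \<Longrightarrow> D (a + b) - (D a + D b) \<in> N"
  and linear_mod_scale: "linear_mod M N D \<Longrightarrow> a \<in> M \<Longrightarrow> D (c *\<^sub>R a) - c *\<^sub>R D a \<in> N"
  by (simp_all add: linear_mod_def)

lemma linear_mod_comp:
  assumes "linear_mod M' N D" "\<And>a. a \<in> M \<Longrightarrow> e a \<in> M'"
    and "\<And>a b. e (a + b) = e a + e b" "\<And>c a. e (c *\<^sub>R a) = c *\<^sub>R e a"
  shows "linear_mod M N (\<lambda>a. D (e a))"
  using assms by (simp add: linear_mod_def)

lemma linear_mod_plus: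
  assumes "linear_mod M N D" "linear_mod M N D'" and N: "subspace N"
  shows "linear_mod M N (\<lambda>a. D a + D' a)"
proof -
  have "D (a + b) + D' (a + b) - (D a + D' a + (D b + D' b)) \<in> N" if "a \<in> M" "b \<in> M" for a b
    using subspace_add[OF N linear_mod_add[OF assms(1) that] linear_mod_add[OF assms(2) that]]
    by (simp add: algebra_simps)
  moreover have "D (c *\<^sub>R a) + D' (c *\<^sub>R a) - c *\<^sub>R (D a + D' a) \<in> N" if "a \<in> M" for c a
    using subspace_add[OF N linear_mod_scale[OF assms(1) that, of c] linear_mod_scale[OF assms(2) that, of c]]
    by (simp add: algebra_simps)
  ultimately show ?thesis by (simp add: linear_mod_def)
qed

context
  fixes M :: "'v::real_vector set" and N :: "'w::real_vector set" and D :: "'v \<Rightarrow> 'w"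
  assumes D: "linear_mod M N D" and M: "subspace M" and N: "subspace N"
begin

lemma linear_mod_diff:
  assumes "a \<in> M" "b \<in> M"
  shows "D (a - b) - (D a - D b) \<in> N"
  using subspace_add[OF N linear_mod_add[OF D assms(1) subspace_neg[OF M assms(2)]]
      linear_mod_scale[OF D assms(2), of "-1"]] by (simp add: algebra_simps)

lemma linear_mod_cong:
  assumes "a \<in> M" "b \<in> M" "D (a - b) \<in> N"
  shows "D a - D b \<in> N"
  using subspace_diff[OF N assms(3) linear_mod_diff[OF assms(1,2)]] by (simp add: algebra_simps)

lemma subspace_linear_mod_kernel: "subspace {a \<in> M. D a \<in> N}"
  unfolding real_vector.subspace_def
proof (intro conjI allI ballI)
  show "0 \<in> {a \<in> M. D a \<in> N}"
    using linear_mod_scale[OF D subspace_0[OF M], of 0] subspace_0[OF M] by simp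
  fix a assume a: "a \<in> {a \<in> M. D a \<in> N}"
  show "c *\<^sub>R a \<in> {a \<in> M. D a \<in> N}" for c
    using a subspace_add[OF N linear_mod_scale[OF D, of a c] subspace_mul[OF N, of "D a" c]]
      subspace_mul[OF M] by simp
  fix b assume b: "b \<in> {a \<in> M. D a \<in> N}"
  show "a + b \<in> {a \<in> M. D a \<in> N}"
    using a b subspace_add[OF N linear_mod_add[OF D, of a b] subspace_add[OF N, of "D a" "D b"]]
      subspace_add[OF M] by simp
qed

lemma linear_mod_primitive_add:
  assumes "b \<in> M" "b' \<in> M" "a - D b \<in> N" "a' - D b' \<in> N"
  shows "a + a' - D (b + b') \<in> N"
  using subspace_diff[OF N subspace_add[OF N assms(3,4)] linear_mod_add[OF D assms(1,2)]]
  by (simp add: algebra_simps)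

lemma linear_mod_primitive_scale:
  assumes "b \<in> M" "a - D b \<in> N"
  shows "c *\<^sub>R a - D (c *\<^sub>R b) \<in> N"
  using subspace_diff[OF N subspace_mul[OF N assms(2), of c] linear_mod_scale[OF D assms(1), of c]]
  by (simp add: algebra_simps)

lemma subspace_linear_mod_image:
  assumes "subspace M'"
  shows "subspace {a \<in> M'. \<exists>b\<in>M. a - D b \<in> N}"
  unfolding real_vector.subspace_def
proof (intro conjI allI ballI)
  have "0 - D 0 \<in> N"
    using subspace_neg[OF N linear_mod_scale[OF D subspace_0[OF M], of 0]] by simp
  then show "0 \<in> {a \<in> M'. \<exists>b\<in>M. a - D b \<in> N}"
    using subspace_0[OF M] subspace_0[OF assms] by blast
  fix a assume "a \<in> {a \<in> M'. \<exists>b\<in>M. a - D b \<in> N}"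
  then obtain b where a: "a \<in> M'" "b \<in> M" "a - D b \<in> N" by blast
  show "c *\<^sub>R a \<in> {a \<in> M'. \<exists>b\<in>M. a - D b \<in> N}" for c
    using linear_mod_primitive_scale[OF a(2,3), of c] subspace_mul[OF M a(2)] subspace_mul[OF assms a(1)]
    by blast
  fix a' assume "a' \<in> {a \<in> M'. \<exists>b\<in>M. a - D b \<in> N}"
  then obtain b' where a': "a' \<in> M'" "b' \<in> M" "a' - D b' \<in> N" by blast
  show "a + a' \<in> {a \<in> M'. \<exists>b\<in>M. a - D b \<in> N}"
    using linear_mod_primitive_add[OF a(2) a'(2) a(3) a'(3)] subspace_add[OF M a(2) a'(2)]
      subspace_add[OF assms a(1) a'(1)] by blast
qed

end

section \<open>Modules presented as linear images\<close>

definition lin_surj :: "'v::real_vector set \<Rightarrow> ('v \<Rightarrow> 'b) \<Rightarrow> (real, 'b, 'm) module_scheme \<Rightarrow> bool" where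
  "lin_surj S h M \<longleftrightarrow> subspace S \<and> h ` S = carrier M \<and> h 0 = \<zero>\<^bsub>M\<^esub> \<and>
     (\<forall>x\<in>S. \<forall>y\<in>S. h (x + y) = h x \<oplus>\<^bsub>M\<^esub> h y) \<and>
     (\<forall>c. \<forall>x\<in>S. h (c *\<^sub>R x) = c \<odot>\<^bsub>M\<^esub> h x)"

lemma cring_real_ring: "cring real_ring"
proof (rule cringI)
  show "abelian_group real_ring"
  proof (rule abelian_groupI)
    fix x assume "x \<in> carrier real_ring"
    show "\<exists>y\<in>carrier real_ring. y \<oplus>\<^bsub>real_ring\<^esub> x = \<zero>\<^bsub>real_ring\<^esub>"
      by (rule bexI[of _ "- x"]) (auto simp: real_ring_def)
  qed (auto simp: real_ring_def)
  show "comm_monoid real_ring"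
    by (rule comm_monoidI) (auto simp: real_ring_def)
qed (auto simp: real_ring_def algebra_simps)

lemma field_real_ring: "field real_ring"
proof (rule cring.cring_fieldI2[OF cring_real_ring])
  fix x assume "x \<in> carrier real_ring" "x \<noteq> \<zero>\<^bsub>real_ring\<^esub>"
  then show "\<exists>y\<in>carrier real_ring. x \<otimes>\<^bsub>real_ring\<^esub> y = \<one>\<^bsub>real_ring\<^esub>"
    by (intro bexI[of _ "1 / x"]) (auto simp: real_ring_def)
qed (auto simp: real_ring_def)

lemma lin_surj_vectorspace:
  fixes M :: "(real, 'b, 'm) module_scheme"
  assumes "lin_surj S h M"
  shows "vectorspace real_ring M"
proof -
  have S: "subspace S" and c: "carrier M = h ` S" and z: "\<zero>\<^bsub>M\<^esub> = h 0"
    and a: "\<And>x y. x \<in> S \<Longrightarrow> y \<in> S \<Longrightarrow> h x \<oplus>\<^bsub>M\<^esub> h y = h (x + y)"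
    and s: "\<And>c x. x \<in> S \<Longrightarrow> c \<odot>\<^bsub>M\<^esub> h x = h (c *\<^sub>R x)"
    using assms unfolding lin_surj_def by auto
  note cl = subspace_0[OF S] subspace_add[OF S] subspace_mul[OF S] subspace_neg[OF S]
  have ag: "abelian_group M"
  proof (rule abelian_groupI)
    fix x assume "x \<in> carrier M"
    then obtain u where "u \<in> S" "x = h u" using c by auto
    then show "\<exists>y\<in>carrier M. y \<oplus>\<^bsub>M\<^esub> x = \<zero>\<^bsub>M\<^esub>"
      by (intro bexI[of _ "h (- u)"]) (auto simp: a c z cl)
  qed (auto simp: c z a cl add_ac)
  have "module real_ring M"
    by (rule moduleI[OF cring_real_ring ag])
       (auto simp: c a s cl real_ring_def algebra_simps)
  then show ?thesis using field_real_ring by (simp add: vectorspace_def)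
qed

lemma lin_surj_fin_dim:
  fixes n :: nat
  assumes h: "lin_surj S h M" and v: "\<And>i. i < n \<Longrightarrow> v i \<in> S"
    and sp: "\<And>x. x \<in> S \<Longrightarrow> \<exists>c. h x = h (\<Sum>i<n. c i *\<^sub>R v i)"
  shows "vectorspace.fin_dim real_ring M"
proof -
  interpret vectorspace real_ring M by (rule lin_surj_vectorspace[OF h])
  have S: "subspace S" and c: "carrier M = h ` S" and z: "\<zero>\<^bsub>M\<^esub> = h 0"
    and a: "\<And>x y. x \<in> S \<Longrightarrow> y \<in> S \<Longrightarrow> h x \<oplus>\<^bsub>M\<^esub> h y = h (x + y)"
    and s: "\<And>c x. x \<in> S \<Longrightarrow> c \<odot>\<^bsub>M\<^esub> h x = h (c *\<^sub>R x)"
    using h unfolding lin_surj_def by auto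
  let ?A = "h ` v ` {..<n}"
  have A: "?A \<subseteq> carrier M" using v c by auto
  interpret sub: submodule real_ring "span ?A" M by (rule span_is_submodule[OF A])
  have "k \<le> n \<Longrightarrow> h (\<Sum>i<k. d i *\<^sub>R v i) \<in> span ?A" for k d
  proof (induction k)
    case 0
    show ?case using sub.zero_closed z by simp
  next
    case (Suc k)
    have S1: "(\<Sum>i<k. d i *\<^sub>R v i) \<in> S" using Suc.prems v S by (intro subspace_sum subspace_mul) auto
    have "h (v k) \<in> span ?A" using Suc.prems in_own_span[OF A] by auto
    then have "h (d k *\<^sub>R v k) \<in> span ?A"
      using sub.smult_closed[of "d k" "h (v k)"] s[of "v k" "d k"] v[of k] Suc.prems
      by (simp add: real_ring_def)
    then show ?case
      using Suc sub.m_closed[of "h (\<Sum>i<k. d i *\<^sub>R v i)" "h (d k *\<^sub>R v k)"]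
        a[OF S1, of "d k *\<^sub>R v k"] v[of k] S by (simp add: subspace_mul)
  qed
  then have "carrier M \<subseteq> span ?A" unfolding c using sp by fastforce
  then have "gen_set ?A" using sub.subset by (rule subset_antisym[rotated])
  then show ?thesis unfolding fin_dim_def using A by (intro exI[of _ ?A] conjI) simp_all
qed

lemma lin_surj_quotient:
  assumes h: "lin_surj S h M" and E: "equiv (carrier M) E"
    and E_iff: "\<And>x y. x \<in> S \<Longrightarrow> y \<in> S \<Longrightarrow> (h x, h y) \<in> E \<longleftrightarrow> x - y \<in> N"
    and N: "subspace N"
  shows "lin_surj S (\<lambda>x. E `` {h x}) (quotient_module M E)"
proof -
  have S: "subspace S" and c: "carrier M = h ` S" and z: "\<zero>\<^bsub>M\<^esub> = h 0"
    and a: "\<And>x y. x \<in> S \<Longrightarrow> y \<in> S \<Longrightarrow> h x \<oplus>\<^bsub>M\<^esub> h y = h (x + y)"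
    and s: "\<And>c x. x \<in> S \<Longrightarrow> c \<odot>\<^bsub>M\<^esub> h x = h (c *\<^sub>R x)"
    using h unfolding lin_surj_def by auto
  have sub: "E \<subseteq> carrier M \<times> carrier M" using E by (simp add: equiv_def refl_on_def)
  have im: "E `` {h x} = h ` {y \<in> S. x - y \<in> N}" if "x \<in> S" for x
  proof
    show "E `` {h x} \<subseteq> h ` {y \<in> S. x - y \<in> N}"
    proof
      fix u assume u: "u \<in> E `` {h x}"
      then obtain y where "y \<in> S" "u = h y" using sub c by auto
      then show "u \<in> h ` {y \<in> S. x - y \<in> N}" using u E_iff[OF that] by auto
    qed
    show "h ` {y \<in> S. x - y \<in> N} \<subseteq> E `` {h x}" using E_iff[OF that] by auto
  qed
  have un: "E `` A = E `` {h x}"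
    if x: "x \<in> S" "h x \<in> A" and A: "\<And>u. u \<in> A \<Longrightarrow> \<exists>y\<in>S. u = h y \<and> x - y \<in> N" for x A
  proof -
    have "E `` {u} = E `` {h x}" if u: "u \<in> A" for u
    proof -
      obtain y where "y \<in> S" "u = h y" "x - y \<in> N" using A[OF u] by blast
      then have "(h x, u) \<in> E" using E_iff x(1) by simp
      then show ?thesis using equiv_class_eq[OF E] by blast
    qed
    then show ?thesis using x(2) by blast
  qed
  have self: "h x \<in> h ` {y \<in> S. x - y \<in> N}" if "x \<in> S" for x
    using that subspace_0[OF N] by auto
  have "E `` {h (x + y)} = E `` {p \<oplus>\<^bsub>M\<^esub> q | p q. p \<in> E `` {h x} \<and> q \<in> E `` {h y}}"
    if xy: "x \<in> S" "y \<in> S" for x y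
  proof (rule un[symmetric])
    show "x + y \<in> S" using xy S by (simp add: subspace_add)
    show "h (x + y) \<in> {p \<oplus>\<^bsub>M\<^esub> q | p q. p \<in> E `` {h x} \<and> q \<in> E `` {h y}}"
      using self[OF xy(1)] self[OF xy(2)] im[OF xy(1)] im[OF xy(2)] a[OF xy, symmetric] by blast
    fix u assume "u \<in> {p \<oplus>\<^bsub>M\<^esub> q | p q. p \<in> E `` {h x} \<and> q \<in> E `` {h y}}"
    then obtain p q where "u = h p \<oplus>\<^bsub>M\<^esub> h q" "p \<in> S" "q \<in> S" "x - p \<in> N" "y - q \<in> N"
      unfolding im[OF xy(1)] im[OF xy(2)] by auto
    then show "\<exists>z\<in>S. u = h z \<and> x + y - z \<in> N"
      using a S subspace_add[OF N, of "x - p" "y - q"]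
      by (intro bexI[of _ "p + q"]) (auto simp: subspace_add algebra_simps)
  qed
  moreover have "E `` {h (r *\<^sub>R x)} = E `` {r \<odot>\<^bsub>M\<^esub> p | p. p \<in> E `` {h x}}"
    if x: "x \<in> S" for x r
  proof (rule un[symmetric])
    show "r *\<^sub>R x \<in> S" using x S by (simp add: subspace_mul)
    show "h (r *\<^sub>R x) \<in> {r \<odot>\<^bsub>M\<^esub> p | p. p \<in> E `` {h x}}"
      using self[OF x] im[OF x] s[OF x, symmetric] by blast
    fix u assume "u \<in> {r \<odot>\<^bsub>M\<^esub> p | p. p \<in> E `` {h x}}"
    then obtain p where "u = r \<odot>\<^bsub>M\<^esub> h p" "p \<in> S" "x - p \<in> N"
      unfolding im[OF x] by auto
    then show "\<exists>z\<in>S. u = h z \<and> r *\<^sub>R x - z \<in> N"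
      using s S subspace_mul[OF N, of "x - p" r]
      by (intro bexI[of _ "r *\<^sub>R p"]) (auto simp: subspace_mul algebra_simps)
  qed
  ultimately show ?thesis
    using S c z unfolding lin_surj_def quotient_module_def
    by (auto simp: quotient_def)
qed

lemma equiv_of_subspace:
  assumes E: "E \<subseteq> h ` S \<times> h ` S"
    and E_iff: "\<And>x y. x \<in> S \<Longrightarrow> y \<in> S \<Longrightarrow> (h x, h y) \<in> E \<longleftrightarrow> x - y \<in> N"
    and N: "subspace N"
  shows "equiv (h ` S) E"
proof (rule equivI)
  show "E \<subseteq> h ` S \<times> h ` S" by (rule E)
  show "refl_on (h ` S) E"
    using E_iff subspace_0[OF N] by (auto simp: refl_on_def)
  show "sym E"
  proof (rule symI)
    fix a b assume ab: "(a, b) \<in> E"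
    then obtain x y where xy: "x \<in> S" "y \<in> S" "a = h x" "b = h y" using E by blast
    then have "- (x - y) \<in> N" using ab E_iff by (intro subspace_neg[OF N]) simp
    then show "(b, a) \<in> E" using xy E_iff by simp
  qed
  show "trans E"
  proof (rule transI)
    fix a b c assume abc: "(a, b) \<in> E" "(b, c) \<in> E"
    then obtain x y z where xyz: "x \<in> S" "y \<in> S" "z \<in> S" "a = h x" "b = h y" "c = h z" using E by blast
    then have "(x - y) + (y - z) \<in> N" using abc E_iff by (intro subspace_add[OF N]) simp_all
    then show "(a, c) \<in> E" using xyz E_iff by simp
  qed
qed

lemma lin_surj_direct_sum:
  assumes h: "\<And>i. i \<in> I \<Longrightarrow> lin_surj (S i) (h i) (M i)"
  shows "lin_surj {a. \<forall>i\<in>I. a i \<in> S i} (\<lambda>a. \<lambda>i\<in>I. h i (a i)) (finite_direct_sum I M)"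
proof -
  have S: "\<And>i. i \<in> I \<Longrightarrow> subspace (S i)" and c: "\<And>i. i \<in> I \<Longrightarrow> h i ` S i = carrier (M i)"
    and z: "\<And>i. i \<in> I \<Longrightarrow> h i 0 = \<zero>\<^bsub>M i\<^esub>"
    and a: "\<And>i x y. i \<in> I \<Longrightarrow> x \<in> S i \<Longrightarrow> y \<in> S i \<Longrightarrow> h i (x + y) = h i x \<oplus>\<^bsub>M i\<^esub> h i y"
    and s: "\<And>i r x. i \<in> I \<Longrightarrow> x \<in> S i \<Longrightarrow> h i (r *\<^sub>R x) = r \<odot>\<^bsub>M i\<^esub> h i x"
    using h unfolding lin_surj_def by auto
  let ?T = "{a. \<forall>i\<in>I. a i \<in> S i}" and ?H = "\<lambda>a. \<lambda>i\<in>I. h i (a i)"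
  have "subspace ?T"
    unfolding real_vector.subspace_def
    using S by (auto intro: subspace_0 subspace_add subspace_mul)
  moreover have "?H ` ?T = (\<Pi>\<^sub>E i\<in>I. carrier (M i))"
  proof
    show "?H ` ?T \<subseteq> (\<Pi>\<^sub>E i\<in>I. carrier (M i))" by (auto simp flip: c)
    show "(\<Pi>\<^sub>E i\<in>I. carrier (M i)) \<subseteq> ?H ` ?T"
    proof
      fix f assume f: "f \<in> (\<Pi>\<^sub>E i\<in>I. carrier (M i))"
      have "\<forall>i\<in>I. \<exists>x. x \<in> S i \<and> f i = h i x"
      proof
        fix i assume i: "i \<in> I"
        then have "f i \<in> h i ` S i" using f c[OF i] by auto
        then show "\<exists>x. x \<in> S i \<and> f i = h i x" by blast
      qed
      then have "\<exists>g. \<forall>i\<in>I. g i \<in> S i \<and> f i = h i (g i)" by (rule bchoice)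
      then obtain g where g: "\<And>i. i \<in> I \<Longrightarrow> g i \<in> S i \<and> f i = h i (g i)" by blast
      have "f = ?H g"
      proof
        fix i
        show "f i = ?H g i"
        proof (cases "i \<in> I")
          case True
          then show ?thesis using g[OF True] by simp
        next
          case False
          then show ?thesis using PiE_arb[OF f False] by simp
        qed
      qed
      moreover have "g \<in> ?T" using g by simp
      ultimately show "f \<in> ?H ` ?T" by (rule image_eqI)
    qed
  qed
  ultimately show ?thesis
    unfolding lin_surj_def finite_direct_sum_def
    by (simp add: z a s cong: restrict_cong)
qed

section \<open>Smooth functions\<close>

lemma Ck_on_Suc_has_derivative:
  "Ck_on (Suc k) U f \<Longrightarrow> x \<in> U \<Longrightarrow> (f has_derivative frechet_derivative f (at x)) (at x)"
  by (simp add: frechet_derivative_works)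

lemma Ck_on_cong:
  assumes "open U" "\<And>x. x \<in> U \<Longrightarrow> f x = g x" "Ck_on k U f"
  shows "Ck_on k U g"
  using assms(2,3)
proof (induction k arbitrary: f g)
  case 0
  then show ?case by (simp cong: continuous_on_cong)
next
  case (Suc k)
  have D: "(g has_derivative frechet_derivative f (at x)) (at x)" if "x \<in> U" for x
    using has_derivative_transform_within_open[OF Ck_on_Suc_has_derivative[OF Suc.prems(2) that] assms(1) that]
      Suc.prems(1) by blast
  have "Ck_on k U (\<lambda>x. frechet_derivative g (at x) v)" for v
    by (rule Suc.IH[of "\<lambda>x. frechet_derivative f (at x) v"])
       (use frechet_derivative_at[OF D] Suc.prems(2) in auto)
  then show ?case unfolding Ck_on.simps using differentiableI[OF D] by blast
qed

lemma Ck_on_SucI: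
  assumes "open U" "\<And>x. x \<in> U \<Longrightarrow> (f has_derivative f' x) (at x)"
    "\<And>v. Ck_on k U (\<lambda>x. f' x v)"
  shows "Ck_on (Suc k) U f"
  unfolding Ck_on.simps
proof (intro conjI ballI allI)
  show "f differentiable at x" if "x \<in> U" for x
    using assms(2)[OF that] by (rule differentiableI)
  show "Ck_on k U (\<lambda>x. frechet_derivative f (at x) v)" for v
    by (rule Ck_on_cong[OF assms(1) _ assms(3)[of v]]) (use frechet_derivative_at[OF assms(2)] in simp)
qed

lemma Ck_on_Suc_imp: "Ck_on (Suc k) U f \<Longrightarrow> Ck_on k U f"
proof (induction k arbitrary: f)
  case 0
  then have "f differentiable_on U"
    unfolding differentiable_on_def using differentiable_at_withinI by auto
  then show ?case by (simp add: differentiable_imp_continuous_on)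
next
  case (Suc k)
  show ?case unfolding Ck_on.simps(2)[of k]
  proof (intro conjI allI)
    show "\<forall>x\<in>U. f differentiable at x" using Suc.prems unfolding Ck_on.simps(2) by blast
    fix v
    have "Ck_on (Suc k) U (\<lambda>x. frechet_derivative f (at x) v)"
      using Suc.prems unfolding Ck_on.simps(2)[of "Suc k"] by blast
    then show "Ck_on k U (\<lambda>x. frechet_derivative f (at x) v)" by (rule Suc.IH)
  qed
qed

lemma Ck_on_subset: "Ck_on k U f \<Longrightarrow> V \<subseteq> U \<Longrightarrow> Ck_on k V f"
proof (induction k arbitrary: f)
  case 0
  then show ?case by (simp add: continuous_on_subset)
next
  case (Suc k)
  then show ?case unfolding Ck_on.simps(2) by blast
qed

lemma Ck_on_Un:
  "open A \<Longrightarrow> open B \<Longrightarrow> Ck_on k A f \<Longrightarrow> Ck_on k B f \<Longrightarrow> Ck_on k (A \<union> B) f"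
proof (induction k arbitrary: f)
  case 0
  then show ?case by (simp add: continuous_on_open_Un)
next
  case (Suc k)
  then show ?case unfolding Ck_on.simps(2) by blast
qed

lemma Ck_on_const: "Ck_on k U (\<lambda>x. c)"
  by (induction k arbitrary: c) (auto simp: frechet_derivative_const)

lemma Ck_on_linear:
  assumes "open U" "bounded_linear f"
  shows "Ck_on k U f"
proof (cases k)
  case 0
  then show ?thesis using assms(2) by (simp add: linear_continuous_on)
next
  case (Suc k)
  show ?thesis unfolding Suc
    by (rule Ck_on_SucI[OF assms(1), where f' = "\<lambda>x. f"])
       (use assms bounded_linear_imp_has_derivative Ck_on_const in auto)
qed

lemma Ck_on_add:
  assumes "open U"
  shows "Ck_on k U f \<Longrightarrow> Ck_on k U g \<Longrightarrow> Ck_on k U (\<lambda>x. f x + g x)"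
proof (induction k arbitrary: f g)
  case 0
  then show ?case by (simp add: continuous_on_add)
next
  case (Suc k)
  show ?case
    by (rule Ck_on_SucI[OF assms has_derivative_add[OF Ck_on_Suc_has_derivative[OF Suc.prems(1)]
            Ck_on_Suc_has_derivative[OF Suc.prems(2)]]])
      (use Suc in auto)
qed

lemma Ck_on_mult:
  assumes "open U"
  shows "Ck_on k U f \<Longrightarrow> Ck_on k U g \<Longrightarrow> Ck_on k U (\<lambda>x. f x * g x)"
proof (induction k arbitrary: f g)
  case 0
  then show ?case by (simp add: continuous_on_mult)
next
  case (Suc k)
  note k = Ck_on_Suc_imp[OF Suc.prems(1)] Ck_on_Suc_imp[OF Suc.prems(2)]
  show ?case
    by (rule Ck_on_SucI[OF assms has_derivative_mult[OF Ck_on_Suc_has_derivative[OF Suc.prems(1)]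
            Ck_on_Suc_has_derivative[OF Suc.prems(2)]]])
      (use Suc k in \<open>auto intro!: Ck_on_add[OF assms]\<close>)
qed

lemma Ck_on_compose:
  assumes "open U" "g ` U \<subseteq> S"
    and F: "\<And>f. f \<in> F \<Longrightarrow> \<exists>f'\<in>F. \<forall>t\<in>S. (f has_real_derivative f' t) (at t)"
  shows "f \<in> F \<Longrightarrow> Ck_on k U g \<Longrightarrow> Ck_on k U (\<lambda>x. f (g x))"
proof (induction k arbitrary: f)
  case 0
  obtain f' where "\<forall>t\<in>S. (f has_real_derivative f' t) (at t)" using F 0 by blast
  then have "continuous_on S f"
    by (meson DERIV_isCont continuous_at_imp_continuous_on)
  then show ?case using 0 assms(2) continuous_on_compose2 by fastforce
next
  case (Suc k)
  obtain f' where f': "f' \<in> F" "\<forall>t\<in>S. (f has_real_derivative f' t) (at t)" using F Suc by blast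
  show ?case
  proof (rule Ck_on_SucI[OF assms(1)])
    fix x assume x: "x \<in> U"
    have "(f has_derivative (*) (f' (g x))) (at (g x))"
      using f'(2) x assms(2) by (auto simp: has_field_derivative_def)
    from has_derivative_compose[OF Ck_on_Suc_has_derivative[OF Suc.prems(2) x] this]
    show "((\<lambda>x. f (g x)) has_derivative (\<lambda>v. f' (g x) * frechet_derivative g (at x) v)) (at x)" .
  next
    fix v
    show "Ck_on k U (\<lambda>x. f' (g x) * frechet_derivative g (at x) v)"
      using Suc.IH[OF f'(1) Ck_on_Suc_imp[OF Suc.prems(2)]] Suc.prems(2)
      by (intro Ck_on_mult[OF assms(1)]) auto
  qed
qed

lemma smooth_on_cong:
  "open U \<Longrightarrow> (\<And>x. x \<in> U \<Longrightarrow> f x = g x) \<Longrightarrow> smooth_on U f \<Longrightarrow> smooth_on U g"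
  unfolding smooth_on_def using Ck_on_cong by blast

lemma smooth_on_has_derivative:
  "smooth_on U f \<Longrightarrow> x \<in> U \<Longrightarrow> (f has_derivative frechet_derivative f (at x)) (at x)"
  unfolding smooth_on_def using Ck_on_Suc_has_derivative by blast

lemma smooth_on_continuous_on: "smooth_on U f \<Longrightarrow> continuous_on U f"
  unfolding smooth_on_def by (metis Ck_on.simps(1))

lemma smooth_on_derivative: "smooth_on U f \<Longrightarrow> smooth_on U (\<lambda>x. frechet_derivative f (at x) v)"
  unfolding smooth_on_def by (metis Ck_on.simps(2))

lemma smooth_on_subset: "smooth_on U f \<Longrightarrow> V \<subseteq> U \<Longrightarrow> smooth_on V f"
  unfolding smooth_on_def using Ck_on_subset by blast

lemma smooth_on_Un: "open A \<Longrightarrow> open B \<Longrightarrow> smooth_on A f \<Longrightarrow> smooth_on B f \<Longrightarrow> smooth_on (A \<union> B) f"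
  unfolding smooth_on_def using Ck_on_Un by blast

lemma smooth_on_const: "smooth_on U (\<lambda>x. c)"
  unfolding smooth_on_def using Ck_on_const by blast

lemma smooth_on_linear: "open U \<Longrightarrow> bounded_linear f \<Longrightarrow> smooth_on U f"
  unfolding smooth_on_def using Ck_on_linear by blast

lemma smooth_on_add:
  "open U \<Longrightarrow> smooth_on U f \<Longrightarrow> smooth_on U g \<Longrightarrow> smooth_on U (\<lambda>x. f x + g x)"
  unfolding smooth_on_def using Ck_on_add by blast

lemma smooth_on_mult:
  "open U \<Longrightarrow> smooth_on U f \<Longrightarrow> smooth_on U g \<Longrightarrow> smooth_on U (\<lambda>x. f x * g x)"
  unfolding smooth_on_def using Ck_on_mult by blast

lemma smooth_on_diff:
  assumes "open U" "smooth_on U f" "smooth_on U g"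
  shows "smooth_on U (\<lambda>x. f x - g x)"
  using smooth_on_add[OF assms(1,2) smooth_on_mult[OF assms(1) smooth_on_const[of U "-1"] assms(3)]]
  by simp

lemma smooth_on_sum:
  assumes "open U" "\<And>i. i \<in> I \<Longrightarrow> smooth_on U (f i)"
  shows "smooth_on U (\<lambda>x. \<Sum>i\<in>I. f i x)"
  using assms(2)
  by (induction I rule: infinite_finite_induct) (auto intro: smooth_on_const smooth_on_add[OF assms(1)])

lemma smooth_on_prod:
  assumes "open U" "\<And>i. i \<in> I \<Longrightarrow> smooth_on U (f i)"
  shows "smooth_on U (\<lambda>x. \<Prod>i\<in>I. f i x)"
  using assms(2)
  by (induction I rule: infinite_finite_induct) (auto intro: smooth_on_const smooth_on_mult[OF assms(1)])

lemma smooth_on_compose: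
  assumes "open U" "g ` U \<subseteq> S"
    and "\<And>f. f \<in> F \<Longrightarrow> \<exists>f'\<in>F. \<forall>t\<in>S. (f has_real_derivative f' t) (at t)"
    and "f \<in> F" "smooth_on U g"
  shows "smooth_on U (\<lambda>x. f (g x))"
  unfolding smooth_on_def using Ck_on_compose[OF assms(1-4)] assms(5)[unfolded smooth_on_def] by blast

lemma smooth_on_inverse:
  fixes g :: "'a::real_normed_vector \<Rightarrow> real"
  assumes "open U" "\<And>x. x \<in> U \<Longrightarrow> g x \<noteq> 0" "smooth_on U g"
  shows "smooth_on U (\<lambda>x. inverse (g x))"
proof -
  define F where "F = range (\<lambda>(c, n) t. c * inverse (t ^ n :: real))"
  show ?thesis
  proof (rule smooth_on_compose[OF assms(1), where f = inverse and S = "- {0}" and F = F])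
    show "inverse \<in> F" unfolding F_def by (rule image_eqI[of _ _ "(1, 1)"]) auto
    fix f assume "f \<in> F"
    then obtain c n where f: "f = (\<lambda>t. c * inverse (t ^ n))" by (auto simp: F_def)
    have "(f has_real_derivative - c * n * inverse (t ^ (n + 1))) (at t)" if "t \<noteq> 0" for t
      unfolding f using that
      by (auto intro!: derivative_eq_intros simp: field_simps power2_eq_square)
         (cases n; simp add: field_simps)
    moreover have "(\<lambda>t. (- c * n) * inverse (t ^ (n + 1))) \<in> F"
      unfolding F_def by (rule image_eqI[of _ _ "(- c * n, n + 1)"]) auto
    ultimately show "\<exists>f'\<in>F. \<forall>t\<in>- {0}. (f has_real_derivative f' t) (at t)"
      by (intro bexI[of _ "\<lambda>t. (- c * n) * inverse (t ^ (n + 1))"]) auto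
  qed (use assms in auto)
qed

definition flat :: "real \<Rightarrow> real" where
  "flat t = (if t > 0 then exp (- inverse t) else 0)"

lemma flat_pos_iff: "flat t > 0 \<longleftrightarrow> t > 0"
  and flat_nonneg: "flat t \<ge> 0"
  and flat_eq_0_iff: "flat t = 0 \<longleftrightarrow> t \<le> 0"
  by (auto simp: flat_def)

lemma tendsto_poly_exp_0: "((\<lambda>u. poly P u * exp (- u)) \<longlongrightarrow> (0::real)) at_top"
proof -
  have "((\<lambda>u::real. \<Sum>i\<le>degree P. coeff P i * (u ^ i / exp u)) \<longlongrightarrow> (\<Sum>i\<le>degree P. coeff P i * 0)) at_top"
    by (intro tendsto_sum tendsto_mult tendsto_const tendsto_power_div_exp_0)
  then show ?thesis
    by (simp add: poly_altdef sum_divide_distrib exp_minus divide_inverse[symmetric])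
qed

lemma smooth_on_flat:
  assumes "open U" "smooth_on U g"
  shows "smooth_on U (\<lambda>x. flat (g x))"
proof -
  define G where "G P t = (if t > 0 then poly P (inverse t) * exp (- inverse t) else 0)" for P and t :: real
  have deriv: "(G P has_real_derivative G ([:0, 0, 1:] * (P - pderiv P)) t) (at t)" for P t
  proof -
    consider "t > 0" | "t < 0" | "t = 0" by linarith
    then show ?thesis
    proof cases
      case 1
      have "((\<lambda>t. poly P (inverse t) * exp (- inverse t)) has_real_derivative
          G ([:0, 0, 1:] * (P - pderiv P)) t) (at t)"
        using 1 by (auto intro!: derivative_eq_intros simp: G_def field_simps power2_eq_square)
      then show ?thesis
        by (rule has_field_derivative_transform_within_open[where S = "{0<..}"]) (use 1 in \<open>auto simp: G_def\<close>)
    next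
      case 2
      have "((\<lambda>t. 0) has_real_derivative G ([:0, 0, 1:] * (P - pderiv P)) t) (at t)"
        using 2 by (auto simp: G_def)
      then show ?thesis
        by (rule has_field_derivative_transform_within_open[where S = "{..<0}"]) (use 2 in \<open>auto simp: G_def\<close>)
    next
      case 3
      have "((\<lambda>h. poly ([:0, 1:] * P) (inverse h) * exp (- inverse h)) \<longlongrightarrow> 0) (at_right 0)"
        by (rule filterlim_compose[OF tendsto_poly_exp_0 filterlim_inverse_at_top_right])
      then have "((\<lambda>h. G P h / h) \<longlongrightarrow> 0) (at_right 0)"
        by (rule Lim_transform_eventually)
           (auto simp: G_def eventually_at_right_less divide_inverse intro!: eventually_at_rightI[of 0 1])
      moreover have "((\<lambda>h. G P h / h) \<longlongrightarrow> 0) (at_left 0)"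
        by (rule Lim_transform_eventually[of "\<lambda>_. 0"])
           (auto simp: G_def intro!: eventually_at_leftI[of "-1"])
      ultimately have "((\<lambda>h. G P h / h) \<longlongrightarrow> 0) (at 0)" by (simp add: filterlim_at_split)
      then show ?thesis using 3 by (simp add: DERIV_def G_def)
    qed
  qed
  have "smooth_on U (\<lambda>x. G [:1:] (g x))"
    by (rule smooth_on_compose[OF assms(1), where S = UNIV and F = "range G"]) (use deriv assms in auto)
  moreover have "G [:1:] = flat" by (auto simp: G_def flat_def)
  ultimately show ?thesis by simp
qed

lemma has_derivative_along_line:
  assumes "(f has_derivative f') (at (p + t *\<^sub>R v))"
  shows "((\<lambda>t. f (p + t *\<^sub>R v)) has_real_derivative f' v) (at t)"
proof -
  have "((\<lambda>t. p + t *\<^sub>R v) has_derivative (\<lambda>h. h *\<^sub>R v)) (at t)"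
    by (auto intro!: derivative_eq_intros)
  from has_derivative_compose[OF this assms]
  have "((\<lambda>t. f (p + t *\<^sub>R v)) has_derivative (\<lambda>h. f' (h *\<^sub>R v))) (at t)" .
  moreover have "f' (h *\<^sub>R v) = f' v * h" for h
    using has_derivative_linear[OF assms] by (simp add: linear_scale)
  ultimately show ?thesis unfolding has_field_derivative_def by simp
qed

lemma second_difference:
  fixes f :: "'a::real_normed_vector \<Rightarrow> real"
  assumes f: "\<And>y. dist x y < d \<Longrightarrow> (f has_derivative f' y) (at y)"
    and f2: "\<And>y. dist x y < d \<Longrightarrow> ((\<lambda>y. f' y v) has_derivative f'' y) (at y)"
    and s: "s > 0" "s * (norm v + norm w) < d"
  obtains y where "dist x y < d"
    "f (x + s *\<^sub>R v + s *\<^sub>R w) - f (x + s *\<^sub>R v) - f (x + s *\<^sub>R w) + f x = s * s * f'' y w"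
proof -
  have near: "dist x (x + a *\<^sub>R v + b *\<^sub>R w) < d" if "0 \<le> a" "a \<le> s" "0 \<le> b" "b \<le> s" for a b
  proof -
    have "norm (a *\<^sub>R v + b *\<^sub>R w) \<le> a * norm v + b * norm w"
      using norm_triangle_ineq[of "a *\<^sub>R v" "b *\<^sub>R w"] that by simp
    also have "\<dots> \<le> s * norm v + s * norm w"
      using that by (intro add_mono mult_right_mono) auto
    finally have "norm (a *\<^sub>R v + b *\<^sub>R w) < d" using s by (simp add: algebra_simps)
    moreover have "dist x (x + a *\<^sub>R v + b *\<^sub>R w) = norm (a *\<^sub>R v + b *\<^sub>R w)"
      using norm_minus_cancel[of "a *\<^sub>R v + b *\<^sub>R w"] by (simp add: dist_norm)
    ultimately show ?thesis by simp
  qed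
  define g where "g t = f ((x + s *\<^sub>R w) + t *\<^sub>R v) - f (x + t *\<^sub>R v)" for t
  have "\<exists>z. 0 < z \<and> z < s \<and> g s - g 0 =
      (s - 0) * (f' ((x + s *\<^sub>R w) + z *\<^sub>R v) v - f' (x + z *\<^sub>R v) v)"
    unfolding g_def
  proof (rule MVT2[OF s(1)])
    fix t assume t: "0 \<le> t" "t \<le> s"
    show "((\<lambda>t. f ((x + s *\<^sub>R w) + t *\<^sub>R v) - f (x + t *\<^sub>R v)) has_real_derivative
        (f' ((x + s *\<^sub>R w) + t *\<^sub>R v) v - f' (x + t *\<^sub>R v) v)) (at t)"
      using near[of t s] near[of t 0] t s
      by (intro DERIV_diff has_derivative_along_line f) (auto simp: algebra_simps)
  qed
  then obtain z where z: "0 < z" "z < s" "g s - g 0 =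
      s * (f' ((x + s *\<^sub>R w) + z *\<^sub>R v) v - f' (x + z *\<^sub>R v) v)" by auto
  have "\<exists>u. 0 < u \<and> u < s \<and> f' ((x + z *\<^sub>R v) + s *\<^sub>R w) v - f' ((x + z *\<^sub>R v) + 0 *\<^sub>R w) v =
      (s - 0) * f'' ((x + z *\<^sub>R v) + u *\<^sub>R w) w"
  proof (rule MVT2[OF s(1)])
    fix t assume t: "0 \<le> t" "t \<le> s"
    show "((\<lambda>t. f' ((x + z *\<^sub>R v) + t *\<^sub>R w) v) has_real_derivative
        f'' ((x + z *\<^sub>R v) + t *\<^sub>R w) w) (at t)"
      using near[of z t] t z by (intro has_derivative_along_line f2) auto
  qed
  then obtain u where u: "0 < u" "u < s" "f' ((x + z *\<^sub>R v) + s *\<^sub>R w) v - f' (x + z *\<^sub>R v) v =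
      s * f'' ((x + z *\<^sub>R v) + u *\<^sub>R w) w" by auto
  show ?thesis
  proof (rule that[of "x + z *\<^sub>R v + u *\<^sub>R w"])
    show "dist x (x + z *\<^sub>R v + u *\<^sub>R w) < d" using near[of z u] z u by auto
    show "f (x + s *\<^sub>R v + s *\<^sub>R w) - f (x + s *\<^sub>R v) - f (x + s *\<^sub>R w) + f x
        = s * s * f'' (x + z *\<^sub>R v + u *\<^sub>R w) w"
      using z(3) u(3) unfolding g_def by (simp add: algebra_simps)
  qed
qed

lemma symmetric_second_derivative:
  fixes f :: "'a::real_normed_vector \<Rightarrow> real"
  assumes "smooth_on U f" "open U" "x \<in> U"
  shows "frechet_derivative (\<lambda>y. frechet_derivative f (at y) v) (at x) w =
    frechet_derivative (\<lambda>y. frechet_derivative f (at y) w) (at x) v"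
proof -
  define D where "D v y = frechet_derivative f (at y) v" for v y
  define D2 where "D2 v w y = frechet_derivative (D v) (at y) w" for v w y
  have D: "smooth_on U (D v)" for v unfolding D_def by (rule smooth_on_derivative[OF assms(1)])
  have "continuous_on U (D2 v w)" for v w
    unfolding D2_def by (rule smooth_on_continuous_on[OF smooth_on_derivative[OF D]])
  then have cont: "isCont (D2 v w) x" for v w using assms by (simp add: continuous_on_eq_continuous_at)
  have "\<bar>D2 v w x - D2 w v x\<bar> \<le> e" if e: "e > 0" for e
  proof -
    have ev: "eventually (\<lambda>y. dist (D2 a b y) (D2 a b x) < e / 2) (nhds x)" for a b
      using cont[of a b] e unfolding isCont_def tendsto_at_iff_tendsto_nhds
      by (intro tendstoD) auto
    have "eventually (\<lambda>y. y \<in> U) (nhds x)" using assms eventually_nhds by blast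
    then have "eventually (\<lambda>y. y \<in> U \<and> dist (D2 v w y) (D2 v w x) < e / 2
        \<and> dist (D2 w v y) (D2 w v x) < e / 2) (nhds x)"
      using ev[of v w] ev[of w v] by eventually_elim auto
    then obtain d where d: "d > 0" "\<And>y. dist x y < d \<Longrightarrow> y \<in> U \<and> dist (D2 v w y) (D2 v w x) < e / 2
        \<and> dist (D2 w v y) (D2 w v x) < e / 2"
      unfolding eventually_nhds_metric by (metis dist_commute)
    define s where "s = d / (norm v + norm w + 1)"
    have n: "norm v + norm w + 1 > 0" using norm_ge_zero[of v] norm_ge_zero[of w] by linarith
    have s: "s > 0" using d(1) n by (simp add: s_def)
    moreover have "s * (norm v + norm w + 1) = d" using n by (simp add: s_def)
    ultimately have s: "s > 0" "s * (norm v + norm w) < d" "s * (norm w + norm v) < d"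
      by (auto simp: algebra_simps)
    have f1: "(f has_derivative (\<lambda>v. D v y)) (at y)" if "dist x y < d" for y
      using smooth_on_has_derivative[OF assms(1)] d(2)[OF that] unfolding D_def by auto
    have f2: "(D v has_derivative (\<lambda>w. D2 v w y)) (at y)" if "dist x y < d" for y v
      using smooth_on_has_derivative[OF D] d(2)[OF that] unfolding D2_def by auto
    obtain y where y: "dist x y < d" "f (x + s *\<^sub>R v + s *\<^sub>R w) - f (x + s *\<^sub>R v) - f (x + s *\<^sub>R w) + f x
        = s * s * D2 v w y"
      using second_difference[of x d f "\<lambda>y v. D v y" v "\<lambda>y w. D2 v w y" s w] f1 f2 s by auto
    obtain z where z: "dist x z < d" "f (x + s *\<^sub>R w + s *\<^sub>R v) - f (x + s *\<^sub>R w) - f (x + s *\<^sub>R v) + f x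
        = s * s * D2 w v z"
      using second_difference[of x d f "\<lambda>y v. D v y" w "\<lambda>y v. D2 w v y" s v] f1 f2 s by auto
    have "s * s * D2 v w y = s * s * D2 w v z"
      using y(2) z(2) by (simp add: algebra_simps)
    then have "D2 v w y = D2 w v z" using s by simp
    moreover have "dist (D2 v w y) (D2 v w x) < e / 2" "dist (D2 w v z) (D2 w v x) < e / 2"
      using d(2) y(1) z(1) by auto
    ultimately show ?thesis by (simp add: dist_real_def abs_if split: if_splits)
  qed
  then have "\<bar>D2 v w x - D2 w v x\<bar> \<le> 0" by (rule field_le_epsilon) auto
  then show ?thesis by (simp add: D2_def D_def[abs_def])
qed

lemma has_derivative_cone_integral:
  fixes f :: "'a::euclidean_space \<Rightarrow> real"
  assumes U: "open U" and star: "\<And>x t. x \<in> U \<Longrightarrow> t \<in> {0..1} \<Longrightarrow> x0 + t *\<^sub>R (x - x0) \<in> U"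
    and f: "Ck_on (Suc 0) U f" and x: "x \<in> U"
  shows "((\<lambda>x. integral {0..1} (\<lambda>t. t ^ n * f (x0 + t *\<^sub>R (x - x0)))) has_derivative
    (\<lambda>v. integral {0..1} (\<lambda>t. t ^ Suc n * frechet_derivative f (at (x0 + t *\<^sub>R (x - x0))) v))) (at x)"
proof -
  define D where "D y = Blinfun (frechet_derivative f (at y))" for y
  have fd: "(f has_derivative frechet_derivative f (at y)) (at y)" if "y \<in> U" for y
    using Ck_on_Suc_has_derivative[OF f that] .
  have D: "blinfun_apply (D y) = frechet_derivative f (at y)" if "y \<in> U" for y
    unfolding D_def using fd[OF that] by (intro bounded_linear_Blinfun_apply) (rule has_derivative_bounded_linear)
  obtain r where r: "r > 0" "ball x r \<subseteq> U" using U x open_contains_ball by blast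
  let ?B = "ball x r" and ?m = "\<lambda>(x, t). x0 + t *\<^sub>R (x - x0)"
  have inU: "x0 + t *\<^sub>R (y - x0) \<in> U" if "y \<in> ?B" "t \<in> {0..1}" for y t
    using star that r by blast
  have cm: "continuous_on (?B \<times> {0..1}) ?m"
    by (auto simp: split_beta intro!: continuous_intros)
  have im: "?m ` (?B \<times> {0..1}) \<subseteq> U" using inU by auto
  have cf: "continuous_on U f" using Ck_on_Suc_imp[OF f] by simp
  let ?fx = "\<lambda>y t. t ^ Suc n *\<^sub>R D (x0 + t *\<^sub>R (y - x0))"
  have cD: "continuous_on (?B \<times> cbox 0 1) (\<lambda>(y, t). ?fx y t)"
  proof (rule continuous_on_blinfun_componentwise)
    fix b :: 'a assume "b \<in> Basis"
    have "continuous_on U (\<lambda>y. frechet_derivative f (at y) b)" using f by simp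
    then have "continuous_on (?B \<times> {0..1}) (\<lambda>p. frechet_derivative f (at (?m p)) b)"
      by (rule continuous_on_compose2[OF _ cm im])
    then have "continuous_on (?B \<times> {0..1})
        (\<lambda>p. snd p ^ Suc n * frechet_derivative f (at (?m p)) b)"
      by (intro continuous_intros)
    then show "continuous_on (?B \<times> cbox 0 1) (\<lambda>p. blinfun_apply (case p of (y, t) \<Rightarrow> ?fx y t) b)"
      unfolding cbox_interval by (rule continuous_on_eq) (use inU D in \<open>auto simp: blinfun.scaleR_left\<close>)
  qed
  have "((\<lambda>y. integral (cbox 0 1) (\<lambda>t. t ^ n * f (x0 + t *\<^sub>R (y - x0)))) has_derivative
      blinfun_apply (integral (cbox 0 1) (?fx x))) (at x within ?B)"
  proof (rule leibniz_rule)
    fix y and t :: real assume y: "y \<in> ?B" and t: "t \<in> cbox 0 1"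
    have "((\<lambda>y. x0 + t *\<^sub>R (y - x0)) has_derivative (\<lambda>v. t *\<^sub>R v)) (at y within ?B)"
      by (auto intro!: derivative_eq_intros)
    moreover have "(f has_derivative frechet_derivative f (at (x0 + t *\<^sub>R (y - x0))))
        (at (x0 + t *\<^sub>R (y - x0)))" using fd inU y t by auto
    ultimately have "((\<lambda>y. f (x0 + t *\<^sub>R (y - x0))) has_derivative
        (\<lambda>v. frechet_derivative f (at (x0 + t *\<^sub>R (y - x0))) (t *\<^sub>R v))) (at y within ?B)"
      by (rule has_derivative_compose)
    then have "((\<lambda>y. t ^ n * f (x0 + t *\<^sub>R (y - x0))) has_derivative
        (\<lambda>v. t ^ n * frechet_derivative f (at (x0 + t *\<^sub>R (y - x0))) (t *\<^sub>R v))) (at y within ?B)"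
      by (rule has_derivative_mult_right)
    moreover have "t ^ n * frechet_derivative f (at (x0 + t *\<^sub>R (y - x0))) (t *\<^sub>R v)
        = blinfun_apply (?fx y t) v" for v
      using D[OF inU[OF y]] t by (auto simp: blinfun.scaleR_left blinfun.scaleR_right simp flip: D[OF inU[OF y]])
    ultimately show "((\<lambda>y. t ^ n * f (x0 + t *\<^sub>R (y - x0))) has_derivative blinfun_apply (?fx y t))
        (at y within ?B)" by simp
  next
    fix y assume y: "y \<in> ?B"
    have "continuous_on {0..1} (\<lambda>t. f (x0 + t *\<^sub>R (y - x0)))"
      by (rule continuous_on_compose2[OF cf]) (use inU y in \<open>auto intro!: continuous_intros\<close>)
    then show "(\<lambda>t. t ^ n * f (x0 + t *\<^sub>R (y - x0))) integrable_on cbox 0 1"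
      by (auto intro!: integrable_continuous_interval continuous_intros)
  qed (use cD r in auto)
  then have *: "((\<lambda>y. integral {0..1} (\<lambda>t. t ^ n * f (x0 + t *\<^sub>R (y - x0)))) has_derivative
      blinfun_apply (integral {0..1} (?fx x))) (at x)"
    using r(1) by (simp add: at_within_open[of x ?B])
  have "continuous_on {0..1} (?fx x)"
  proof -
    have "(\<lambda>t::real. (x, t)) ` {0..1} \<subseteq> ?B \<times> cbox 0 1" using r(1) by auto
    from continuous_on_compose2[OF cD continuous_on_Pair[OF continuous_on_const continuous_on_id] this]
    show ?thesis by simp
  qed
  then have "?fx x integrable_on {0..1}" by (rule integrable_continuous_interval)
  then have "blinfun_apply (integral {0..1} (?fx x)) v = integral {0..1} (\<lambda>t. blinfun_apply (?fx x t) v)" for v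
    by (rule blinfun_apply_integral)
  also have "\<dots> v = integral {0..1} (\<lambda>t. t ^ Suc n * frechet_derivative f (at (x0 + t *\<^sub>R (x - x0))) v)" for v
    using D star x by (intro integral_cong) (auto simp: blinfun.scaleR_left)
  finally show ?thesis using * by presburger
qed

lemma Ck_on_cone_integral:
  fixes f :: "'a::euclidean_space \<Rightarrow> real"
  assumes U: "open U" and star: "\<And>x t. x \<in> U \<Longrightarrow> t \<in> {0..1} \<Longrightarrow> x0 + t *\<^sub>R (x - x0) \<in> U"
  shows "Ck_on k U f \<Longrightarrow> Ck_on k U (\<lambda>x. integral {0..1} (\<lambda>t. t ^ n * f (x0 + t *\<^sub>R (x - x0))))"
proof (induction k arbitrary: f n)
  case 0
  let ?g = "\<lambda>p. snd p ^ n * f (x0 + snd p *\<^sub>R (fst p - x0))"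
  have "continuous_on (U \<times> cbox 0 1) (\<lambda>p. f (x0 + snd p *\<^sub>R (fst p - x0)))"
    by (rule continuous_on_compose2[of U f]) (use 0 star in \<open>auto intro!: continuous_intros\<close>)
  then have "continuous_on (U \<times> cbox 0 1) (\<lambda>(x, t). t ^ n * f (x0 + t *\<^sub>R (x - x0)))"
    unfolding split_beta by (intro continuous_intros)
  then show ?case using integral_continuous_on_param[of U 0 "1::real"] by simp
next
  case (Suc k)
  have 1: "Ck_on (Suc 0) U f"
    using Suc.prems by (induction k) (auto dest: Ck_on_Suc_imp simp del: Ck_on.simps)
  show ?case
  proof (rule Ck_on_SucI[OF U has_derivative_cone_integral[OF U star 1]])
    fix v
    show "Ck_on k U (\<lambda>x. integral {0..1} (\<lambda>t. t ^ Suc n * frechet_derivative f (at (x0 + t *\<^sub>R (x - x0))) v))"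
      by (rule Suc.IH) (use Suc.prems in simp)
  qed
qed

lemma smooth_on_cone_integral:
  fixes f :: "'a::euclidean_space \<Rightarrow> real"
  assumes "open U" "\<And>x t. x \<in> U \<Longrightarrow> t \<in> {0..1} \<Longrightarrow> x0 + t *\<^sub>R (x - x0) \<in> U" "smooth_on U f"
  shows "smooth_on U (\<lambda>x. integral {0..1} (\<lambda>t. t ^ n * f (x0 + t *\<^sub>R (x - x0))))"
  using Ck_on_cone_integral assms unfolding smooth_on_def by blast

section \<open>Alternating forms\<close>

lemma length_omit [simp]: "i < length xs \<Longrightarrow> length (omit i xs) = length xs - 1"
  by (auto simp: omit_def)

lemma nth_omit: "i < length xs \<Longrightarrow> j < length xs - 1 \<Longrightarrow> omit i xs ! j = xs ! (if j < i then j else Suc j)"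
  by (auto simp: omit_def nth_append min_def)

lemma omit_Cons_0 [simp]: "omit 0 (x # xs) = xs"
  and omit_Cons_Suc [simp]: "omit (Suc i) (x # xs) = x # omit i xs"
  by (auto simp: omit_def)

lemma set_omit_subset: "set (omit i xs) \<subseteq> set xs"
  by (auto simp: omit_def dest: in_set_takeD in_set_dropD)

lemma omit_list_update:
  assumes "i < length xs" "j < length xs" "i \<noteq> j"
  shows "omit i (xs[j := u]) = (omit i xs)[(if j < i then j else j - 1) := u]"
  by (rule nth_equalityI) (use assms in \<open>auto simp: nth_omit nth_list_update\<close>)

lemma omit_list_update_same: "omit i (xs[i := u]) = omit i xs"
  by (auto simp: omit_def)

lemma omit_omit:
  assumes "i \<le> j" "Suc j < length xs"
  shows "omit j (omit i xs) = omit i (omit (Suc j) xs)"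
  by (rule nth_equalityI) (use assms in \<open>auto simp: nth_omit\<close>)

lemma alternating_form_linear:
  assumes "alternating_form n f" "length xs + Suc (length ys) = n"
  shows "linear (\<lambda>u. f (xs @ u # ys))"
proof -
  have "linear (\<lambda>u. f ((xs @ undefined # ys)[length xs := u]))"
    using assms unfolding alternating_form_def by (metis length_Cons length_append less_add_Suc1 add_Suc_right)
  then show ?thesis by simp
qed

lemma alternating_form_eq:
  assumes "alternating_form n f" "length (xs @ a # ys @ a # zs) = n"
  shows "f (xs @ a # ys @ a # zs) = 0"
proof -
  have "(xs @ a # ys @ a # zs) ! length xs = (xs @ a # ys @ a # zs) ! (Suc (length xs + length ys))"
    using nth_append_length[of "xs @ a # ys" a zs] nth_append_length[of xs a "ys @ a # zs"] by simp
  moreover have "Suc (length xs + length ys) < n" using assms(2) by simp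
  moreover have "length xs < Suc (length xs + length ys)" by simp
  ultimately show ?thesis using assms unfolding alternating_form_def by blast
qed

lemma alternating_form_swap:
  assumes f: "alternating_form n f" and n: "length (xs @ a # b # ys) = n"
  shows "f (xs @ a # b # ys) = - f (xs @ b # a # ys)"
proof -
  have 1: "linear (\<lambda>u. f (xs @ u # c # ys))" for c
    using alternating_form_linear[OF f, of xs "c # ys"] n by simp
  have 2: "linear (\<lambda>u. f (xs @ c # u # ys))" for c
    using alternating_form_linear[OF f, of "xs @ [c]" ys] n by simp
  have 0: "f (xs @ c # c # ys) = 0" for c
    using alternating_form_eq[OF f, of xs c "[]" ys] n by simp
  have "f (xs @ (a + b) # (a + b) # ys) = f (xs @ a # b # ys) + f (xs @ b # a # ys)"
    using linear_add[OF 1] linear_add[OF 2] 0[of a] 0[of b] by simp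
  then show ?thesis using 0[of "a + b"] by simp
qed

lemma alternating_form_move:
  assumes "alternating_form n f" "length (us @ v # ws) = n"
  shows "f (us @ v # ws) = (-1) ^ length us * f (v # us @ ws)"
  using assms(2)
proof (induction us arbitrary: ws rule: rev_induct)
  case (snoc u us)
  have "f ((us @ [u]) @ v # ws) = - f (us @ v # u # ws)"
    using alternating_form_swap[OF assms(1), of us u v ws] snoc.prems by simp
  also have "f (us @ v # u # ws) = (-1) ^ length us * f (v # us @ u # ws)"
    using snoc by simp
  finally show ?case by simp
qed simp

lemma alternating_form_nth_omit:
  assumes "alternating_form n f" "length vs = n" "i < n"
  shows "f (vs ! i # omit i vs) = (-1) ^ i * f vs"
proof -
  have "f vs = f (take i vs @ vs ! i # drop (Suc i) vs)"
    using assms by (simp add: id_take_nth_drop[symmetric])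
  also have "\<dots> = (-1) ^ i * f (vs ! i # omit i vs)"
    using alternating_form_move[OF assms(1), of "take i vs" "vs ! i" "drop (Suc i) vs"] assms
    by (simp add: omit_def)
  finally show ?thesis by (simp add: power_mult_distrib[symmetric] mult.assoc[symmetric] power_add[symmetric])
qed

lemma alternating_form_sum:
  assumes "\<And>i. i \<in> I \<Longrightarrow> alternating_form n (f i)"
  shows "alternating_form n (\<lambda>vs. \<Sum>i\<in>I. c i * f i vs)"
proof -
  have "linear (\<lambda>u. \<Sum>i\<in>I. c i * f i (vs[j := u]))" if "length vs = n" "j < n" for vs j
  proof (rule linear_compose_sum, rule ballI)
    fix i assume "i \<in> I"
    then have "linear (\<lambda>u. f i (vs[j := u]))" using assms that unfolding alternating_form_def by blast
    from linear_compose_scale_right[OF this, of "c i"]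
    show "linear (\<lambda>u. c i * f i (vs[j := u]))" by simp
  qed
  moreover have "(\<Sum>i\<in>I. c i * f i vs) = 0"
    if "length vs = n" "a < b" "b < n" "vs ! a = vs ! b" for vs a b
  proof (rule sum.neutral, rule ballI)
    fix i assume "i \<in> I"
    then have "f i vs = 0" using assms that unfolding alternating_form_def by blast
    then show "c i * f i vs = 0" by simp
  qed
  ultimately show ?thesis unfolding alternating_form_def by blast
qed

lemma alternating_form_add:
  assumes "alternating_form n f" "alternating_form n g"
  shows "alternating_form n (\<lambda>vs. f vs + g vs)"
  using alternating_form_sum[of "{True, False}" n "\<lambda>b. if b then f else g" "\<lambda>_. 1"] assms by auto

lemma alternating_form_scale:
  assumes "alternating_form n f"
  shows "alternating_form n (\<lambda>vs. c * f vs)"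
  using alternating_form_sum[of "{()}" n "\<lambda>_. f" "\<lambda>_. c"] assms by auto

lemma alternating_form_0: "alternating_form n (\<lambda>_. 0)"
  using alternating_form_sum[of "{}"] by simp

lemma alternating_form_Cons:
  assumes "alternating_form (Suc n) f"
  shows "alternating_form n (\<lambda>vs. f (v # vs))"
proof -
  have "linear (\<lambda>u. f (v # vs[i := u]))" if "length vs = n" "i < n" for vs i
  proof -
    have "linear (\<lambda>u. f ((v # vs)[Suc i := u]))"
      using assms that unfolding alternating_form_def by (metis Suc_less_eq length_Cons)
    then show ?thesis by simp
  qed
  moreover have "f (v # vs) = 0" if "length vs = n" "i < j" "j < n" "vs ! i = vs ! j" for vs i j
    using assms that unfolding alternating_form_def
    by (metis Suc_less_eq length_Cons nth_Cons_Suc)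
  ultimately show ?thesis unfolding alternating_form_def by blast
qed

lemma alternating_form_derivative:
  assumes U: "open U" "x \<in> U"
    and alt: "\<And>y. y \<in> U \<Longrightarrow> alternating_form n (F y)"
    and diff: "\<And>vs. length vs = n \<Longrightarrow> (\<lambda>y. F y vs) differentiable (at x)"
  shows "alternating_form n (\<lambda>vs. frechet_derivative (\<lambda>y. F y vs) (at x) v)"
proof -
  note D = diff[unfolded frechet_derivative_works]
  have lin: "linear (\<lambda>u. F y (vs[i := u]))" if "length vs = n" "i < n" "y \<in> U" for vs i y
    using alt that unfolding alternating_form_def by blast
  have "linear (\<lambda>u. frechet_derivative (\<lambda>y. F y (vs[i := u])) (at x) v)"
    if vs: "length vs = n" "i < n" for vs i
  proof (rule linearI)
    fix a b
    have "((\<lambda>y. F y (vs[i := a]) + F y (vs[i := b])) has_derivative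
        (\<lambda>v. frechet_derivative (\<lambda>y. F y (vs[i := a])) (at x) v
           + frechet_derivative (\<lambda>y. F y (vs[i := b])) (at x) v)) (at x)"
      using D vs by (intro has_derivative_add) auto
    then have "((\<lambda>y. F y (vs[i := a + b])) has_derivative
        (\<lambda>v. frechet_derivative (\<lambda>y. F y (vs[i := a])) (at x) v
           + frechet_derivative (\<lambda>y. F y (vs[i := b])) (at x) v)) (at x)"
      by (rule has_derivative_transform_within_open[OF _ U]) (use linear_add[OF lin[OF vs]] in auto)
    from frechet_derivative_at[OF this]
    show "frechet_derivative (\<lambda>y. F y (vs[i := a + b])) (at x) v =
        frechet_derivative (\<lambda>y. F y (vs[i := a])) (at x) v
           + frechet_derivative (\<lambda>y. F y (vs[i := b])) (at x) v" by metis
  next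
    fix c a
    have "((\<lambda>y. c * F y (vs[i := a])) has_derivative
        (\<lambda>v. c * frechet_derivative (\<lambda>y. F y (vs[i := a])) (at x) v)) (at x)"
      using D vs by (intro has_derivative_mult_right) auto
    then have "((\<lambda>y. F y (vs[i := c *\<^sub>R a])) has_derivative
        (\<lambda>v. c * frechet_derivative (\<lambda>y. F y (vs[i := a])) (at x) v)) (at x)"
      by (rule has_derivative_transform_within_open[OF _ U]) (use linear_scale[OF lin[OF vs]] in auto)
    from frechet_derivative_at[OF this]
    show "frechet_derivative (\<lambda>y. F y (vs[i := c *\<^sub>R a])) (at x) v =
        c *\<^sub>R frechet_derivative (\<lambda>y. F y (vs[i := a])) (at x) v" by (metis real_scaleR_def)
  qed
  moreover have "frechet_derivative (\<lambda>y. F y vs) (at x) v = 0"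
    if vs: "length vs = n" "i < j" "j < n" "vs ! i = vs ! j" for vs i j
  proof -
    have "((\<lambda>y. 0) has_derivative (\<lambda>v. 0)) (at x)" by simp
    then have "((\<lambda>y. F y vs) has_derivative (\<lambda>v. 0)) (at x)"
      by (rule has_derivative_transform_within_open[OF _ U])
         (use alt vs in \<open>unfold alternating_form_def, metis\<close>)
    from frechet_derivative_at[OF this] show ?thesis by metis
  qed
  ultimately show ?thesis unfolding alternating_form_def by blast
qed

lemma alternating_form_alternating_sum:
  assumes lin: "\<And>us. length us = p \<Longrightarrow> linear (G us)"
    and alt: "\<And>v. alternating_form p (\<lambda>us. G us v)"
  shows "alternating_form (Suc p) (\<lambda>vs. \<Sum>i<length vs. (-1) ^ i * G (omit i vs) (vs ! i))"
proof -
  have "linear (\<lambda>u. \<Sum>i<length (vs[j := u]). (-1) ^ i * G (omit i (vs[j := u])) (vs[j := u] ! i))"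
    if vs: "length vs = Suc p" "j < Suc p" for vs j
  proof -
    have "linear (\<lambda>u. (-1) ^ i * G (omit i (vs[j := u])) (vs[j := u] ! i))" if i: "i < Suc p" for i
    proof -
      have "linear (\<lambda>u. G (omit i (vs[j := u])) (vs[j := u] ! i))"
      proof (cases "i = j")
        case True
        then show ?thesis using lin[of "omit j vs"] vs by (simp add: omit_list_update_same)
      next
        case False
        have "linear (\<lambda>u. (\<lambda>us. G us (vs ! i)) ((omit i vs)[(if j < i then j else j - 1) := u]))"
        proof -
          have "length (omit i vs) = p" "(if j < i then j else j - 1) < p" using vs i False by auto
          then show ?thesis using alt[of "vs ! i"] unfolding alternating_form_def by blast
        qed
        then show ?thesis using vs i False by (simp add: omit_list_update)
      qed
      from linear_compose_scale_right[OF this, of "(-1) ^ i"] show ?thesis by simp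
    qed
    then show ?thesis using vs by (simp add: linear_compose_sum del: sum.lessThan_Suc)
  qed
  moreover have "(\<Sum>i<length vs. (-1) ^ i * G (omit i vs) (vs ! i)) = 0"
    if vs: "length vs = Suc p" "a < b" "b < Suc p" "vs ! a = vs ! b" for vs a b
  proof -
    let ?T = "\<lambda>i. (-1) ^ i * G (omit i vs) (vs ! i)"
    have "?T i = 0" if i: "i < Suc p" "i \<noteq> a" "i \<noteq> b" for i
    proof -
      let ?a = "if a < i then a else a - 1" and ?b = "if b < i then b else b - 1"
      have ab: "?a < ?b" "?b < p" using vs i by (auto split: if_splits)
      have "omit i vs ! ?a = omit i vs ! ?b"
        using vs i ab by (auto simp: nth_omit)
      moreover have "length (omit i vs) = p" using vs i by simp
      ultimately have "G (omit i vs) (vs ! i) = 0"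
        using alt[of "vs ! i"] ab unfolding alternating_form_def by blast
      then show ?thesis by simp
    qed
    then have "(\<Sum>i<length vs. ?T i) = (\<Sum>i\<in>{a, b}. ?T i)"
      using vs by (intro sum.mono_neutral_right) auto
    also have "\<dots> = ?T a + ?T b" using vs by simp
    also have "\<dots> = 0"
    proof -
      define v xs ys zs where "v = vs ! a" and "xs = take a vs" and "ys = drop (Suc a) (take b vs)"
        and "zs = drop (Suc b) vs"
      have tb: "take b vs = xs @ v # ys"
        unfolding xs_def ys_def v_def using id_take_nth_drop[of a "take b vs"] vs by (simp add: min_def)
      have eq: "vs = xs @ v # ys @ v # zs"
        using id_take_nth_drop[of b vs] tb vs unfolding zs_def v_def by simp
      have len: "length xs = a" "Suc (length xs + length ys) = b" "length xs + length ys + length zs + 2 = Suc p"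
        using vs unfolding xs_def ys_def zs_def by auto
      have oa: "omit a vs = (xs @ ys) @ v # zs" and ob: "omit b vs = xs @ v # ys @ zs"
        unfolding omit_def by (subst eq, subst eq, simp add: len(1)[symmetric] len(2)[symmetric])+
      have "G ((xs @ ys) @ v # zs) v = (-1) ^ length (xs @ ys) * G (v # (xs @ ys) @ zs) v"
        by (rule alternating_form_move[OF alt]) (use len in auto)
      moreover have "G (xs @ v # ys @ zs) v = (-1) ^ length xs * G (v # xs @ ys @ zs) v"
        by (rule alternating_form_move[OF alt]) (use len in auto)
      ultimately show ?thesis
        unfolding oa ob using vs(4) len(1,2)
        by (auto simp: v_def[symmetric] power_add algebra_simps)
    qed
    finally show ?thesis .
  qed
  ultimately show ?thesis unfolding alternating_form_def by blast
qed

section \<open>Superforms and their derivatives\<close>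

lemma superforms_alternating1:
  "\<alpha> \<in> superforms p q U \<Longrightarrow> x \<in> U \<Longrightarrow> length ws = q \<Longrightarrow> alternating_form p (\<lambda>vs. \<alpha> x vs ws)"
  and superforms_alternating2:
  "\<alpha> \<in> superforms p q U \<Longrightarrow> x \<in> U \<Longrightarrow> length vs = p \<Longrightarrow> alternating_form q (\<lambda>ws. \<alpha> x vs ws)"
  and superforms_smooth:
  "\<alpha> \<in> superforms p q U \<Longrightarrow> length vs = p \<Longrightarrow> length ws = q \<Longrightarrow> smooth_on U (\<lambda>x. \<alpha> x vs ws)"
  by (auto simp: superforms_def)

lemma superforms_has_derivative:
  "\<alpha> \<in> superforms p q U \<Longrightarrow> x \<in> U \<Longrightarrow> length vs = p \<Longrightarrow> length ws = q \<Longrightarrow>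
   ((\<lambda>y. \<alpha> y vs ws) has_derivative frechet_derivative (\<lambda>y. \<alpha> y vs ws) (at x)) (at x)"
  using smooth_on_has_derivative superforms_smooth by blast

lemma superforms_subset: "\<alpha> \<in> superforms p q U \<Longrightarrow> V \<subseteq> U \<Longrightarrow> \<alpha> \<in> superforms p q V"
  unfolding superforms_def by (auto intro: smooth_on_subset[of U])

lemma superforms_add:
  assumes "open U" "\<alpha> \<in> superforms p q U" "\<beta> \<in> superforms p q U"
  shows "\<alpha> + \<beta> \<in> superforms p q U"
  unfolding plus_fun_def superforms_def mem_Collect_eq
  using assms(2,3) unfolding superforms_def mem_Collect_eq
  by (intro conjI allI ballI impI alternating_form_add smooth_on_add[OF assms(1)]) simp_all

lemma superforms_mult:
  assumes "open U" "\<alpha> \<in> superforms p q U" "smooth_on U \<phi>"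
  shows "(\<lambda>x vs ws. \<phi> x * \<alpha> x vs ws) \<in> superforms p q U"
  unfolding superforms_def mem_Collect_eq
  using assms(2) unfolding superforms_def mem_Collect_eq
  by (intro conjI allI ballI impI alternating_form_scale smooth_on_mult[OF assms(1,3)]) simp_all

lemma superforms_scale: "open U \<Longrightarrow> \<alpha> \<in> superforms p q U \<Longrightarrow> c *\<^sub>R \<alpha> \<in> superforms p q U"
  using superforms_mult[of U \<alpha> p q "\<lambda>_. c"] by (simp add: smooth_on_const scaleR_fun_def)

lemma superforms_0: "0 \<in> superforms p q U"
  by (simp add: superforms_def smooth_on_const zero_fun_def alternating_form_0)

lemma superforms_swap: "\<alpha> \<in> superforms p q U \<Longrightarrow> (\<lambda>x vs ws. \<alpha> x ws vs) \<in> superforms q p U"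
  by (auto simp: superforms_def)

lemma d_prime_superforms:
  assumes U: "open U" and \<alpha>: "\<alpha> \<in> superforms p q U"
  shows "d_prime \<alpha> \<in> superforms (Suc p) q U"
proof -
  have diff: "(\<lambda>y. \<alpha> y vs ws) differentiable (at x)" if "x \<in> U" "length vs = p" "length ws = q" for x vs ws
    using superforms_has_derivative[OF \<alpha> that] by (rule differentiableI)
  have "alternating_form (Suc p) (\<lambda>vs. d_prime \<alpha> x vs ws)" if x: "x \<in> U" "length ws = q" for x ws
    unfolding d_prime_def
  proof (rule alternating_form_alternating_sum)
    show "linear (frechet_derivative (\<lambda>y. \<alpha> y us ws) (at x))" if "length us = p" for us
      using superforms_has_derivative[OF \<alpha> x(1) that x(2)] by (rule has_derivative_linear)
    show "alternating_form p (\<lambda>us. frechet_derivative (\<lambda>y. \<alpha> y us ws) (at x) v)" for v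
      using superforms_alternating1[OF \<alpha> _ x(2)] diff[OF x(1) _ x(2)]
      by (rule alternating_form_derivative[OF U x(1)])
  qed
  moreover have "alternating_form q (\<lambda>ws. d_prime \<alpha> x vs ws)" if x: "x \<in> U" "length vs = Suc p" for x vs
    unfolding d_prime_def
  proof (rule alternating_form_sum)
    fix i assume "i \<in> {..<length vs}"
    then have l: "length (omit i vs) = p" using x by simp
    show "alternating_form q (\<lambda>ws. frechet_derivative (\<lambda>y. \<alpha> y (omit i vs) ws) (at x) (vs ! i))"
      using superforms_alternating2[OF \<alpha> _ l] diff[OF x(1) l]
      by (rule alternating_form_derivative[OF U x(1)])
  qed
  moreover have "smooth_on U (\<lambda>x. d_prime \<alpha> x vs ws)" if x: "length vs = Suc p" "length ws = q" for vs ws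
    unfolding d_prime_def
    by (intro smooth_on_sum[OF U] smooth_on_mult[OF U] smooth_on_const smooth_on_derivative
        superforms_smooth[OF \<alpha>]) (use x in auto)
  ultimately show ?thesis by (simp add: superforms_def)
qed

lemma d_second_eq: "d_second \<alpha> x vs ws = (-1) ^ length vs * d_prime (\<lambda>x vs ws. \<alpha> x ws vs) x ws vs"
  by (simp add: d_second_def d_prime_def)

lemma d_second_superforms:
  assumes U: "open U" and \<alpha>: "\<alpha> \<in> superforms p q U"
  shows "d_second \<alpha> \<in> superforms p (Suc q) U"
proof -
  let ?\<beta> = "\<lambda>x vs ws. d_prime (\<lambda>x vs ws. \<alpha> x ws vs) x ws vs"
  have "?\<beta> \<in> superforms p (Suc q) U"
    by (rule superforms_swap[OF d_prime_superforms[OF U superforms_swap[OF \<alpha>]]])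
  from superforms_scale[OF U this, of "(-1) ^ p"]
  have s: "(-1) ^ p *\<^sub>R ?\<beta> \<in> superforms p (Suc q) U" .
  have eq: "d_second \<alpha> x vs = ((-1) ^ p *\<^sub>R ?\<beta>) x vs" if "length vs = p" for x vs
    using that by (auto simp: d_second_eq)
  moreover have "alternating_form p (\<lambda>vs. d_second \<alpha> x vs ws) \<longleftrightarrow>
      alternating_form p (\<lambda>vs. ((-1) ^ p *\<^sub>R ?\<beta>) x vs ws)" for x ws
    unfolding alternating_form_def using eq by (auto simp del: scaleR_apply)
  ultimately show ?thesis using s unfolding superforms_def by (simp del: scaleR_apply)
qed

lemma frechet_derivative_add:
  fixes f g :: "'a::real_normed_vector \<Rightarrow> real"
  assumes "f differentiable (at x)" "g differentiable (at x)"
  shows "frechet_derivative (\<lambda>y. f y + g y) (at x) v = frechet_derivative f (at x) v + frechet_derivative g (at x) v"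
  by (rule fun_cong[OF frechet_derivative_at[OF has_derivative_add[OF assms[unfolded frechet_derivative_works]],
        symmetric]])

lemma frechet_derivative_mult_const:
  fixes f :: "'a::real_normed_vector \<Rightarrow> real"
  assumes "f differentiable (at x)"
  shows "frechet_derivative (\<lambda>y. c * f y) (at x) v = c * frechet_derivative f (at x) v"
  by (rule fun_cong[OF frechet_derivative_at[OF has_derivative_mult_right[OF assms[unfolded frechet_derivative_works]],
        symmetric]])

lemma frechet_derivative_sum:
  fixes f :: "'i \<Rightarrow> 'a::real_normed_vector \<Rightarrow> real"
  assumes "\<And>i. i \<in> I \<Longrightarrow> f i differentiable (at x)"
  shows "frechet_derivative (\<lambda>y. \<Sum>i\<in>I. c i * f i y) (at x) v = (\<Sum>i\<in>I. c i * frechet_derivative (f i) (at x) v)"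
proof -
  have "((\<lambda>y. \<Sum>i\<in>I. c i * f i y) has_derivative (\<lambda>v. \<Sum>i\<in>I. c i * frechet_derivative (f i) (at x) v)) (at x)"
    by (intro has_derivative_sum has_derivative_mult_right assms[unfolded frechet_derivative_works])
  then show ?thesis by (rule fun_cong[OF frechet_derivative_at[symmetric]])
qed

lemma superforms_differentiable:
  "\<alpha> \<in> superforms p q U \<Longrightarrow> x \<in> U \<Longrightarrow> length vs = p \<Longrightarrow> length ws = q \<Longrightarrow>
   (\<lambda>y. \<alpha> y vs ws) differentiable (at x)"
  using superforms_has_derivative differentiableI by blast

lemma d_prime_add:
  assumes "\<alpha> \<in> superforms p q U" "\<beta> \<in> superforms p q U" "x \<in> U" "length vs = Suc p" "length ws = q"
  shows "d_prime (\<alpha> + \<beta>) x vs ws = d_prime \<alpha> x vs ws + d_prime \<beta> x vs ws"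
  unfolding d_prime_def plus_fun_def sum.distrib[symmetric]
  by (intro sum.cong refl, subst frechet_derivative_add)
     (use assms in \<open>auto simp: distrib_left intro: superforms_differentiable\<close>)

lemma d_prime_scale:
  assumes "\<alpha> \<in> superforms p q U" "x \<in> U" "length vs = Suc p" "length ws = q"
  shows "d_prime (c *\<^sub>R \<alpha>) x vs ws = c * d_prime \<alpha> x vs ws"
  unfolding d_prime_def scaleR_fun_def real_scaleR_def sum_distrib_left
  by (intro sum.cong refl, subst frechet_derivative_mult_const)
     (use assms in \<open>auto intro: superforms_differentiable\<close>)

lemma d_second_add:
  assumes "\<alpha> \<in> superforms p q U" "\<beta> \<in> superforms p q U" "x \<in> U" "length vs = p" "length ws = Suc q"
  shows "d_second (\<alpha> + \<beta>) x vs ws = d_second \<alpha> x vs ws + d_second \<beta> x vs ws"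
  using d_prime_add[OF superforms_swap[OF assms(1)] superforms_swap[OF assms(2)] assms(3,5,4)]
  by (simp add: d_second_eq plus_fun_def distrib_left)

lemma d_second_scale:
  assumes "\<alpha> \<in> superforms p q U" "x \<in> U" "length vs = p" "length ws = Suc q"
  shows "d_second (c *\<^sub>R \<alpha>) x vs ws = c * d_second \<alpha> x vs ws"
  using d_prime_scale[OF superforms_swap[OF assms(1)] assms(2,4,3)]
  by (simp add: d_second_eq scaleR_fun_def)

lemma d_prime_d_prime:
  assumes U: "open U" and \<alpha>: "\<alpha> \<in> superforms p q U" and x: "x \<in> U"
    and vs: "length vs = Suc (Suc p)" and ws: "length ws = q"
  shows "d_prime (d_prime \<alpha>) x vs ws = 0"
proof -
  define H where "H us a b = frechet_derivative (\<lambda>y. frechet_derivative (\<lambda>y. \<alpha> y us ws) (at y) a) (at x) b" for us a b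
  have sm: "smooth_on U (\<lambda>y. \<alpha> y us ws)" if "length us = p" for us
    using superforms_smooth[OF \<alpha> that ws] .
  have sym: "H us a b = H us b a" if "length us = p" for us a b
    unfolding H_def by (rule symmetric_second_derivative[OF sm[OF that] U x])
  define T where "T = (\<lambda>(i, j). (-1) ^ (i + j) * H (omit j (omit i vs)) (omit i vs ! j) (vs ! i))"
  have "frechet_derivative (\<lambda>y. d_prime \<alpha> y (omit i vs) ws) (at x) v =
      (\<Sum>j<Suc p. (-1) ^ j * H (omit j (omit i vs)) (omit i vs ! j) v)" if "i < Suc (Suc p)" for i v
  proof -
    have "(\<lambda>y. frechet_derivative (\<lambda>y. \<alpha> y (omit j (omit i vs)) ws) (at y) (omit i vs ! j)) differentiable (at x)"
      if "j \<in> {..<length (omit i vs)}" for j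
      by (rule differentiableI[OF smooth_on_has_derivative[OF smooth_on_derivative[OF sm] x]])
         (use that \<open>i < _\<close> vs in simp)
    from frechet_derivative_sum[where I = "{..<length (omit i vs)}" and c = "\<lambda>j. (-1) ^ j"
        and f = "\<lambda>j y. frechet_derivative (\<lambda>y. \<alpha> y (omit j (omit i vs)) ws) (at y) (omit i vs ! j)",
        OF this]
    show ?thesis unfolding d_prime_def H_def using that vs by (simp del: sum.lessThan_Suc)
  qed
  then have "d_prime (d_prime \<alpha>) x vs ws = (\<Sum>i<Suc (Suc p). \<Sum>j<Suc p. T (i, j))"
    unfolding d_prime_def[of "d_prime \<alpha>"] T_def vs
    by (intro sum.cong refl) (simp add: sum_distrib_left power_add mult.assoc del: sum.lessThan_Suc)
  also have "\<dots> = sum T ({..<Suc (Suc p)} \<times> {..<Suc p})" by (simp add: sum.cartesian_product del: sum.lessThan_Suc)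
  also have "\<dots> = sum T ({(i, j). i < Suc (Suc p) \<and> j < Suc p \<and> i \<le> j}
      \<union> {(i, j). i < Suc (Suc p) \<and> j < Suc p \<and> j < i})"
    by (rule arg_cong[where f = "sum T"]) auto
  also have "\<dots> = sum T {(i, j). i < Suc (Suc p) \<and> j < Suc p \<and> i \<le> j}
      + sum T {(i, j). i < Suc (Suc p) \<and> j < Suc p \<and> j < i}"
  proof (rule sum.union_disjoint)
    show "finite {(i, j). i < Suc (Suc p) \<and> j < Suc p \<and> i \<le> j}"
      by (rule finite_subset[of _ "{..<Suc (Suc p)} \<times> {..<Suc p}"]) auto
    show "finite {(i, j). i < Suc (Suc p) \<and> j < Suc p \<and> j < i}"
      by (rule finite_subset[of _ "{..<Suc (Suc p)} \<times> {..<Suc p}"]) auto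
  qed auto
  also have "sum T {(i, j). i < Suc (Suc p) \<and> j < Suc p \<and> j < i} =
      (\<Sum>(i, j)\<in>{(i, j). i < Suc (Suc p) \<and> j < Suc p \<and> i \<le> j}. - T (i, j))"
  proof (rule sum.reindex_bij_witness[where i = "\<lambda>(i, j). (Suc j, i)" and j = "\<lambda>(i, j). (j, i - 1)"])
    fix a assume "a \<in> {(i, j). i < Suc (Suc p) \<and> j < Suc p \<and> j < i}"
    then obtain i j where a: "a = (Suc i, j)" "i < Suc p" "j \<le> i"
      by (cases "fst a"; cases a) auto
    have "omit j (omit (Suc i) vs) = omit i (omit j vs)"
      by (rule omit_omit[symmetric]) (use a vs in auto)
    moreover have "omit (Suc i) vs ! j = vs ! j" "omit j vs ! i = vs ! Suc i"
      using a vs by (auto simp: nth_omit)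
    moreover have "length (omit i (omit j vs)) = p" using a vs by simp
    ultimately have "H (omit j (omit (Suc i) vs)) (omit (Suc i) vs ! j) (vs ! Suc i) =
        H (omit i (omit j vs)) (omit j vs ! i) (vs ! j)"
      using sym by metis
    then show "(case (case a of (i, j) \<Rightarrow> (j, i - 1)) of (i, j) \<Rightarrow> - T (i, j)) = T a"
      using a by (simp add: T_def add.commute)
  qed auto
  finally show ?thesis by (simp add: sum_negf case_prod_unfold)
qed

lemma d_second_d_second:
  assumes U: "open U" and \<alpha>: "\<alpha> \<in> superforms p q U" and x: "x \<in> U"
    and vs: "length vs = p" and ws: "length ws = Suc (Suc q)"
  shows "d_second (d_second \<alpha>) x vs ws = 0"
proof -
  let ?\<beta> = "\<lambda>x vs ws. \<alpha> x ws vs"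
  have b: "?\<beta> \<in> superforms q p U" by (rule superforms_swap[OF \<alpha>])
  have "d_prime (\<lambda>x vs ws. d_second \<alpha> x ws vs) x ws vs = d_prime ((-1) ^ p *\<^sub>R d_prime ?\<beta>) x ws vs"
    unfolding d_prime_def[of "\<lambda>x vs ws. d_second \<alpha> x ws vs"] d_prime_def[of "(-1) ^ p *\<^sub>R d_prime ?\<beta>"]
    by (simp add: d_second_eq vs)
  also have "\<dots> = 0"
    using d_prime_scale[OF d_prime_superforms[OF U b] x _ vs] d_prime_d_prime[OF U b x _ vs] ws by simp
  finally show ?thesis by (simp add: d_second_eq[of "d_second \<alpha>"])
qed

lemma d_prime_d_second:
  assumes U: "open U" and \<alpha>: "\<alpha> \<in> superforms p q U" and x: "x \<in> U"
    and vs: "length vs = Suc p" and ws: "length ws = Suc q"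
  shows "d_prime (d_second \<alpha>) x vs ws = - d_second (d_prime \<alpha>) x vs ws"
proof -
  define H where "H us zs a b = frechet_derivative (\<lambda>y. frechet_derivative (\<lambda>y. \<alpha> y us zs) (at y) a) (at x) b" for us zs a b
  have sm: "smooth_on U (\<lambda>y. \<alpha> y us zs)" if "length us = p" "length zs = q" for us zs
    using superforms_smooth[OF \<alpha> that] .
  have sym: "H us zs a b = H us zs b a" if "length us = p" "length zs = q" for us zs a b
    unfolding H_def by (rule symmetric_second_derivative[OF sm[OF that] U x])
  have df: "(\<lambda>y. frechet_derivative (\<lambda>y. \<alpha> y us zs) (at y) a) differentiable (at x)"
    if "length us = p" "length zs = q" for us zs a
    using smooth_on_has_derivative[OF smooth_on_derivative[OF sm[OF that]] x] by (rule differentiableI)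
  have dsm: "(\<lambda>y. \<Sum>j<Suc q. (-1) ^ j * frechet_derivative (\<lambda>y. \<alpha> y us (omit j ws)) (at y) (ws ! j)) differentiable (at x)"
    if "length us = p" for us
    using that ws by (auto intro!: differentiable_sum differentiable_mult df simp del: sum.lessThan_Suc)
  have "frechet_derivative (\<lambda>y. d_second \<alpha> y (omit i vs) ws) (at x) v =
      (-1) ^ p * (\<Sum>j<Suc q. (-1) ^ j * H (omit i vs) (omit j ws) (ws ! j) v)" if "i < Suc p" for i v
  proof -
    have l: "length (omit i vs) = p" using vs that by simp
    show ?thesis
      unfolding d_second_def l ws H_def
      using frechet_derivative_mult_const[OF dsm[OF l]]
        frechet_derivative_sum[of "{..<Suc q}" "\<lambda>j y. frechet_derivative (\<lambda>y. \<alpha> y (omit i vs) (omit j ws)) (at y) (ws ! j)" x]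
        df[OF l] ws by (simp del: sum.lessThan_Suc)
  qed
  then have L: "d_prime (d_second \<alpha>) x vs ws =
      (\<Sum>i<Suc p. \<Sum>j<Suc q. (-1) ^ p * (-1) ^ i * (-1) ^ j * H (omit i vs) (omit j ws) (ws ! j) (vs ! i))"
    unfolding d_prime_def[of "d_second \<alpha>"] vs
    by (intro sum.cong refl) (simp add: sum_distrib_left mult_ac del: sum.lessThan_Suc)
  have "frechet_derivative (\<lambda>y. d_prime \<alpha> y vs (omit j ws)) (at x) w =
      (\<Sum>i<Suc p. (-1) ^ i * H (omit i vs) (omit j ws) (vs ! i) w)" if "j < Suc q" for j w
    unfolding d_prime_def vs H_def
    using frechet_derivative_sum[of "{..<Suc p}" "\<lambda>i y. frechet_derivative (\<lambda>y. \<alpha> y (omit i vs) (omit j ws)) (at y) (vs ! i)" x]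
        df ws vs that by (simp del: sum.lessThan_Suc)
  then have "d_second (d_prime \<alpha>) x vs ws =
      - (\<Sum>j<Suc q. \<Sum>i<Suc p. (-1) ^ p * (-1) ^ i * (-1) ^ j * H (omit i vs) (omit j ws) (vs ! i) (ws ! j))"
    unfolding d_second_def[of "d_prime \<alpha>"] vs ws
    by (simp add: sum_distrib_left mult_ac sum_negf del: sum.lessThan_Suc)
  also have "\<dots> = - d_prime (d_second \<alpha>) x vs ws"
    unfolding L using sym vs ws
    by (subst sum.swap) (intro arg_cong[where f = uminus] sum.cong refl, simp)
  finally show ?thesis by simp
qed

section \<open>Superforms on the support of a polyhedral complex\<close>

lemma superforms_cong:
  assumes "open U" "\<And>x vs ws. x \<in> U \<Longrightarrow> \<alpha> x vs ws = \<beta> x vs ws" "\<alpha> \<in> superforms p q U"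
  shows "\<beta> \<in> superforms p q U"
proof -
  have "\<beta> x vs = \<alpha> x vs" if "x \<in> U" for x vs using assms(2)[OF that] by auto
  moreover have "smooth_on U (\<lambda>x. \<beta> x vs ws)" if "smooth_on U (\<lambda>x. \<alpha> x vs ws)" for vs ws
    by (rule smooth_on_cong[OF assms(1) _ that]) (use assms(2) in simp)
  ultimately show ?thesis using assms(3) unfolding superforms_def by auto
qed

lemma superforms_Un:
  assumes "open A" "open B" "\<alpha> \<in> superforms p q A" "\<alpha> \<in> superforms p q B"
  shows "\<alpha> \<in> superforms p q (A \<union> B)"
  using assms(3,4) unfolding superforms_def by (auto intro: smooth_on_Un[OF assms(1,2)])

lemma derivative_zero_along_convex:
  fixes f :: "'a::real_normed_vector \<Rightarrow> real"
  assumes D: "(f has_derivative D) (at x)" and V: "open V" "x \<in> V" and S: "convex S" "x \<in> S"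
    and f0: "\<And>y. y \<in> S \<inter> V \<Longrightarrow> f y = 0" and v: "v \<in> parallel_space S"
  shows "D v = 0"
proof -
  have lin: "linear D" using D by (rule has_derivative_linear)
  have D0: "D (y - x) = 0" if y: "y \<in> S" for y
  proof -
    have "((\<lambda>t. f (x + t *\<^sub>R (y - x))) has_real_derivative D (y - x)) (at 0)"
      by (rule has_derivative_along_line) (use D in simp)
    then have "((\<lambda>t. (f (x + t *\<^sub>R (y - x)) - f x) / t) \<longlongrightarrow> D (y - x)) (at_right 0)"
      unfolding DERIV_def by (auto intro: tendsto_mono[OF at_le])
    moreover have "((\<lambda>t. (f (x + t *\<^sub>R (y - x)) - f x) / t) \<longlongrightarrow> 0) (at_right 0)"
    proof (rule Lim_transform_eventually[OF tendsto_const])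
      have "((\<lambda>t. x + t *\<^sub>R (y - x)) \<longlongrightarrow> x + 0 *\<^sub>R (y - x)) (at_right 0)"
        by (intro tendsto_intros)
      then have "\<forall>\<^sub>F t in at_right 0. x + t *\<^sub>R (y - x) \<in> V"
        using V by (auto dest!: topological_tendstoD[where S = V])
      moreover have "\<forall>\<^sub>F t in at_right (0::real). t \<in> {0<..<1}"
        by (rule eventually_at_right_real) simp
      ultimately show "\<forall>\<^sub>F t in at_right 0. 0 = (f (x + t *\<^sub>R (y - x)) - f x) / t"
      proof eventually_elim
        case (elim t)
        have "x + t *\<^sub>R (y - x) = (1 - t) *\<^sub>R x + t *\<^sub>R y" by (simp add: algebra_simps)
        also have "\<dots> \<in> S" using S y elim by (intro convexD) auto
        finally show ?case using f0 elim S V by auto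
      qed
    qed
    ultimately show ?thesis by (rule tendsto_unique[rotated]) simp
  qed
  have aff: "affine hull S = (+) x ` span ((\<lambda>y. - x + y) ` (S - {x}))"
    by (rule affine_hull_span2[OF S(2)])
  have Ds: "D w = 0" if "w \<in> span ((\<lambda>y. - x + y) ` (S - {x}))" for w
    by (rule linear_eq_0_on_span[OF lin _ that]) (use D0 in auto)
  obtain a b where "v = b - a" "a \<in> affine hull S" "b \<in> affine hull S"
    using v unfolding parallel_space_def by blast
  then show ?thesis using Ds aff by (auto simp: linear_diff[OF lin] linear_add[OF lin])
qed

definition cut :: "('a \<Rightarrow> real) \<Rightarrow> 'a superform \<Rightarrow> 'a superform" where
  "cut \<phi> \<alpha> = (\<lambda>x vs ws. \<phi> x * \<alpha> x vs ws)"

lemma cut_apply [simp]: "cut \<phi> \<alpha> x vs ws = \<phi> x * \<alpha> x vs ws"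
  by (simp add: cut_def)

lemma d_prime_0 [simp]: "d_prime 0 = 0"
  by (auto simp: d_prime_def fun_eq_iff frechet_derivative_const)

lemma d_second_0 [simp]: "d_second 0 = 0"
  by (auto simp: d_second_def fun_eq_iff frechet_derivative_const)

locale cell_complex =
  fixes C :: "'a::euclidean_space set set"
  assumes polyhedral: "polyhedral_complex C"
begin

definition rel_open :: "'a set \<Rightarrow> bool" where
  "rel_open \<Omega> \<longleftrightarrow> (\<exists>V. open V \<and> V \<inter> support C = \<Omega>)"

definition reps :: "nat \<Rightarrow> nat \<Rightarrow> 'a set \<Rightarrow> 'a superform set" where
  "reps p q \<Omega> = {\<alpha>. \<exists>V. open V \<and> V \<inter> support C = \<Omega> \<and> \<alpha> \<in> superforms p q V}"

definition null :: "nat \<Rightarrow> nat \<Rightarrow> 'a set \<Rightarrow> 'a superform set" where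
  "null p q \<Omega> = {\<alpha>. \<forall>\<sigma>\<in>C. \<forall>x\<in>\<sigma> \<inter> \<Omega>. \<forall>vs ws.
     length vs = p \<and> set vs \<subseteq> parallel_space \<sigma> \<and> length ws = q \<and> set ws \<subseteq> parallel_space \<sigma> \<longrightarrow>
     \<alpha> x vs ws = 0}"

lemma nullI:
  assumes "\<And>\<sigma> x vs ws. \<sigma> \<in> C \<Longrightarrow> x \<in> \<sigma> \<Longrightarrow> x \<in> \<Omega> \<Longrightarrow> length vs = p \<Longrightarrow> set vs \<subseteq> parallel_space \<sigma> \<Longrightarrow>
    length ws = q \<Longrightarrow> set ws \<subseteq> parallel_space \<sigma> \<Longrightarrow> \<alpha> x vs ws = 0"
  shows "\<alpha> \<in> null p q \<Omega>"
  unfolding null_def using assms by simp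

lemma nullD:
  "\<alpha> \<in> null p q \<Omega> \<Longrightarrow> \<sigma> \<in> C \<Longrightarrow> x \<in> \<sigma> \<Longrightarrow> x \<in> \<Omega> \<Longrightarrow> length vs = p \<Longrightarrow> set vs \<subseteq> parallel_space \<sigma> \<Longrightarrow>
    length ws = q \<Longrightarrow> set ws \<subseteq> parallel_space \<sigma> \<Longrightarrow> \<alpha> x vs ws = 0"
  unfolding null_def by simp

lemma subspace_null: "subspace (null p q \<Omega>)"
  unfolding real_vector.subspace_def
proof (intro conjI ballI allI)
  show "0 \<in> null p q \<Omega>" by (rule nullI) simp
  fix \<alpha> assume a: "\<alpha> \<in> null p q \<Omega>"
  show "c *\<^sub>R \<alpha> \<in> null p q \<Omega>" for c
    by (rule nullI) (simp add: nullD[OF a])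
  fix \<beta> assume b: "\<beta> \<in> null p q \<Omega>"
  show "\<alpha> + \<beta> \<in> null p q \<Omega>"
  proof (rule nullI)
    fix \<sigma> x vs ws
    assume h: "\<sigma> \<in> C" "x \<in> \<sigma>" "x \<in> \<Omega>" "length vs = p" "set vs \<subseteq> parallel_space \<sigma>"
      "length ws = q" "set ws \<subseteq> parallel_space \<sigma>"
    show "(\<alpha> + \<beta>) x vs ws = 0" using nullD[OF a h] nullD[OF b h] by simp
  qed
qed

lemmas null_0 = subspace_0[OF subspace_null]
  and null_add = subspace_add[OF subspace_null]
  and null_diff = subspace_diff[OF subspace_null]
  and null_scale = subspace_mul[OF subspace_null]

lemma null_mono: "\<alpha> \<in> null p q \<Omega> \<Longrightarrow> \<Omega>' \<subseteq> \<Omega> \<Longrightarrow> \<alpha> \<in> null p q \<Omega>'"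
  unfolding null_def by blast

lemma null_Un: "\<alpha> \<in> null p q \<Omega> \<Longrightarrow> \<alpha> \<in> null p q \<Omega>' \<Longrightarrow> \<alpha> \<in> null p q (\<Omega> \<union> \<Omega>')"
  unfolding null_def by blast

lemma null_if_zero_on_superforms:
  assumes "V \<inter> support C = \<Omega>"
    "\<And>x vs ws. x \<in> V \<Longrightarrow> length vs = p \<Longrightarrow> length ws = q \<Longrightarrow> \<alpha> x vs ws = 0"
  shows "\<alpha> \<in> null p q \<Omega>"
  using assms by (auto intro!: nullI)

lemma reps_obtain:
  assumes "\<alpha> \<in> reps p q \<Omega>" "\<beta> \<in> reps p' q' \<Omega>"
  obtains V where "open V" "V \<inter> support C = \<Omega>" "\<alpha> \<in> superforms p q V" "\<beta> \<in> superforms p' q' V"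
proof -
  obtain V W where V: "open V" "V \<inter> support C = \<Omega>" "\<alpha> \<in> superforms p q V"
    and W: "open W" "W \<inter> support C = \<Omega>" "\<beta> \<in> superforms p' q' W"
    using assms unfolding reps_def by blast
  show ?thesis
    using V W superforms_subset[OF V(3), of "V \<inter> W"] superforms_subset[OF W(3), of "V \<inter> W"]
    by (intro that[of "V \<inter> W"]) auto
qed

lemma repsI: "open V \<Longrightarrow> V \<inter> support C = \<Omega> \<Longrightarrow> \<alpha> \<in> superforms p q V \<Longrightarrow> \<alpha> \<in> reps p q \<Omega>"
  unfolding reps_def by blast

lemma reps_0: "rel_open \<Omega> \<Longrightarrow> 0 \<in> reps p q \<Omega>"
  unfolding rel_open_def using repsI superforms_0 by blast

lemma reps_rel_open: "\<alpha> \<in> reps p q \<Omega> \<Longrightarrow> rel_open \<Omega>"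
  unfolding rel_open_def reps_def by blast

lemma reps_add:
  assumes "\<alpha> \<in> reps p q \<Omega>" "\<beta> \<in> reps p q \<Omega>"
  shows "\<alpha> + \<beta> \<in> reps p q \<Omega>"
proof -
  obtain V where V: "open V" "V \<inter> support C = \<Omega>" "\<alpha> \<in> superforms p q V" "\<beta> \<in> superforms p q V"
    using reps_obtain[OF assms] .
  show ?thesis by (rule repsI[OF V(1,2) superforms_add[OF V(1,3,4)]])
qed

lemma reps_scale: "\<alpha> \<in> reps p q \<Omega> \<Longrightarrow> c *\<^sub>R \<alpha> \<in> reps p q \<Omega>"
  unfolding reps_def by (auto intro: superforms_scale)

lemma reps_diff: "\<alpha> \<in> reps p q \<Omega> \<Longrightarrow> \<beta> \<in> reps p q \<Omega> \<Longrightarrow> \<alpha> - \<beta> \<in> reps p q \<Omega>"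
  using reps_add[OF _ reps_scale[of \<beta> _ _ _ "-1"], of \<alpha>] by simp

lemma subspace_reps: "rel_open \<Omega> \<Longrightarrow> subspace (reps p q \<Omega>)"
  unfolding real_vector.subspace_def using reps_0 by (auto intro: reps_add reps_scale)

lemma reps_restrict:
  assumes "\<alpha> \<in> reps p q \<Omega>" "rel_open \<Omega>'" "\<Omega>' \<subseteq> \<Omega>"
  shows "\<alpha> \<in> reps p q \<Omega>'"
proof -
  obtain V where V: "open V" "V \<inter> support C = \<Omega>" "\<alpha> \<in> superforms p q V"
    using assms(1) unfolding reps_def by blast
  obtain W where W: "open W" "W \<inter> support C = \<Omega>'" using assms(2) unfolding rel_open_def by blast
  show ?thesis
    using V W assms(3) superforms_subset[OF V(3), of "V \<inter> W"]
    by (intro repsI[of "V \<inter> W"]) auto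
qed

lemma d_prime_reps: "\<alpha> \<in> reps p q \<Omega> \<Longrightarrow> d_prime \<alpha> \<in> reps (Suc p) q \<Omega>"
  unfolding reps_def by (auto intro: d_prime_superforms)

lemma d_second_reps: "\<alpha> \<in> reps p q \<Omega> \<Longrightarrow> d_second \<alpha> \<in> reps p (Suc q) \<Omega>"
  unfolding reps_def by (auto intro: d_second_superforms)

lemma convex_cell: "\<sigma> \<in> C \<Longrightarrow> convex \<sigma>"
  using polyhedral polyhedron_imp_convex unfolding polyhedral_complex_def by auto

text \<open>The derivative at a point of a cell in a direction parallel to the cell only sees the values
  on the cell, even at its boundary, because the directions into the cell span.\<close>

lemma d_prime_null:
  assumes \<alpha>: "\<alpha> \<in> reps p q \<Omega>" "\<alpha> \<in> null p q \<Omega>"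
  shows "d_prime \<alpha> \<in> null (Suc p) q \<Omega>"
proof (rule nullI)
  fix \<sigma> x vs ws
  assume h: "\<sigma> \<in> C" "x \<in> \<sigma>" "x \<in> \<Omega>" "length vs = Suc p" "set vs \<subseteq> parallel_space \<sigma>"
    "length ws = q" "set ws \<subseteq> parallel_space \<sigma>"
  obtain V where V: "open V" "V \<inter> support C = \<Omega>" "\<alpha> \<in> superforms p q V"
    using \<alpha>(1) unfolding reps_def by blast
  have "frechet_derivative (\<lambda>y. \<alpha> y (omit i vs) ws) (at x) (vs ! i) = 0" if i: "i < length vs" for i
  proof (rule derivative_zero_along_convex[OF _ V(1) _ convex_cell[OF h(1)] h(2)])
    show "((\<lambda>y. \<alpha> y (omit i vs) ws) has_derivative frechet_derivative (\<lambda>y. \<alpha> y (omit i vs) ws) (at x)) (at x)"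
      by (rule superforms_has_derivative[OF V(3)]) (use V h i in auto)
    show "x \<in> V" using V h by auto
    show "vs ! i \<in> parallel_space \<sigma>" using h i by auto
    show "\<alpha> y (omit i vs) ws = 0" if y: "y \<in> \<sigma> \<inter> V" for y
    proof (rule nullD[OF \<alpha>(2) h(1)])
      show "y \<in> \<Omega>" using V y h(1) by blast
      show "set (omit i vs) \<subseteq> parallel_space \<sigma>" by (rule subset_trans[OF set_omit_subset h(5)])
    qed (use y h i in auto)
  qed
  then show "d_prime \<alpha> x vs ws = 0" unfolding d_prime_def by simp
qed

lemma d_second_null:
  assumes \<alpha>: "\<alpha> \<in> reps p q \<Omega>" "\<alpha> \<in> null p q \<Omega>"
  shows "d_second \<alpha> \<in> null p (Suc q) \<Omega>"
proof (rule nullI)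
  let ?\<beta> = "\<lambda>x vs ws. \<alpha> x ws vs"
  have "?\<beta> \<in> reps q p \<Omega>" using \<alpha>(1) unfolding reps_def by (auto intro: superforms_swap)
  moreover have "?\<beta> \<in> null q p \<Omega>" by (rule nullI) (rule nullD[OF \<alpha>(2)])
  ultimately have n: "d_prime ?\<beta> \<in> null (Suc q) p \<Omega>" by (rule d_prime_null)
  fix \<sigma> x vs ws
  assume "\<sigma> \<in> C" "x \<in> \<sigma>" "x \<in> \<Omega>" "length vs = p" "set vs \<subseteq> parallel_space \<sigma>"
    "length ws = Suc q" "set ws \<subseteq> parallel_space \<sigma>"
  then show "d_second \<alpha> x vs ws = 0" using nullD[OF n] by (simp add: d_second_eq)
qed

lemma linear_mod_d_prime: "linear_mod (reps p q \<Omega>) (null (Suc p) q \<Omega>) d_prime"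
  unfolding linear_mod_def
proof (intro conjI ballI allI)
  fix \<alpha> \<beta> assume r: "\<alpha> \<in> reps p q \<Omega>" "\<beta> \<in> reps p q \<Omega>"
  obtain V where V: "V \<inter> support C = \<Omega>" "\<alpha> \<in> superforms p q V" "\<beta> \<in> superforms p q V"
    using reps_obtain[OF r] by blast
  show "d_prime (\<alpha> + \<beta>) - (d_prime \<alpha> + d_prime \<beta>) \<in> null (Suc p) q \<Omega>"
    by (rule null_if_zero_on_superforms[OF V(1)]) (simp add: d_prime_add[OF V(2,3)])
  show "d_prime (c *\<^sub>R \<alpha>) - c *\<^sub>R d_prime \<alpha> \<in> null (Suc p) q \<Omega>" for c
    by (rule null_if_zero_on_superforms[OF V(1)]) (simp add: d_prime_scale[OF V(2)])
qed

lemma linear_mod_d_second: "linear_mod (reps p q \<Omega>) (null p (Suc q) \<Omega>) d_second"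
  unfolding linear_mod_def
proof (intro conjI ballI allI)
  fix \<alpha> \<beta> assume r: "\<alpha> \<in> reps p q \<Omega>" "\<beta> \<in> reps p q \<Omega>"
  obtain V where V: "V \<inter> support C = \<Omega>" "\<alpha> \<in> superforms p q V" "\<beta> \<in> superforms p q V"
    using reps_obtain[OF r] by blast
  show "d_second (\<alpha> + \<beta>) - (d_second \<alpha> + d_second \<beta>) \<in> null p (Suc q) \<Omega>"
    by (rule null_if_zero_on_superforms[OF V(1)]) (simp add: d_second_add[OF V(2,3)])
  show "d_second (c *\<^sub>R \<alpha>) - c *\<^sub>R d_second \<alpha> \<in> null p (Suc q) \<Omega>" for c
    by (rule null_if_zero_on_superforms[OF V(1)]) (simp add: d_second_scale[OF V(2)])
qed

lemmas d_prime_add_null = linear_mod_add[OF linear_mod_d_prime]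
  and d_second_add_null = linear_mod_add[OF linear_mod_d_second]

lemma d_prime_diff_null:
  assumes "\<alpha> \<in> reps p q \<Omega>" "\<beta> \<in> reps p q \<Omega>"
  shows "d_prime (\<alpha> - \<beta>) - (d_prime \<alpha> - d_prime \<beta>) \<in> null (Suc p) q \<Omega>"
  by (rule linear_mod_diff[OF linear_mod_d_prime subspace_reps[OF reps_rel_open[OF assms(1)]] subspace_null assms])

lemma d_prime_cong_null:
  assumes "\<alpha> \<in> reps p q \<Omega>" "\<beta> \<in> reps p q \<Omega>" "\<alpha> - \<beta> \<in> null p q \<Omega>"
  shows "d_prime \<alpha> - d_prime \<beta> \<in> null (Suc p) q \<Omega>"
  by (rule linear_mod_cong[OF linear_mod_d_prime subspace_reps[OF reps_rel_open[OF assms(1)]] subspace_null assms(1,2)])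
     (rule d_prime_null[OF reps_diff[OF assms(1,2)] assms(3)])

lemma d_second_cong_null:
  assumes "\<alpha> \<in> reps p q \<Omega>" "\<beta> \<in> reps p q \<Omega>" "\<alpha> - \<beta> \<in> null p q \<Omega>"
  shows "d_second \<alpha> - d_second \<beta> \<in> null p (Suc q) \<Omega>"
  by (rule linear_mod_cong[OF linear_mod_d_second subspace_reps[OF reps_rel_open[OF assms(1)]] subspace_null assms(1,2)])
     (rule d_second_null[OF reps_diff[OF assms(1,2)] assms(3)])

lemma d_prime_d_prime_null:
  assumes "\<alpha> \<in> reps p q \<Omega>"
  shows "d_prime (d_prime \<alpha>) \<in> null (Suc (Suc p)) q \<Omega>"
proof -
  obtain V where V: "open V" "V \<inter> support C = \<Omega>" "\<alpha> \<in> superforms p q V"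
    using reps_obtain[OF assms assms] by blast
  show ?thesis
    by (rule null_if_zero_on_superforms[OF V(2)]) (simp add: d_prime_d_prime[OF V(1,3)])
qed

lemma d_second_d_second_null:
  assumes "\<alpha> \<in> reps p q \<Omega>"
  shows "d_second (d_second \<alpha>) \<in> null p (Suc (Suc q)) \<Omega>"
proof -
  obtain V where V: "open V" "V \<inter> support C = \<Omega>" "\<alpha> \<in> superforms p q V"
    using reps_obtain[OF assms assms] by blast
  show ?thesis
    by (rule null_if_zero_on_superforms[OF V(2)]) (simp add: d_second_d_second[OF V(1,3)])
qed

lemma d_prime_d_second_null:
  assumes "\<alpha> \<in> reps p q \<Omega>"
  shows "d_prime (d_second \<alpha>) + d_second (d_prime \<alpha>) \<in> null (Suc p) (Suc q) \<Omega>"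
proof -
  obtain V where V: "open V" "V \<inter> support C = \<Omega>" "\<alpha> \<in> superforms p q V"
    using reps_obtain[OF assms assms] by blast
  show ?thesis
    by (rule null_if_zero_on_superforms[OF V(2)]) (simp add: d_prime_d_second[OF V(1,3)])
qed

section \<open>The Mayer-Vietoris argument for the first differential\<close>

definition closed_forms :: "nat \<Rightarrow> nat \<Rightarrow> 'a set \<Rightarrow> 'a superform set" where
  "closed_forms p q \<Omega> = {\<alpha> \<in> reps p q \<Omega>. d_prime \<alpha> \<in> null (Suc p) q \<Omega>}"

fun exact_forms :: "nat \<Rightarrow> nat \<Rightarrow> 'a set \<Rightarrow> 'a superform set" where
  "exact_forms 0 q \<Omega> = reps 0 q \<Omega> \<inter> null 0 q \<Omega>"
| "exact_forms (Suc p) q \<Omega> = {\<alpha> \<in> reps (Suc p) q \<Omega>. \<exists>\<beta>\<in>reps p q \<Omega>. \<alpha> - d_prime \<beta> \<in> null (Suc p) q \<Omega>}"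

lemma subspace_closed_forms:
  assumes "rel_open \<Omega>"
  shows "subspace (closed_forms p q \<Omega>)"
  unfolding closed_forms_def
  by (rule subspace_linear_mod_kernel[OF linear_mod_d_prime subspace_reps[OF assms] subspace_null])

lemma subspace_exact_forms:
  assumes "rel_open \<Omega>"
  shows "subspace (exact_forms p q \<Omega>)"
proof (cases p)
  case 0
  then show ?thesis using subspace_inter[OF subspace_reps[OF assms] subspace_null] by simp
next
  case (Suc n)
  show ?thesis unfolding Suc exact_forms.simps
    by (rule subspace_linear_mod_image[OF linear_mod_d_prime subspace_reps[OF assms] subspace_null
          subspace_reps[OF assms]])
qed

definition primitive :: "nat \<Rightarrow> nat \<Rightarrow> 'a set \<Rightarrow> 'a superform \<Rightarrow> 'a superform \<Rightarrow> bool" where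
  "primitive p q \<Omega> \<alpha> \<beta> \<longleftrightarrow> \<beta> \<in> reps p q \<Omega> \<and> \<alpha> - d_prime \<beta> \<in> null (Suc p) q \<Omega>"

lemma primitive_0: "rel_open \<Omega> \<Longrightarrow> primitive p q \<Omega> 0 0"
  unfolding primitive_def d_prime_0 using reps_0 null_0 by simp

lemma primitive_add:
  assumes "primitive p q \<Omega> \<alpha> \<beta>" "primitive p q \<Omega> \<alpha>' \<beta>'"
  shows "primitive p q \<Omega> (\<alpha> + \<alpha>') (\<beta> + \<beta>')"
  using assms unfolding primitive_def
  by (auto intro: reps_add
      linear_mod_primitive_add[OF linear_mod_d_prime subspace_reps[OF reps_rel_open] subspace_null])

lemma primitive_scale:
  assumes "primitive p q \<Omega> \<alpha> \<beta>"
  shows "primitive p q \<Omega> (c *\<^sub>R \<alpha>) (c *\<^sub>R \<beta>)"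
  using assms unfolding primitive_def
  by (auto intro: reps_scale
      linear_mod_primitive_scale[OF linear_mod_d_prime subspace_reps[OF reps_rel_open] subspace_null])

lemma exact_forms_Suc: "exact_forms (Suc p) q \<Omega> = {\<alpha> \<in> reps (Suc p) q \<Omega>. \<exists>\<beta>. primitive p q \<Omega> \<alpha> \<beta>}"
  unfolding primitive_def by auto

definition smooth_set :: "'a set \<Rightarrow> bool" where
  "smooth_set \<Omega> \<longleftrightarrow> (\<exists>f. smooth_on UNIV f \<and> (\<forall>x. f x \<ge> 0) \<and> \<Omega> = {x \<in> support C. f x > 0})"

lemma open_Collect_pos: "smooth_on UNIV f \<Longrightarrow> open {x::'a. f x > 0}"
  using smooth_on_continuous_on by (intro open_Collect_less) auto

lemma smooth_set_rel_open: "smooth_set \<Omega> \<Longrightarrow> rel_open \<Omega>"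
  unfolding smooth_set_def rel_open_def using open_Collect_pos by blast

lemma smooth_set_Un:
  assumes "smooth_set A" "smooth_set B"
  shows "smooth_set (A \<union> B)"
proof -
  obtain f g where f: "smooth_on UNIV f" "\<And>x. f x \<ge> 0" "A = {x \<in> support C. f x > 0}"
    and g: "smooth_on UNIV g" "\<And>x. g x \<ge> 0" "B = {x \<in> support C. g x > 0}"
    using assms unfolding smooth_set_def by blast
  have "f x + g x > 0 \<longleftrightarrow> f x > 0 \<or> g x > 0" for x
    using f(2)[of x] g(2)[of x] by linarith
  then show ?thesis unfolding smooth_set_def
    by (intro exI[of _ "\<lambda>x. f x + g x"]) (use f g in \<open>auto intro!: smooth_on_add\<close>)
qed

lemma smooth_set_Int:
  assumes "smooth_set A" "smooth_set B"
  shows "smooth_set (A \<inter> B)"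
proof -
  obtain f g where f: "smooth_on UNIV f" "\<And>x. f x \<ge> 0" "A = {x \<in> support C. f x > 0}"
    and g: "smooth_on UNIV g" "\<And>x. g x \<ge> 0" "B = {x \<in> support C. g x > 0}"
    using assms unfolding smooth_set_def by blast
  have "f x * g x > 0 \<longleftrightarrow> f x > 0 \<and> g x > 0" for x
    using f(2)[of x] g(2)[of x] by (auto simp: zero_less_mult_iff)
  then show ?thesis unfolding smooth_set_def
    by (intro exI[of _ "\<lambda>x. f x * g x"]) (use f g in \<open>auto intro!: smooth_on_mult\<close>)
qed

lemma cut_reps:
  assumes \<alpha>: "\<alpha> \<in> reps p q A" and \<Omega>: "rel_open \<Omega>" "A \<subseteq> \<Omega>"
    and W: "open W" "\<Omega> \<subseteq> W" "smooth_on W \<phi>"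
    and S: "open S" "\<Omega> \<subseteq> A \<union> S" "\<And>x. x \<in> S \<inter> W \<Longrightarrow> \<phi> x = 0"
  shows "cut \<phi> \<alpha> \<in> reps p q \<Omega>"
proof -
  obtain V where V: "open V" "V \<inter> support C = A" "\<alpha> \<in> superforms p q V"
    using \<alpha> unfolding reps_def by blast
  obtain V' where V': "open V'" "V' \<inter> support C = \<Omega>" using \<Omega>(1) unfolding rel_open_def by blast
  have "cut \<phi> \<alpha> \<in> superforms p q (V' \<inter> W \<inter> V)"
    unfolding cut_def
  proof (rule superforms_mult)
    show "open (V' \<inter> W \<inter> V)" using V V' W by auto
    show "\<alpha> \<in> superforms p q (V' \<inter> W \<inter> V)" by (rule superforms_subset[OF V(3)]) auto
    show "smooth_on (V' \<inter> W \<inter> V) \<phi>" by (rule smooth_on_subset[OF W(3)]) auto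
  qed
  moreover have "cut \<phi> \<alpha> \<in> superforms p q (V' \<inter> W \<inter> S)"
    by (rule superforms_cong[OF _ _ superforms_0]) (use V' W S in auto)
  ultimately have "cut \<phi> \<alpha> \<in> superforms p q ((V' \<inter> W \<inter> V) \<union> (V' \<inter> W \<inter> S))"
    using V V' W S by (intro superforms_Un) auto
  moreover have "((V' \<inter> W \<inter> V) \<union> (V' \<inter> W \<inter> S)) \<inter> support C = \<Omega>"
    using V V' W S \<Omega> by blast
  ultimately show ?thesis using V V' W S by (intro repsI[of "(V' \<inter> W \<inter> V) \<union> (V' \<inter> W \<inter> S)"]) auto
qed

lemma cutoff_exists:
  assumes "smooth_set U" "smooth_set V"
  obtains \<phi> where
    "\<And>p q \<alpha>. \<alpha> \<in> reps p q U \<Longrightarrow> cut \<phi> \<alpha> \<in> reps p q (U \<union> V)"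
    "\<And>p q \<alpha>. \<alpha> \<in> reps p q V \<Longrightarrow> cut (\<lambda>x. 1 - \<phi> x) \<alpha> \<in> reps p q (U \<union> V)"
    "\<And>p q \<alpha>. \<alpha> \<in> reps p q (U \<inter> V) \<Longrightarrow> cut \<phi> \<alpha> \<in> reps p q V"
    "\<And>p q \<alpha>. \<alpha> \<in> reps p q (U \<inter> V) \<Longrightarrow> cut (\<lambda>x. 1 - \<phi> x) \<alpha> \<in> reps p q U"
    "\<And>x. x \<in> U - V \<Longrightarrow> \<phi> x = 1" "\<And>x. x \<in> V - U \<Longrightarrow> \<phi> x = 0"
proof -
  obtain f g where f: "smooth_on UNIV f" "\<And>x. f x \<ge> 0" "U = {x \<in> support C. f x > 0}"
    and g: "smooth_on UNIV g" "\<And>x. g x \<ge> 0" "V = {x \<in> support C. g x > 0}"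
    using assms unfolding smooth_set_def by blast
  define A where "A x = flat (2 * f x - g x)" for x
  define B where "B x = flat (2 * g x - f x)" for x
  define \<phi> where "\<phi> x = A x * inverse (A x + B x)" for x
  define W where "W = {x. f x + g x > 0}"
  have W: "open W" unfolding W_def by (rule open_Collect_pos) (use f g in \<open>auto intro: smooth_on_add\<close>)
  have AB: "A x + B x > 0" if "x \<in> W" for x
  proof -
    have "2 * f x - g x > 0 \<or> 2 * g x - f x > 0" using that unfolding W_def by auto
    then show ?thesis unfolding A_def B_def using flat_pos_iff flat_nonneg
      by (metis add_nonneg_pos add_pos_nonneg)
  qed
  have sA: "smooth_on W A" and sB: "smooth_on W B"
    unfolding A_def B_def using f(1) g(1)
    by (auto intro!: smooth_on_flat smooth_on_diff smooth_on_mult smooth_on_const W intro: smooth_on_subset[of UNIV])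
  have s\<phi>: "smooth_on W \<phi>" unfolding \<phi>_def
    by (intro smooth_on_mult smooth_on_inverse smooth_on_add W sA sB) (use AB in force)
  have s1: "smooth_on W (\<lambda>x. 1 - \<phi> x)" by (intro smooth_on_diff smooth_on_const W s\<phi>)
  define S T where "S = {x. 2 * f x < g x}" and "T = {x. 2 * g x < f x}"
  have cont: "continuous_on UNIV f" "continuous_on UNIV g" using f g smooth_on_continuous_on by auto
  have op: "open S" "open T" unfolding S_def T_def
    by (intro open_Collect_less continuous_intros cont)+
  have S0: "\<phi> x = 0" if "x \<in> S" for x
    using that by (simp add: S_def \<phi>_def A_def flat_eq_0_iff)
  have T1: "1 - \<phi> x = 0" if "x \<in> T \<inter> W" for x
    using that AB[of x] by (simp add: T_def \<phi>_def B_def flat_eq_0_iff field_simps)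
  have sub: "U \<union> V \<subseteq> W" using f g unfolding W_def by (auto intro: add_pos_nonneg add_nonneg_pos)
  have US: "V \<subseteq> U \<union> S" and VT: "U \<subseteq> V \<union> T"
    using f g unfolding S_def T_def by force+
  have ro: "rel_open U" "rel_open V" "rel_open (U \<union> V)"
    using assms smooth_set_rel_open smooth_set_Un by auto
  show ?thesis
  proof (rule that[of \<phi>])
    fix p q \<alpha>
    show "\<alpha> \<in> reps p q U \<Longrightarrow> cut \<phi> \<alpha> \<in> reps p q (U \<union> V)"
      by (erule cut_reps[OF _ ro(3) _ W sub s\<phi> op(1)]) (use US S0 in auto)
    show "\<alpha> \<in> reps p q V \<Longrightarrow> cut (\<lambda>x. 1 - \<phi> x) \<alpha> \<in> reps p q (U \<union> V)"
      by (erule cut_reps[OF _ ro(3) _ W sub s1 op(2)]) (use VT T1 in auto)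
    show "\<alpha> \<in> reps p q (U \<inter> V) \<Longrightarrow> cut \<phi> \<alpha> \<in> reps p q V"
      by (erule cut_reps[OF _ ro(2) _ W _ s\<phi> op(1)]) (use US S0 sub in auto)
    show "\<alpha> \<in> reps p q (U \<inter> V) \<Longrightarrow> cut (\<lambda>x. 1 - \<phi> x) \<alpha> \<in> reps p q U"
      by (erule cut_reps[OF _ ro(1) _ W _ s1 op(2)]) (use VT T1 sub in auto)
  next
    fix x
    show "x \<in> U - V \<Longrightarrow> \<phi> x = 1" using VT T1[of x] sub by auto
    show "x \<in> V - U \<Longrightarrow> \<phi> x = 0" using US S0[of x] by auto
  qed
qed

lemma exact_forms_glue:
  assumes U: "smooth_set U" and V: "smooth_set V"
    and \<alpha>: "\<alpha> \<in> reps (Suc p) q (U \<union> V)"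
    and b1: "\<beta>\<^sub>1 \<in> reps p q U" "\<alpha> - d_prime \<beta>\<^sub>1 \<in> null (Suc p) q U"
    and b2: "\<beta>\<^sub>2 \<in> reps p q V" "\<alpha> - d_prime \<beta>\<^sub>2 \<in> null (Suc p) q V"
    and b: "\<beta>\<^sub>1 - \<beta>\<^sub>2 \<in> null p q (U \<inter> V)"
  shows "\<alpha> \<in> exact_forms (Suc p) q (U \<union> V)"
proof -
  obtain \<phi> where \<phi>: "\<And>p q \<alpha>. \<alpha> \<in> reps p q U \<Longrightarrow> cut \<phi> \<alpha> \<in> reps p q (U \<union> V)"
    "\<And>p q \<alpha>. \<alpha> \<in> reps p q V \<Longrightarrow> cut (\<lambda>x. 1 - \<phi> x) \<alpha> \<in> reps p q (U \<union> V)"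
    "\<And>x. x \<in> U - V \<Longrightarrow> \<phi> x = 1" "\<And>x. x \<in> V - U \<Longrightarrow> \<phi> x = 0"
    using cutoff_exists[OF U V] by metis
  define \<beta> where "\<beta> = cut \<phi> \<beta>\<^sub>1 + cut (\<lambda>x. 1 - \<phi> x) \<beta>\<^sub>2"
  have \<beta>: "\<beta> \<in> reps p q (U \<union> V)" unfolding \<beta>_def using \<phi> b1 b2 by (intro reps_add) auto
  have eq: "\<beta>\<^sub>1 x vs ws = \<beta>\<^sub>2 x vs ws" if "\<sigma> \<in> C" "x \<in> \<sigma>" "x \<in> U \<inter> V" "length vs = p" "set vs \<subseteq> parallel_space \<sigma>"
    "length ws = q" "set ws \<subseteq> parallel_space \<sigma>" for \<sigma> x vs ws
    using nullD[OF b that] by simp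
  have "\<beta> - \<beta>\<^sub>1 \<in> null p q U"
  proof (rule nullI)
    fix \<sigma> x vs ws assume h: "\<sigma> \<in> C" "x \<in> \<sigma>" "x \<in> U" "length vs = p" "set vs \<subseteq> parallel_space \<sigma>"
      "length ws = q" "set ws \<subseteq> parallel_space \<sigma>"
    show "(\<beta> - \<beta>\<^sub>1) x vs ws = 0"
      using eq[OF h(1,2) _ h(4-)] \<phi>(3)[of x] h(3)
      by (cases "x \<in> V") (auto simp: \<beta>_def algebra_simps)
  qed
  then have "d_prime \<beta> - d_prime \<beta>\<^sub>1 \<in> null (Suc p) q U"
    using \<beta> b1 U smooth_set_rel_open by (intro d_prime_cong_null) (auto intro: reps_restrict)
  from null_diff[OF b1(2) this] have 1: "\<alpha> - d_prime \<beta> \<in> null (Suc p) q U" by simp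
  have "\<beta> - \<beta>\<^sub>2 \<in> null p q V"
  proof (rule nullI)
    fix \<sigma> x vs ws assume h: "\<sigma> \<in> C" "x \<in> \<sigma>" "x \<in> V" "length vs = p" "set vs \<subseteq> parallel_space \<sigma>"
      "length ws = q" "set ws \<subseteq> parallel_space \<sigma>"
    show "(\<beta> - \<beta>\<^sub>2) x vs ws = 0"
      using eq[OF h(1,2) _ h(4-)] \<phi>(4)[of x] h(3)
      by (cases "x \<in> U") (auto simp: \<beta>_def algebra_simps)
  qed
  then have "d_prime \<beta> - d_prime \<beta>\<^sub>2 \<in> null (Suc p) q V"
    using \<beta> b2 V smooth_set_rel_open by (intro d_prime_cong_null) (auto intro: reps_restrict)
  from null_diff[OF b2(2) this] have 2: "\<alpha> - d_prime \<beta> \<in> null (Suc p) q V" by simp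
  show ?thesis using \<alpha> \<beta> null_Un[OF 1 2] by auto
qed

lemma exact_forms_Un:
  assumes U: "smooth_set U" and V: "smooth_set V"
    and \<alpha>: "\<alpha> \<in> reps (Suc p) q (U \<union> V)"
    and b1: "\<beta>\<^sub>1 \<in> reps p q U" "\<alpha> - d_prime \<beta>\<^sub>1 \<in> null (Suc p) q U"
    and b2: "\<beta>\<^sub>2 \<in> reps p q V" "\<alpha> - d_prime \<beta>\<^sub>2 \<in> null (Suc p) q V"
    and b: "\<beta>\<^sub>1 - \<beta>\<^sub>2 \<in> exact_forms p q (U \<inter> V)"
  shows "\<alpha> \<in> exact_forms (Suc p) q (U \<union> V)"
proof (cases p)
  case 0
  then show ?thesis using exact_forms_glue[OF U V \<alpha> b1 b2] b by simp
next
  case (Suc n)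
  obtain \<delta> where \<delta>: "\<delta> \<in> reps n q (U \<inter> V)" "\<beta>\<^sub>1 - \<beta>\<^sub>2 - d_prime \<delta> \<in> null p q (U \<inter> V)"
    using b unfolding Suc by auto
  obtain \<phi> where \<phi>: "\<And>p q \<alpha>. \<alpha> \<in> reps p q (U \<inter> V) \<Longrightarrow> cut \<phi> \<alpha> \<in> reps p q V"
    "\<And>p q \<alpha>. \<alpha> \<in> reps p q (U \<inter> V) \<Longrightarrow> cut (\<lambda>x. 1 - \<phi> x) \<alpha> \<in> reps p q U"
    using cutoff_exists[OF U V] by metis
  let ?\<delta>V = "cut \<phi> \<delta>" and ?\<delta>U = "cut (\<lambda>x. 1 - \<phi> x) \<delta>"
  have dV: "?\<delta>V \<in> reps n q V" and dU: "?\<delta>U \<in> reps n q U" using \<phi> \<delta>(1) by auto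
  have sum: "?\<delta>U + ?\<delta>V = \<delta>" by (auto simp: fun_eq_iff algebra_simps)
  have UV: "rel_open (U \<inter> V)" using U V smooth_set_Int smooth_set_rel_open by blast
  have 1: "\<beta>\<^sub>1 - d_prime ?\<delta>U \<in> reps p q U" and 2: "\<beta>\<^sub>2 + d_prime ?\<delta>V \<in> reps p q V"
    unfolding Suc using b1(1) b2(1) dU dV unfolding Suc by (auto intro: reps_diff reps_add d_prime_reps)
  have dU1: "d_prime ?\<delta>U \<in> reps p q U" and dV1: "d_prime ?\<delta>V \<in> reps p q V"
    using d_prime_reps dU dV Suc by auto
  have ddU: "d_prime (d_prime ?\<delta>U) \<in> null (Suc p) q U" and ddV: "d_prime (d_prime ?\<delta>V) \<in> null (Suc p) q V"
    using d_prime_d_prime_null dU dV Suc by auto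
  show ?thesis
  proof (rule exact_forms_glue[OF U V \<alpha> 1 _ 2])
    have "\<alpha> - d_prime (\<beta>\<^sub>1 - d_prime ?\<delta>U) = (\<alpha> - d_prime \<beta>\<^sub>1)
        - (d_prime (\<beta>\<^sub>1 - d_prime ?\<delta>U) - (d_prime \<beta>\<^sub>1 - d_prime (d_prime ?\<delta>U))) + d_prime (d_prime ?\<delta>U)"
      by simp
    also have "\<dots> \<in> null (Suc p) q U"
      by (rule null_add[OF null_diff[OF b1(2) d_prime_diff_null[OF b1(1) dU1]] ddU])
    finally show "\<alpha> - d_prime (\<beta>\<^sub>1 - d_prime ?\<delta>U) \<in> null (Suc p) q U" .
    have "\<alpha> - d_prime (\<beta>\<^sub>2 + d_prime ?\<delta>V) = (\<alpha> - d_prime \<beta>\<^sub>2)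
        - (d_prime (\<beta>\<^sub>2 + d_prime ?\<delta>V) - (d_prime \<beta>\<^sub>2 + d_prime (d_prime ?\<delta>V))) - d_prime (d_prime ?\<delta>V)"
      by simp
    also have "\<dots> \<in> null (Suc p) q V"
      by (rule null_diff[OF null_diff[OF b2(2) d_prime_add_null[OF b2(1) dV1]] ddV])
    finally show "\<alpha> - d_prime (\<beta>\<^sub>2 + d_prime ?\<delta>V) \<in> null (Suc p) q V" .
    have "d_prime \<delta> - (d_prime ?\<delta>U + d_prime ?\<delta>V) \<in> null p q (U \<inter> V)"
      using d_prime_add_null[OF reps_restrict[OF dU UV] reps_restrict[OF dV UV]] unfolding sum Suc by simp
    from null_add[OF \<delta>(2) this]
    show "\<beta>\<^sub>1 - d_prime ?\<delta>U - (\<beta>\<^sub>2 + d_prime ?\<delta>V) \<in> null p q (U \<inter> V)"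
      by (simp add: algebra_simps)
  qed
qed

definition finite_rows :: "nat \<Rightarrow> 'a set \<Rightarrow> bool" where
  "finite_rows q \<Omega> \<longleftrightarrow> (\<forall>p. fin_codim (closed_forms p q \<Omega>) (exact_forms p q \<Omega>))"

lemma closed_forms_restrict:
  "\<alpha> \<in> closed_forms p q \<Omega> \<Longrightarrow> rel_open \<Omega>' \<Longrightarrow> \<Omega>' \<subseteq> \<Omega> \<Longrightarrow> \<alpha> \<in> closed_forms p q \<Omega>'"
  unfolding closed_forms_def using reps_restrict null_mono by blast

theorem finite_rows_Un:
  assumes U: "smooth_set U" and V: "smooth_set V"
    and "finite_rows q U" "finite_rows q V" "finite_rows q (U \<inter> V)"
  shows "finite_rows q (U \<union> V)"
  unfolding finite_rows_def
proof
  fix p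
  have ro: "rel_open U" "rel_open V" "rel_open (U \<union> V)" "rel_open (U \<inter> V)"
    using U V smooth_set_Un smooth_set_Int smooth_set_rel_open by blast+
  let ?Z = "closed_forms p q (U \<union> V)" and ?BU = "exact_forms p q U" and ?BV = "exact_forms p q V"
  note Z = subspace_closed_forms[OF ro(3), of p q]
  have ZB: "subspace (?Z \<inter> ?BU)" using Z subspace_exact_forms[OF ro(1)] by (rule subspace_inter)
  have "fin_codim ?Z (?Z \<inter> ?BU)"
  proof (rule fin_codim_pullback[where P = "\<lambda>m m'. m = m' \<and> m \<in> ?Z"])
    show "fin_codim (closed_forms p q U) ?BU" using assms(3) unfolding finite_rows_def by blast
  qed (use closed_forms_restrict ro Z in \<open>auto simp: real_vector.subspace_def\<close>)
  moreover have "fin_codim (?Z \<inter> ?BU) (?Z \<inter> ?BU \<inter> ?BV)"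
  proof (rule fin_codim_pullback[where P = "\<lambda>m m'. m = m' \<and> m \<in> ?Z \<inter> ?BU"])
    show "fin_codim (closed_forms p q V) ?BV" using assms(4) unfolding finite_rows_def by blast
    show "\<And>m. m \<in> ?Z \<inter> ?BU \<Longrightarrow> \<exists>m'\<in>closed_forms p q V. m = m' \<and> m \<in> ?Z \<inter> ?BU"
      using closed_forms_restrict ro by blast
  qed (use ZB in \<open>auto simp: real_vector.subspace_def\<close>)
  moreover have "fin_codim (?Z \<inter> ?BU \<inter> ?BV) (exact_forms p q (U \<union> V))"
  proof (cases p)
    case 0
    have "?Z \<inter> ?BU \<inter> ?BV \<subseteq> exact_forms p q (U \<union> V)"
      unfolding 0 closed_forms_def using null_Un by auto
    then show ?thesis
      using fin_codim_mono[OF fin_codim_self[OF subspace_exact_forms[OF ro(3)]]] by blast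
  next
    case (Suc n)
    let ?P = "\<lambda>\<alpha> \<gamma>. \<alpha> \<in> reps (Suc n) q (U \<union> V) \<and>
      (\<exists>\<beta>\<^sub>1 \<beta>\<^sub>2. primitive n q U \<alpha> \<beta>\<^sub>1 \<and> primitive n q V \<alpha> \<beta>\<^sub>2 \<and> \<gamma> = \<beta>\<^sub>1 - \<beta>\<^sub>2)"
    show ?thesis unfolding Suc
    proof (rule fin_codim_pullback[where P = ?P])
      show "fin_codim (closed_forms n q (U \<inter> V)) (exact_forms n q (U \<inter> V))"
        using assms(5) unfolding finite_rows_def by blast
      show "?P 0 0"
        using reps_0[OF ro(3)] primitive_0[OF ro(1)] primitive_0[OF ro(2)]
        by (metis diff_zero)
    next
      fix \<alpha> assume \<alpha>: "\<alpha> \<in> closed_forms (Suc n) q (U \<union> V) \<inter> exact_forms (Suc n) q U \<inter> exact_forms (Suc n) q V"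
      then obtain \<beta>\<^sub>1 \<beta>\<^sub>2 where b: "primitive n q U \<alpha> \<beta>\<^sub>1" "primitive n q V \<alpha> \<beta>\<^sub>2"
        unfolding exact_forms_Suc by blast
      have r: "\<beta>\<^sub>1 \<in> reps n q (U \<inter> V)" "\<beta>\<^sub>2 \<in> reps n q (U \<inter> V)"
        using b reps_restrict[OF _ ro(4)] unfolding primitive_def by blast+
      have n: "\<alpha> - d_prime \<beta>\<^sub>1 \<in> null (Suc n) q (U \<inter> V)" "\<alpha> - d_prime \<beta>\<^sub>2 \<in> null (Suc n) q (U \<inter> V)"
        using b null_mono unfolding primitive_def by blast+
      have "d_prime (\<beta>\<^sub>1 - \<beta>\<^sub>2) = (\<alpha> - d_prime \<beta>\<^sub>2) - (\<alpha> - d_prime \<beta>\<^sub>1)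
          + (d_prime (\<beta>\<^sub>1 - \<beta>\<^sub>2) - (d_prime \<beta>\<^sub>1 - d_prime \<beta>\<^sub>2))" by simp
      also have "\<dots> \<in> null (Suc n) q (U \<inter> V)"
        by (intro null_add null_diff n d_prime_diff_null r)
      finally have "\<beta>\<^sub>1 - \<beta>\<^sub>2 \<in> closed_forms n q (U \<inter> V)"
        unfolding closed_forms_def using reps_diff[OF r] by simp
      moreover have "\<alpha> \<in> reps (Suc n) q (U \<union> V)" using \<alpha> unfolding closed_forms_def by blast
      ultimately show "\<exists>\<gamma>\<in>closed_forms n q (U \<inter> V). ?P \<alpha> \<gamma>" using b by blast
    next
      fix \<alpha> \<gamma> \<alpha>' \<gamma>' assume "?P \<alpha> \<gamma>" "?P \<alpha>' \<gamma>'"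
      then obtain \<beta>\<^sub>1 \<beta>\<^sub>2 \<beta>\<^sub>1' \<beta>\<^sub>2' where r: "\<alpha> \<in> reps (Suc n) q (U \<union> V)" "\<alpha>' \<in> reps (Suc n) q (U \<union> V)"
        and b: "primitive n q U \<alpha> \<beta>\<^sub>1" "primitive n q V \<alpha> \<beta>\<^sub>2" "primitive n q U \<alpha>' \<beta>\<^sub>1'" "primitive n q V \<alpha>' \<beta>\<^sub>2'"
        and \<gamma>: "\<gamma> = \<beta>\<^sub>1 - \<beta>\<^sub>2" "\<gamma>' = \<beta>\<^sub>1' - \<beta>\<^sub>2'"
        by blast
      have "\<gamma> + \<gamma>' = (\<beta>\<^sub>1 + \<beta>\<^sub>1') - (\<beta>\<^sub>2 + \<beta>\<^sub>2')" unfolding \<gamma> by simp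
      then show "?P (\<alpha> + \<alpha>') (\<gamma> + \<gamma>')"
        using reps_add[OF r] primitive_add[OF b(1,3)] primitive_add[OF b(2,4)] by blast
    next
      fix c \<alpha> \<gamma> assume "?P \<alpha> \<gamma>"
      then obtain \<beta>\<^sub>1 \<beta>\<^sub>2 where r: "\<alpha> \<in> reps (Suc n) q (U \<union> V)"
        and b: "primitive n q U \<alpha> \<beta>\<^sub>1" "primitive n q V \<alpha> \<beta>\<^sub>2" and \<gamma>: "\<gamma> = \<beta>\<^sub>1 - \<beta>\<^sub>2"
        by blast
      have "c *\<^sub>R \<gamma> = c *\<^sub>R \<beta>\<^sub>1 - c *\<^sub>R \<beta>\<^sub>2" unfolding \<gamma> by (rule scaleR_diff_right)
      then show "?P (c *\<^sub>R \<alpha>) (c *\<^sub>R \<gamma>)"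
        using reps_scale[OF r] primitive_scale[OF b(1)] primitive_scale[OF b(2)] by blast
    next
      fix \<alpha> \<gamma> assume "?P \<alpha> \<gamma>" "\<gamma> \<in> exact_forms n q (U \<inter> V)"
      then show "\<alpha> \<in> exact_forms (Suc n) q (U \<union> V)"
        using exact_forms_Un[OF U V] unfolding primitive_def by blast
    qed
  qed
  ultimately show "fin_codim (closed_forms p q (U \<union> V)) (exact_forms p q (U \<union> V))"
    using fin_codim_trans by blast
qed

end

section \<open>The Poincare lemma for the first differential\<close>

lemma multilinear_zero:
  fixes f :: "'a::euclidean_space list \<Rightarrow> real"
  assumes f: "alternating_form n f" and B: "\<And>vs. set vs \<subseteq> Basis \<Longrightarrow> length vs = n \<Longrightarrow> f vs = 0"
    and vs: "length vs = n"
  shows "f vs = 0"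
proof -
  have "k \<le> n \<Longrightarrow> length vs = n \<Longrightarrow> set (drop k vs) \<subseteq> Basis \<Longrightarrow> f vs = 0" for k vs
  proof (induction k arbitrary: vs)
    case 0
    then show ?case using B by simp
  next
    case (Suc k)
    have lin: "linear (\<lambda>u. f (vs[k := u]))"
      using f Suc.prems unfolding alternating_form_def by simp
    have zero: "f (vs[k := b]) = 0" if "b \<in> Basis" for b
    proof (rule Suc.IH)
      have "drop k (vs[k := b]) = b # drop (Suc k) vs"
        using Suc.prems by (simp add: Cons_nth_drop_Suc[symmetric])
      then show "set (drop k (vs[k := b])) \<subseteq> Basis" using that Suc.prems by simp
    qed (use Suc.prems in auto)
    have "f vs = f (vs[k := vs ! k])" by simp
    also have "\<dots> = f (vs[k := \<Sum>b\<in>Basis. (vs ! k \<bullet> b) *\<^sub>R b])" by (simp add: euclidean_representation)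
    also have "\<dots> = (\<Sum>b\<in>Basis. (vs ! k \<bullet> b) *\<^sub>R f (vs[k := b]))"
      using linear_sum[OF lin, of "\<lambda>b. (vs ! k \<bullet> b) *\<^sub>R b" Basis] linear_scale[OF lin] by simp
    also have "\<dots> = 0" using zero by simp
    finally show ?case .
  qed
  from this[of n vs] vs show ?thesis by simp
qed

lemma alternating_form_integral:
  fixes F :: "real \<Rightarrow> 'a::real_vector list \<Rightarrow> real"
  assumes alt: "\<And>t. t \<in> {a..b} \<Longrightarrow> alternating_form n (F t)"
    and int: "\<And>vs. length vs = n \<Longrightarrow> (\<lambda>t. F t vs) integrable_on {a..b}"
  shows "alternating_form n (\<lambda>vs. integral {a..b} (\<lambda>t. F t vs))"
  unfolding alternating_form_def
proof (intro conjI allI impI)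
  fix vs :: "'a list" and i assume vs: "length vs = n \<and> i < n"
  have lin: "linear (\<lambda>u. F t (vs[i := u]))" if "t \<in> {a..b}" for t
    using alt[OF that] vs unfolding alternating_form_def by blast
  show "linear (\<lambda>u. integral {a..b} (\<lambda>t. F t (vs[i := u])))"
  proof (rule linearI)
    fix u v
    have "integral {a..b} (\<lambda>t. F t (vs[i := u + v])) = integral {a..b} (\<lambda>t. F t (vs[i := u]) + F t (vs[i := v]))"
      by (rule integral_cong) (use linear_add[OF lin] in simp)
    also have "\<dots> = integral {a..b} (\<lambda>t. F t (vs[i := u])) + integral {a..b} (\<lambda>t. F t (vs[i := v]))"
      by (rule integral_add) (use int vs in auto)
    finally show "integral {a..b} (\<lambda>t. F t (vs[i := u + v])) =
        integral {a..b} (\<lambda>t. F t (vs[i := u])) + integral {a..b} (\<lambda>t. F t (vs[i := v]))" .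
  next
    fix c u
    have "integral {a..b} (\<lambda>t. F t (vs[i := c *\<^sub>R u])) = integral {a..b} (\<lambda>t. c * F t (vs[i := u]))"
      by (rule integral_cong) (use linear_scale[OF lin] in simp)
    then show "integral {a..b} (\<lambda>t. F t (vs[i := c *\<^sub>R u])) = c *\<^sub>R integral {a..b} (\<lambda>t. F t (vs[i := u]))"
      by simp
  qed
next
  fix vs :: "'a list" and i j assume vs: "length vs = n \<and> i < j \<and> j < n \<and> vs ! i = vs ! j"
  have "integral {a..b} (\<lambda>t. F t vs) = integral {a..b} (\<lambda>t. 0)"
    by (rule integral_cong) (use alt vs in \<open>unfold alternating_form_def, blast\<close>)
  then show "integral {a..b} (\<lambda>t. F t vs) = 0" by simp
qed

lemma integral_linear_combination:
  fixes g :: "'i \<Rightarrow> real \<Rightarrow> real"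
  assumes "finite I" "\<And>i. i \<in> I \<Longrightarrow> g i integrable_on S"
    and "\<And>t. t \<in> S \<Longrightarrow> f t = (\<Sum>i\<in>I. c i * g i t)"
  shows "integral S f = (\<Sum>i\<in>I. c i * integral S (g i))"
proof -
  have "integral S f = integral S (\<lambda>t. \<Sum>i\<in>I. c i * g i t)"
    by (rule integral_cong) (rule assms(3))
  also have "\<dots> = (\<Sum>i\<in>I. integral S (\<lambda>t. c i * g i t))"
    using assms(1,2) by (intro integral_sum integrable_on_mult_right)
  finally show ?thesis by simp
qed

definition cone_operator :: "nat \<Rightarrow> 'a::euclidean_space \<Rightarrow> 'a superform \<Rightarrow> 'a superform" where
  "cone_operator n x0 \<alpha> = (\<lambda>x vs ws.
     integral {0..1} (\<lambda>t. t ^ n * \<alpha> (x0 + t *\<^sub>R (x - x0)) ((x - x0) # vs) ws))"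

context
  fixes U :: "'a::euclidean_space set" and x0 :: 'a and n q :: nat and \<alpha> :: "'a superform"
  assumes U: "open U" and star: "\<And>x t. x \<in> U \<Longrightarrow> t \<in> {0..1} \<Longrightarrow> x0 + t *\<^sub>R (x - x0) \<in> U"
    and \<alpha>: "\<alpha> \<in> superforms (Suc n) q U"
begin

lemma cone_continuous:
  assumes "x \<in> U" "continuous_on U f"
  shows "continuous_on {0..1} (\<lambda>t. f (x0 + t *\<^sub>R (x - x0)))"
  by (rule continuous_on_compose2[OF assms(2)]) (use star[OF assms(1)] in \<open>auto intro!: continuous_intros\<close>)

lemma cone_integrable:
  fixes f :: "'a \<Rightarrow> real"
  assumes "x \<in> U" "continuous_on U f"
  shows "(\<lambda>t. t ^ m * f (x0 + t *\<^sub>R (x - x0))) integrable_on {0..1}"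
  by (intro integrable_continuous_interval continuous_intros cone_continuous assms)

lemma superform_Cons_expand:
  assumes "y \<in> U" "length vs = n" "length ws = q"
  shows "\<alpha> y (v # vs) ws = (\<Sum>b\<in>Basis. (v \<bullet> b) * \<alpha> y (b # vs) ws)"
proof -
  have lin: "linear (\<lambda>u. \<alpha> y (u # vs) ws)"
    using alternating_form_linear[OF superforms_alternating1[OF \<alpha> assms(1,3)], of "[]" vs] assms by simp
  have "\<alpha> y (v # vs) ws = \<alpha> y ((\<Sum>b\<in>Basis. (v \<bullet> b) *\<^sub>R b) # vs) ws" by (simp add: euclidean_representation)
  also have "\<dots> = (\<Sum>b\<in>Basis. (v \<bullet> b) * \<alpha> y (b # vs) ws)"
    using linear_sum[OF lin, of "\<lambda>b. (v \<bullet> b) *\<^sub>R b" Basis] linear_scale[OF lin] by simp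
  finally show ?thesis .
qed

lemma derivative_Cons_expand:
  assumes "y \<in> U" "length vs = n" "length ws = q"
  shows "frechet_derivative (\<lambda>y. \<alpha> y (v # vs) ws) (at y) w =
    (\<Sum>b\<in>Basis. (v \<bullet> b) * frechet_derivative (\<lambda>y. \<alpha> y (b # vs) ws) (at y) w)"
proof -
  have d: "(\<lambda>y. \<alpha> y (b # vs) ws) differentiable (at y)" for b
    by (rule superforms_differentiable[OF \<alpha> assms(1)]) (use assms in auto)
  have "((\<lambda>y. \<Sum>b\<in>Basis. (v \<bullet> b) * \<alpha> y (b # vs) ws) has_derivative
      (\<lambda>w. \<Sum>b\<in>Basis. (v \<bullet> b) * frechet_derivative (\<lambda>y. \<alpha> y (b # vs) ws) (at y) w)) (at y)"
    by (intro has_derivative_sum has_derivative_mult_right d[unfolded frechet_derivative_works])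
  then have "((\<lambda>y. \<alpha> y (v # vs) ws) has_derivative
      (\<lambda>w. \<Sum>b\<in>Basis. (v \<bullet> b) * frechet_derivative (\<lambda>y. \<alpha> y (b # vs) ws) (at y) w)) (at y)"
    by (rule has_derivative_transform_within_open[OF _ U assms(1)])
       (use superform_Cons_expand assms in simp)
  then show ?thesis by (rule fun_cong[OF frechet_derivative_at[symmetric]])
qed

lemma cone_operator_expand:
  assumes x: "x \<in> U" and l: "length vs = n" "length ws = q"
  shows "cone_operator n x0 \<alpha> x vs ws =
    (\<Sum>b\<in>Basis. ((x - x0) \<bullet> b) * integral {0..1} (\<lambda>t. t ^ n * \<alpha> (x0 + t *\<^sub>R (x - x0)) (b # vs) ws))"
proof -
  have int: "(\<lambda>t. t ^ n * \<alpha> (x0 + t *\<^sub>R (x - x0)) (b # vs) ws) integrable_on {0..1}" for b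
    by (rule cone_integrable[OF x smooth_on_continuous_on[OF superforms_smooth[OF \<alpha>]]]) (use l in auto)
  show ?thesis
    unfolding cone_operator_def
    by (rule integral_linear_combination[OF finite_Basis int])
       (simp add: superform_Cons_expand[OF star[OF x] l, of _ "x - x0"] sum_distrib_left mult_ac)
qed

lemma cone_operator_superforms: "cone_operator n x0 \<alpha> \<in> superforms n q U"
  unfolding superforms_def mem_Collect_eq
proof (intro conjI ballI allI impI)
  fix x ws vs assume x: "x \<in> U"
  have int: "(\<lambda>t. t ^ n * \<alpha> (x0 + t *\<^sub>R (x - x0)) ((x - x0) # vs) ws) integrable_on {0..1}"
    if "length vs = n" "length ws = q" for vs ws
    by (rule cone_integrable[OF x smooth_on_continuous_on[OF superforms_smooth[OF \<alpha>]]]) (use that in auto)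
  show "alternating_form n (\<lambda>vs. cone_operator n x0 \<alpha> x vs ws)" if "length ws = q"
    unfolding cone_operator_def
    by (intro alternating_form_integral alternating_form_scale alternating_form_Cons
        superforms_alternating1[OF \<alpha> star[OF x]] int that)
  show "alternating_form q (\<lambda>ws. cone_operator n x0 \<alpha> x vs ws)" if "length vs = n"
    unfolding cone_operator_def
    by (intro alternating_form_integral alternating_form_scale
        superforms_alternating2[OF \<alpha> star[OF x]] int that) (use that in auto)
next
  fix vs ws :: "'a list" assume l: "length vs = n \<and> length ws = q"
  have "smooth_on U (\<lambda>x. \<Sum>b\<in>Basis. (x \<bullet> b - x0 \<bullet> b) * integral {0..1} (\<lambda>t. t ^ n * \<alpha> (x0 + t *\<^sub>R (x - x0)) (b # vs) ws))"
    by (intro smooth_on_sum smooth_on_mult smooth_on_diff smooth_on_const smooth_on_linear U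
        bounded_linear_inner_left smooth_on_cone_integral[OF U star] superforms_smooth[OF \<alpha>])
       (use l in auto)
  then show "smooth_on U (\<lambda>x. cone_operator n x0 \<alpha> x vs ws)"
    by (rule smooth_on_cong[OF U, rotated]) (use cone_operator_expand l in \<open>simp add: inner_diff_left\<close>)
qed

lemma cone_operator_derivative:
  assumes x: "x \<in> U" and l: "length vs = n" "length ws = q"
  shows "frechet_derivative (\<lambda>y. cone_operator n x0 \<alpha> y vs ws) (at x) w =
    integral {0..1} (\<lambda>t. t ^ n * \<alpha> (x0 + t *\<^sub>R (x - x0)) (w # vs) ws) +
    integral {0..1} (\<lambda>t. t ^ Suc n *
      frechet_derivative (\<lambda>y. \<alpha> y ((x - x0) # vs) ws) (at (x0 + t *\<^sub>R (x - x0))) w)"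
proof -
  let ?y = "\<lambda>t. x0 + t *\<^sub>R (x - x0)"
  define I where "I b y = integral {0..1} (\<lambda>t. t ^ n * \<alpha> (x0 + t *\<^sub>R (y - x0)) (b # vs) ws)" for b y
  define J where "J b w = integral {0..1} (\<lambda>t. t ^ Suc n * frechet_derivative (\<lambda>y. \<alpha> y (b # vs) ws) (at (?y t)) w)" for b w
  have sm: "smooth_on U (\<lambda>y. \<alpha> y (b # vs) ws)" for b
    by (rule superforms_smooth[OF \<alpha>]) (use l in auto)
  have c1: "Ck_on (Suc 0) U (\<lambda>y. \<alpha> y (b # vs) ws)" for b
    using sm[of b] unfolding smooth_on_def by blast
  have I: "(I b has_derivative J b) (at x)" for b
    unfolding I_def J_def by (rule has_derivative_cone_integral[OF U star c1 x])
  have "((\<lambda>y. (y - x0) \<bullet> b) has_derivative (\<lambda>w. w \<bullet> b)) (at x)" for b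
    by (auto intro!: derivative_eq_intros)
  then have "((\<lambda>y. \<Sum>b\<in>Basis. ((y - x0) \<bullet> b) * I b y) has_derivative
      (\<lambda>w. \<Sum>b\<in>Basis. ((x - x0) \<bullet> b) * J b w + (w \<bullet> b) * I b x)) (at x)"
    by (intro has_derivative_sum has_derivative_mult I)
  then have "((\<lambda>y. cone_operator n x0 \<alpha> y vs ws) has_derivative
      (\<lambda>w. \<Sum>b\<in>Basis. ((x - x0) \<bullet> b) * J b w + (w \<bullet> b) * I b x)) (at x)"
    by (rule has_derivative_transform_within_open[OF _ U x]) (use cone_operator_expand l in \<open>simp add: I_def\<close>)
  then have D: "frechet_derivative (\<lambda>y. cone_operator n x0 \<alpha> y vs ws) (at x) w =
      (\<Sum>b\<in>Basis. ((x - x0) \<bullet> b) * J b w + (w \<bullet> b) * I b x)"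
    by (rule fun_cong[OF frechet_derivative_at[symmetric]])
  have int1: "(\<lambda>t. t ^ n * \<alpha> (?y t) (b # vs) ws) integrable_on {0..1}" for b
    by (rule cone_integrable[OF x smooth_on_continuous_on[OF sm]])
  have int2: "(\<lambda>t. t ^ Suc n * frechet_derivative (\<lambda>y. \<alpha> y (b # vs) ws) (at (?y t)) w) integrable_on {0..1}" for b
    by (rule cone_integrable[OF x smooth_on_continuous_on[OF smooth_on_derivative[OF sm]]])
  have 1: "integral {0..1} (\<lambda>t. t ^ n * \<alpha> (?y t) (w # vs) ws) = (\<Sum>b\<in>Basis. (w \<bullet> b) * I b x)"
    unfolding I_def
    by (rule integral_linear_combination[OF finite_Basis int1])
       (simp add: superform_Cons_expand[OF star[OF x] l, of _ w] sum_distrib_left mult_ac)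
  have 2: "integral {0..1} (\<lambda>t. t ^ Suc n * frechet_derivative (\<lambda>y. \<alpha> y ((x - x0) # vs) ws) (at (?y t)) w) =
      (\<Sum>b\<in>Basis. ((x - x0) \<bullet> b) * J b w)"
    unfolding J_def
    by (rule integral_linear_combination[OF finite_Basis int2])
       (simp add: derivative_Cons_expand[OF star[OF x] l, of _ "x - x0"] sum_distrib_left mult_ac)
  show ?thesis unfolding D 1 2 by (simp add: sum.distrib)
qed

lemma cone_operator_homotopy:
  assumes x: "x \<in> U" and l: "length vs = Suc n" "length ws = q"
  shows "d_prime (cone_operator n x0 \<alpha>) x vs ws = \<alpha> x vs ws -
    integral {0..1} (\<lambda>t. t ^ Suc n * d_prime \<alpha> (x0 + t *\<^sub>R (x - x0)) ((x - x0) # vs) ws)"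
proof -
  let ?y = "\<lambda>t. x0 + t *\<^sub>R (x - x0)"
  define G where "G us w t = frechet_derivative (\<lambda>y. \<alpha> y us ws) (at (?y t)) w" for us w t
  have sm: "smooth_on U (\<lambda>y. \<alpha> y us ws)" if "length us = Suc n" for us
    using superforms_smooth[OF \<alpha> that l(2)] .
  have intG: "(\<lambda>t. t ^ m * G us w t) integrable_on {0..1}" if "length us = Suc n" for m us w
    unfolding G_def by (rule cone_integrable[OF x smooth_on_continuous_on[OF smooth_on_derivative[OF sm[OF that]]]])
  have inta: "(\<lambda>t. t ^ m * \<alpha> (?y t) vs ws) integrable_on {0..1}" for m
    by (rule cone_integrable[OF x smooth_on_continuous_on[OF sm[OF l(1)]]])
  let ?T = "\<lambda>i. integral {0..1} (\<lambda>t. t ^ Suc n * G ((x - x0) # omit i vs) (vs ! i) t)"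
  let ?A = "integral {0..1} (\<lambda>t. t ^ n * \<alpha> (?y t) vs ws)"
  have "d_prime (cone_operator n x0 \<alpha>) x vs ws = (\<Sum>i<Suc n. ?A + (-1) ^ i * ?T i)"
    unfolding d_prime_def[of "cone_operator n x0 \<alpha>"] l
  proof (intro sum.cong refl)
    fix i assume "i \<in> {..<Suc n}"
    then have i: "i < Suc n" "length (omit i vs) = n" using l by auto
    have "integral {0..1} (\<lambda>t. t ^ n * \<alpha> (?y t) (vs ! i # omit i vs) ws) =
        integral {0..1} (\<lambda>t. (-1) ^ i * (t ^ n * \<alpha> (?y t) vs ws))"
      by (rule integral_cong)
         (simp add: alternating_form_nth_omit[OF superforms_alternating1[OF \<alpha> star[OF x] l(2)] l(1) i(1)])
    also have "\<dots> = (-1) ^ i * ?A" by simp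
    finally have "integral {0..1} (\<lambda>t. t ^ n * \<alpha> (?y t) (vs ! i # omit i vs) ws) = (-1) ^ i * ?A" .
    then show "(-1) ^ i * frechet_derivative (\<lambda>y. cone_operator n x0 \<alpha> y (omit i vs) ws) (at x) (vs ! i) =
        ?A + (-1) ^ i * ?T i"
      unfolding cone_operator_derivative[OF x i(2) l(2)] G_def[symmetric]
      by (simp add: distrib_left mult.assoc[symmetric] power_add[symmetric])
  qed
  then have 1: "d_prime (cone_operator n x0 \<alpha>) x vs ws = Suc n * ?A + (\<Sum>i<Suc n. (-1) ^ i * ?T i)"
    by (simp only: sum.distrib sum_constant card_lessThan)
  have dp: "d_prime \<alpha> (?y t) ((x - x0) # vs) ws =
      G vs (x - x0) t - (\<Sum>i<Suc n. (-1) ^ i * G ((x - x0) # omit i vs) (vs ! i) t)" for t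
    unfolding d_prime_def G_def length_Cons l sum.lessThan_Suc_shift[of _ "Suc n"]
    by (simp add: sum_negf del: sum.lessThan_Suc)
  have "integral {0..1} (\<lambda>t. t ^ Suc n * d_prime \<alpha> (?y t) ((x - x0) # vs) ws) =
      integral {0..1} (\<lambda>t. t ^ Suc n * G vs (x - x0) t -
        (\<Sum>i<Suc n. (-1) ^ i * (t ^ Suc n * G ((x - x0) # omit i vs) (vs ! i) t)))"
    unfolding dp by (rule integral_cong) (simp add: right_diff_distrib sum_distrib_left mult_ac del: sum.lessThan_Suc)
  also have "\<dots> = integral {0..1} (\<lambda>t. t ^ Suc n * G vs (x - x0) t) -
      integral {0..1} (\<lambda>t. \<Sum>i<Suc n. (-1) ^ i * (t ^ Suc n * G ((x - x0) # omit i vs) (vs ! i) t))"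
    by (intro integral_diff integrable_sum integrable_on_mult_right intG) (use l in auto)
  also have "integral {0..1} (\<lambda>t. \<Sum>i<Suc n. (-1) ^ i * (t ^ Suc n * G ((x - x0) # omit i vs) (vs ! i) t)) =
      (\<Sum>i<Suc n. (-1) ^ i * ?T i)"
  proof (rule integral_linear_combination)
    fix i assume "i \<in> {..<Suc n}"
    then show "(\<lambda>t. t ^ Suc n * G ((x - x0) # omit i vs) (vs ! i) t) integrable_on {0..1}"
      by (intro intG) (use l in simp)
  qed (rule finite_lessThan refl)+
  finally have 2: "integral {0..1} (\<lambda>t. t ^ Suc n * d_prime \<alpha> (?y t) ((x - x0) # vs) ws) =
      integral {0..1} (\<lambda>t. t ^ Suc n * G vs (x - x0) t) - (\<Sum>i<Suc n. (-1) ^ i * ?T i)" .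
  have "((\<lambda>t. Suc n * (t ^ n * \<alpha> (?y t) vs ws) + t ^ Suc n * G vs (x - x0) t) has_integral
      (1 ^ Suc n * \<alpha> (?y 1) vs ws - 0 ^ Suc n * \<alpha> (?y 0) vs ws)) {0..1}"
  proof (rule fundamental_theorem_of_calculus)
    fix t :: real assume t: "t \<in> {0..1}"
    have "((\<lambda>t. \<alpha> (?y t) vs ws) has_real_derivative G vs (x - x0) t) (at t)"
      unfolding G_def
      by (rule has_derivative_along_line[OF superforms_has_derivative[OF \<alpha> star[OF x t] l]])
    from DERIV_mult[OF DERIV_power[OF DERIV_ident, of "Suc n"] this]
    have "((\<lambda>t. t ^ Suc n * \<alpha> (?y t) vs ws) has_real_derivative
        Suc n * (t ^ n * \<alpha> (?y t) vs ws) + t ^ Suc n * G vs (x - x0) t) (at t)"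
      by (simp add: mult_ac)
    then show "((\<lambda>t. t ^ Suc n * \<alpha> (?y t) vs ws) has_vector_derivative
        Suc n * (t ^ n * \<alpha> (?y t) vs ws) + t ^ Suc n * G vs (x - x0) t) (at t within {0..1})"
      unfolding has_real_derivative_iff_has_vector_derivative by (rule has_vector_derivative_at_within)
  qed simp
  then have "integral {0..1} (\<lambda>t. Suc n * (t ^ n * \<alpha> (?y t) vs ws) + t ^ Suc n * G vs (x - x0) t) = \<alpha> x vs ws"
    by (simp add: integral_unique)
  moreover have "integral {0..1} (\<lambda>t. Suc n * (t ^ n * \<alpha> (?y t) vs ws) + t ^ Suc n * G vs (x - x0) t) =
      integral {0..1} (\<lambda>t. Suc n * (t ^ n * \<alpha> (?y t) vs ws)) + integral {0..1} (\<lambda>t. t ^ Suc n * G vs (x - x0) t)"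
    by (intro integral_add integrable_on_mult_right inta intG l)
  moreover have "integral {0..1} (\<lambda>t. Suc n * (t ^ n * \<alpha> (?y t) vs ws)) = Suc n * ?A" by simp
  ultimately show ?thesis unfolding 1 2 by simp
qed

end

lemma open_star_kernel:
  fixes x0 :: "'a::euclidean_space"
  assumes "open V"
  shows "open {y. \<forall>t\<in>{0..1}. x0 + t *\<^sub>R (y - x0) \<in> V}"
proof -
  have "closed ((\<lambda>p::real \<times> 'a. x0 + fst p *\<^sub>R (snd p - x0)) -` (- V))"
    using assms by (intro closed_vimage) (auto intro!: continuous_intros)
  then have "closed {p::real \<times> 'a. x0 + fst p *\<^sub>R (snd p - x0) \<in> - V}"
    by (simp add: vimage_def)
  then have "closed {y. \<exists>t. t \<in> {0..1} \<and> (t, y) \<in> {p::real \<times> 'a. x0 + fst p *\<^sub>R (snd p - x0) \<in> - V}}"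
    by (rule closed_compact_projection[OF compact_Icc])
  moreover have "{y. \<forall>t\<in>{0..1}. x0 + t *\<^sub>R (y - x0) \<in> V} =
      - {y. \<exists>t. t \<in> {0..1} \<and> (t, y) \<in> {p::real \<times> 'a. x0 + fst p *\<^sub>R (snd p - x0) \<in> - V}}" by auto
  ultimately show ?thesis by (simp add: open_Compl)
qed

lemma polyhedron_smooth_zero_set:
  fixes S :: "'a::euclidean_space set"
  assumes "polyhedron S"
  shows "\<exists>g. smooth_on UNIV g \<and> (\<forall>x. g x \<ge> 0) \<and> (\<forall>x. g x = 0 \<longleftrightarrow> x \<in> S)"
proof -
  obtain F where F: "finite F" "S = \<Inter> F" "\<forall>h\<in>F. \<exists>a b. a \<noteq> 0 \<and> h = {x. a \<bullet> x \<le> b}"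
    using assms unfolding polyhedron_def by blast
  then obtain a b where ab: "\<And>h. h \<in> F \<Longrightarrow> h = {x. a h \<bullet> x \<le> b h}" by metis
  let ?g = "\<lambda>x. \<Sum>h\<in>F. flat (a h \<bullet> x - b h)"
  have "smooth_on UNIV ?g"
    by (intro smooth_on_sum smooth_on_flat smooth_on_diff smooth_on_const smooth_on_linear
        bounded_linear_inner_right open_UNIV)
  moreover have "?g x = 0 \<longleftrightarrow> x \<in> S" for x
  proof -
    have "?g x = 0 \<longleftrightarrow> (\<forall>h\<in>F. flat (a h \<bullet> x - b h) = 0)"
      by (rule sum_nonneg_eq_0_iff) (use F flat_nonneg in auto)
    also have "\<dots> \<longleftrightarrow> (\<forall>h\<in>F. x \<in> h)" using ab by (auto simp: flat_eq_0_iff)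
    finally show ?thesis using F(2) by blast
  qed
  ultimately show ?thesis using flat_nonneg by (intro exI[of _ ?g]) (auto intro: sum_nonneg)
qed

context cell_complex
begin

lemma face_Int:
  assumes "\<sigma> \<in> C" "\<tau> \<in> C"
  shows "(\<sigma> \<inter> \<tau>) face_of \<sigma>"
  using polyhedral assms unfolding polyhedral_complex_def by blast

lemma finite_C: "finite C"
  using polyhedral unfolding polyhedral_complex_def by blast

lemma open_segment_cell:
  assumes "\<sigma> \<in> C" "\<tau> \<in> C" "x \<in> \<sigma>" "y \<in> \<sigma>" "z \<in> \<tau>" "z \<in> open_segment x y"
  shows "x \<in> \<tau> \<and> y \<in> \<tau>"
proof -
  have "z \<in> \<sigma>" using convex_cell[OF assms(1)] assms unfolding convex_contains_open_segment by blast
  then show ?thesis using face_Int[OF assms(1,2)] assms unfolding face_of_def by blast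
qed

definition star :: "'a \<Rightarrow> 'a set" where
  "star x = {y \<in> support C. \<forall>\<sigma>\<in>C. y \<in> \<sigma> \<longrightarrow> x \<in> \<sigma>}"

lemma smooth_set_star: "smooth_set (star x)"
proof -
  have "\<forall>\<sigma>\<in>C. \<exists>g. smooth_on UNIV g \<and> (\<forall>x. g x \<ge> 0) \<and> (\<forall>x. g x = 0 \<longleftrightarrow> x \<in> \<sigma>)"
    using polyhedron_smooth_zero_set polyhedral unfolding polyhedral_complex_def by blast
  then obtain g where g: "\<And>\<sigma>. \<sigma> \<in> C \<Longrightarrow> smooth_on UNIV (g \<sigma>)" "\<And>\<sigma> y. \<sigma> \<in> C \<Longrightarrow> g \<sigma> y \<ge> 0"
    "\<And>\<sigma> y. \<sigma> \<in> C \<Longrightarrow> g \<sigma> y = 0 \<longleftrightarrow> y \<in> \<sigma>" by metis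
  let ?D = "{\<sigma> \<in> C. x \<notin> \<sigma>}"
  let ?f = "\<lambda>y. \<Prod>\<sigma>\<in>?D. g \<sigma> y"
  have nn: "?f y \<ge> 0" for y using g by (intro prod_nonneg) auto
  have "?f y = 0 \<longleftrightarrow> (\<exists>\<sigma>\<in>?D. y \<in> \<sigma>)" for y using g(3) finite_C by (simp add: prod_zero_iff)
  then have "?f y > 0 \<longleftrightarrow> (\<forall>\<sigma>\<in>C. y \<in> \<sigma> \<longrightarrow> x \<in> \<sigma>)" for y
    using nn[of y] by (auto simp: less_le)
  moreover have "smooth_on UNIV ?f" using g by (intro smooth_on_prod) auto
  ultimately show ?thesis unfolding smooth_set_def star_def using nn by (intro exI[of _ ?f]) auto
qed

lemma star_segment:
  assumes "y \<in> star x" "t \<in> {0..1}"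
  shows "x + t *\<^sub>R (y - x) \<in> star x" and "\<And>\<sigma>. \<sigma> \<in> C \<Longrightarrow> y \<in> \<sigma> \<Longrightarrow> x + t *\<^sub>R (y - x) \<in> \<sigma>"
proof -
  let ?z = "x + t *\<^sub>R (y - x)"
  have z: "?z = (1 - t) *\<^sub>R x + t *\<^sub>R y" by (simp add: algebra_simps)
  show in\<sigma>: "?z \<in> \<sigma>" if "\<sigma> \<in> C" "y \<in> \<sigma>" for \<sigma>
  proof -
    have "x \<in> \<sigma>" using assms(1) that unfolding star_def by blast
    then show ?thesis unfolding z using convex_cell[OF that(1)] that assms(2) by (intro convexD) auto
  qed
  obtain \<sigma> where \<sigma>: "\<sigma> \<in> C" "y \<in> \<sigma>" using assms(1) unfolding star_def by blast
  have x: "x \<in> \<sigma>" using assms(1) \<sigma> unfolding star_def by blast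
  have "x \<in> \<tau>" if \<tau>: "\<tau> \<in> C" "?z \<in> \<tau>" for \<tau>
  proof (cases "t = 0 \<or> t = 1 \<or> x = y")
    case True
    then have "?z = x \<or> ?z = y" by auto
    then show ?thesis using \<tau> assms(1) unfolding star_def by (elim disjE) simp_all
  next
    case False
    then have "x \<noteq> y" "0 < t" "t < 1" using assms(2) by auto
    then have "?z \<in> open_segment x y" unfolding in_segment z by blast
    then show ?thesis using open_segment_cell[OF \<sigma>(1) \<tau>(1) x \<sigma>(2) \<tau>(2)] by blast
  qed
  then show "?z \<in> star x" using in\<sigma>[OF \<sigma>] \<sigma>(1) unfolding star_def by blast
qed

lemma star_Int:
  assumes "star x \<inter> star y \<noteq> {}"
  shows "star x \<inter> star y = star (midpoint x y)"
proof -
  obtain z \<sigma> where z: "z \<in> star x" "z \<in> star y" and \<sigma>: "\<sigma> \<in> C" "z \<in> \<sigma>"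
    using assms unfolding star_def by blast
  then have xy: "x \<in> \<sigma>" "y \<in> \<sigma>" unfolding star_def by auto
  have "midpoint x y \<in> \<tau> \<longleftrightarrow> x \<in> \<tau> \<and> y \<in> \<tau>" if \<tau>: "\<tau> \<in> C" for \<tau>
  proof
    assume m: "midpoint x y \<in> \<tau>"
    show "x \<in> \<tau> \<and> y \<in> \<tau>"
    proof (cases "x = y")
      case True
      then show ?thesis using m by simp
    next
      case False
      then show ?thesis using open_segment_cell[OF \<sigma>(1) \<tau> xy m] by simp
    qed
  next
    assume "x \<in> \<tau> \<and> y \<in> \<tau>"
    then show "midpoint x y \<in> \<tau>"
      using convex_cell[OF \<tau>] midpoint_in_closed_segment closed_segment_subset by blast
  qed
  then show ?thesis unfolding star_def by auto
qed

lemma parallel_spaceI: "x \<in> \<sigma> \<Longrightarrow> y \<in> \<sigma> \<Longrightarrow> y - x \<in> parallel_space \<sigma>"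
  unfolding parallel_space_def using hull_subset by fastforce

lemma closed_forms_star_Suc:
  assumes "\<alpha> \<in> closed_forms (Suc n) q (star x0)"
  shows "\<alpha> \<in> exact_forms (Suc n) q (star x0)"
proof -
  have r: "\<alpha> \<in> reps (Suc n) q (star x0)" and null: "d_prime \<alpha> \<in> null (Suc (Suc n)) q (star x0)"
    using assms unfolding closed_forms_def by auto
  obtain V where V: "open V" "V \<inter> support C = star x0" "\<alpha> \<in> superforms (Suc n) q V"
    using r unfolding reps_def by blast
  define W where "W = {y. \<forall>t\<in>{0..1}. x0 + t *\<^sub>R (y - x0) \<in> V}"
  have W: "open W" unfolding W_def using V(1) by (rule open_star_kernel)
  have WV: "W \<subseteq> V"
  proof
    fix y assume "y \<in> W"
    then have "x0 + 1 *\<^sub>R (y - x0) \<in> V" unfolding W_def by fastforce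
    then show "y \<in> V" by simp
  qed
  have Wstar: "x0 + t *\<^sub>R (x - x0) \<in> W" if "x \<in> W" "t \<in> {0..1}" for x t
    unfolding W_def
  proof (intro CollectI ballI)
    fix s :: real assume "s \<in> {0..1}"
    then have "s * t \<in> {0..1}" using that(2) by (auto intro: mult_le_one)
    then have "x0 + (s * t) *\<^sub>R (x - x0) \<in> V" using that(1) unfolding W_def by blast
    then show "x0 + s *\<^sub>R (x0 + t *\<^sub>R (x - x0) - x0) \<in> V" by simp
  qed
  have WC: "W \<inter> support C = star x0"
  proof
    show "W \<inter> support C \<subseteq> star x0" using WV V(2) by blast
    show "star x0 \<subseteq> W \<inter> support C"
    proof
      fix y assume y: "y \<in> star x0"
      then have "x0 + t *\<^sub>R (y - x0) \<in> V" if "t \<in> {0..1}" for t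
        using star_segment(1)[OF y that] V(2) by blast
      then show "y \<in> W \<inter> support C" using y unfolding W_def star_def by blast
    qed
  qed
  have \<alpha>W: "\<alpha> \<in> superforms (Suc n) q W" using V(3) WV by (rule superforms_subset)
  let ?K = "cone_operator n x0 \<alpha>"
  have "?K \<in> reps n q (star x0)"
    by (rule repsI[OF W WC cone_operator_superforms[OF W Wstar \<alpha>W]])
  moreover have "\<alpha> - d_prime ?K \<in> null (Suc n) q (star x0)"
  proof (rule nullI)
    fix \<sigma> x vs ws
    assume h: "\<sigma> \<in> C" "x \<in> \<sigma>" "x \<in> star x0" "length vs = Suc n" "set vs \<subseteq> parallel_space \<sigma>"
      "length ws = q" "set ws \<subseteq> parallel_space \<sigma>"
    have x0: "x0 \<in> \<sigma>" using h unfolding star_def by blast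
    have "integral {0..1} (\<lambda>t. t ^ Suc n * d_prime \<alpha> (x0 + t *\<^sub>R (x - x0)) ((x - x0) # vs) ws) =
        integral {0..1} (\<lambda>t::real. 0)"
    proof (rule integral_cong)
      fix t :: real assume t: "t \<in> {0..1}"
      have "d_prime \<alpha> (x0 + t *\<^sub>R (x - x0)) ((x - x0) # vs) ws = 0"
        by (rule nullD[OF null h(1) star_segment(2)[OF h(3) t h(1,2)] star_segment(1)[OF h(3) t]])
           (use h parallel_spaceI[OF x0 h(2)] in auto)
      then show "t ^ Suc n * d_prime \<alpha> (x0 + t *\<^sub>R (x - x0)) ((x - x0) # vs) ws = 0" by simp
    qed
    moreover have "x \<in> W" using h(3) WC by blast
    ultimately show "(\<alpha> - d_prime ?K) x vs ws = 0"
      using cone_operator_homotopy[OF W Wstar \<alpha>W _ h(4,6)] by simp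
  qed
  ultimately show ?thesis using r by auto
qed

lemma closed_forms_star_0:
  assumes "\<alpha> \<in> closed_forms 0 q (star x0)"
    and h: "\<sigma> \<in> C" "y \<in> \<sigma>" "y \<in> star x0" "length ws = q" "set ws \<subseteq> parallel_space \<sigma>"
  shows "\<alpha> y [] ws = \<alpha> x0 [] ws"
proof -
  have r: "\<alpha> \<in> reps 0 q (star x0)" and null: "d_prime \<alpha> \<in> null (Suc 0) q (star x0)"
    using assms unfolding closed_forms_def by auto
  obtain V where V: "V \<inter> support C = star x0" "\<alpha> \<in> superforms 0 q V"
    using r unfolding reps_def by blast
  have x0: "x0 \<in> \<sigma>" using h unfolding star_def by blast
  have "\<exists>z::real. 0 < z \<and> z < 1 \<and> \<alpha> (x0 + 1 *\<^sub>R (y - x0)) [] ws - \<alpha> (x0 + 0 *\<^sub>R (y - x0)) [] ws = (1 - 0) * (0::real)"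
  proof (rule MVT2[where f = "\<lambda>t. \<alpha> (x0 + t *\<^sub>R (y - x0)) [] ws" and f' = "\<lambda>_. 0"])
    fix t :: real assume "0 \<le> t" "t \<le> 1"
    then have t: "t \<in> {0..1}" by simp
    have "x0 + t *\<^sub>R (y - x0) \<in> V" using star_segment(1)[OF h(3) t] V(1) by blast
    then have "((\<lambda>t. \<alpha> (x0 + t *\<^sub>R (y - x0)) [] ws) has_real_derivative
        frechet_derivative (\<lambda>y. \<alpha> y [] ws) (at (x0 + t *\<^sub>R (y - x0))) (y - x0)) (at t)"
      by (intro has_derivative_along_line superforms_has_derivative[OF V(2)]) (use h in auto)
    moreover have "d_prime \<alpha> (x0 + t *\<^sub>R (y - x0)) [y - x0] ws = 0"
      by (rule nullD[OF null h(1) star_segment(2)[OF h(3) t h(1,2)] star_segment(1)[OF h(3) t]])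
         (use h parallel_spaceI[OF x0 h(2)] in auto)
    ultimately show "((\<lambda>t. \<alpha> (x0 + t *\<^sub>R (y - x0)) [] ws) has_real_derivative 0) (at t)"
      by (simp add: d_prime_def)
  qed simp
  then show ?thesis by auto
qed

lemma finite_rows_star: "finite_rows q (star x0)"
  unfolding finite_rows_def
proof
  fix p
  have ro: "rel_open (star x0)" using smooth_set_star smooth_set_rel_open by blast
  show "fin_codim (closed_forms p q (star x0)) (exact_forms p q (star x0))"
  proof (cases p)
    case 0
    define I :: "'a list set" where "I = {ws. set ws \<subseteq> Basis \<and> length ws = q}"
    have "finite I" unfolding I_def by (rule finite_lists_length_eq) simp
    then have "fin_codim (closed_forms 0 q (star x0))
        {\<alpha> \<in> closed_forms 0 q (star x0). \<forall>ws\<in>I. \<alpha> x0 [] ws = 0}"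
      using subspace_closed_forms[OF ro] by (rule fin_codim_kernels) auto
    moreover have "\<alpha> \<in> exact_forms 0 q (star x0)"
      if a: "\<alpha> \<in> closed_forms 0 q (star x0)" "\<And>ws. ws \<in> I \<Longrightarrow> \<alpha> x0 [] ws = 0" for \<alpha>
    proof -
      have r: "\<alpha> \<in> reps 0 q (star x0)" using a unfolding closed_forms_def by auto
      obtain V where V: "V \<inter> support C = star x0" "\<alpha> \<in> superforms 0 q V"
        using r unfolding reps_def by blast
      have "\<alpha> \<in> null 0 q (star x0)"
      proof (rule nullI)
        fix \<sigma> y vs ws
        assume h: "\<sigma> \<in> C" "y \<in> \<sigma>" "y \<in> star x0" "length vs = 0" "set vs \<subseteq> parallel_space \<sigma>"
          "length ws = q" "set ws \<subseteq> parallel_space \<sigma>"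
        have "x0 \<in> V" using star_segment(1)[OF h(3), of 0] V(1) by auto
        then have "\<alpha> x0 [] ws = 0"
          using multilinear_zero[OF superforms_alternating2[OF V(2)] _ h(6)] a(2) unfolding I_def by simp
        then show "\<alpha> y vs ws = 0" using closed_forms_star_0[OF a(1) h(1,2,3,6,7)] h(4) by simp
      qed
      then show ?thesis using r by simp
    qed
    ultimately show ?thesis unfolding 0 by (elim fin_codim_mono) auto
  next
    case (Suc n)
    show ?thesis unfolding Suc
      using fin_codim_mono[OF fin_codim_self[OF subspace_exact_forms[OF ro]]] closed_forms_star_Suc by blast
  qed
qed

lemma null_empty: "\<alpha> \<in> null p q {}"
  by (rule nullI) simp

lemma finite_rows_empty: "finite_rows q {}"
  unfolding finite_rows_def
proof
  fix p
  have ro: "rel_open {}" unfolding rel_open_def by auto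
  have "closed_forms p q {} \<subseteq> exact_forms p q {}"
  proof (cases p)
    case 0
    then show ?thesis by (auto simp: closed_forms_def null_empty)
  next
    case (Suc n)
    have "0 \<in> reps n q {}" by (rule reps_0[OF ro])
    then show ?thesis unfolding Suc closed_forms_def by (auto simp: null_empty)
  qed
  then show "fin_codim (closed_forms p q {}) (exact_forms p q {})"
    using fin_codim_mono[OF fin_codim_self[OF subspace_exact_forms[OF ro]]] by blast
qed

lemma smooth_set_empty: "smooth_set {}"
  unfolding smooth_set_def by (intro exI[of _ "\<lambda>_. 0"]) (simp add: smooth_on_const)

text \<open>Stars are stable under intersection up to the empty set, so the intersection of a star with
  a union of \<open>n\<close> stars is again a union of at most \<open>n\<close> stars.\<close>

lemma finite_rows_Union_stars:
  assumes "finite S" "S \<subseteq> insert {} (range star)" "card S \<le> n"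
  shows "smooth_set (\<Union> S) \<and> finite_rows q (\<Union> S)"
  using assms
proof (induction n arbitrary: S)
  case 0
  then show ?case using smooth_set_empty finite_rows_empty by simp
next
  case (Suc n)
  show ?case
  proof (cases "S = {}")
    case True
    then show ?thesis using smooth_set_empty finite_rows_empty by simp
  next
    case False
    then obtain A T where S: "S = insert A T" "A \<notin> T" by (metis all_not_in_conv mk_disjoint_insert)
    have T: "finite T" "T \<subseteq> insert {} (range star)" "card T \<le> n" using Suc.prems S by auto
    have A: "A = {} \<or> (\<exists>x. A = star x)" using Suc.prems S by auto
    have sub: "(\<inter>) A ` T \<subseteq> insert {} (range star)"
    proof
      fix X assume "X \<in> (\<inter>) A ` T"
      then obtain B where B: "X = A \<inter> B" "B = {} \<or> (\<exists>x. B = star x)" using T(2) by auto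
      then show "X \<in> insert {} (range star)" using A star_Int by (metis Int_empty_left Int_empty_right insertCI rangeI)
    qed
    have "card ((\<inter>) A ` T) \<le> n" using card_image_le[OF T(1)] T(3) le_trans by blast
    then have I: "smooth_set (\<Union> ((\<inter>) A ` T)) \<and> finite_rows q (\<Union> ((\<inter>) A ` T))"
      using Suc.IH sub T(1) by blast
    have IT: "smooth_set (\<Union> T) \<and> finite_rows q (\<Union> T)" using Suc.IH T by blast
    have fA: "smooth_set A" "finite_rows q A"
      using A smooth_set_empty finite_rows_empty smooth_set_star finite_rows_star by auto
    have "A \<inter> \<Union> T = \<Union> ((\<inter>) A ` T)" by auto
    then have "finite_rows q (A \<inter> \<Union> T)" using I by (simp only:)
    then show ?thesis unfolding S(1) Union_insert
      using smooth_set_Un[OF fA(1) conjunct1[OF IT]]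
        finite_rows_Un[OF fA(1) conjunct1[OF IT] fA(2) conjunct2[OF IT]] by blast
  qed
qed

theorem finite_rows_support: "finite_rows q (support C)"
proof -
  let ?S = "star ` support C"
  have "?S \<subseteq> (\<lambda>D. {y \<in> support C. \<forall>\<sigma>\<in>C. y \<in> \<sigma> \<longrightarrow> \<sigma> \<in> D}) ` Pow C"
  proof
    fix X assume "X \<in> ?S"
    then obtain x where "X = star x" by auto
    then have "X = {y \<in> support C. \<forall>\<sigma>\<in>C. y \<in> \<sigma> \<longrightarrow> \<sigma> \<in> {\<sigma> \<in> C. x \<in> \<sigma>}}" unfolding star_def by auto
    then show "X \<in> (\<lambda>D. {y \<in> support C. \<forall>\<sigma>\<in>C. y \<in> \<sigma> \<longrightarrow> \<sigma> \<in> D}) ` Pow C" by blast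
  qed
  then have "finite ?S" by (rule finite_subset) (simp add: finite_C)
  moreover have "?S \<subseteq> insert {} (range star)" by auto
  ultimately have "finite_rows q (\<Union> ?S)" using finite_rows_Union_stars by blast
  moreover have "\<Union> ?S = support C" unfolding star_def by auto
  ultimately show ?thesis by simp
qed

end

section \<open>The total complex\<close>

definition diff1 :: "(nat \<times> nat \<Rightarrow> 'a::euclidean_space superform) \<Rightarrow> nat \<times> nat \<Rightarrow> 'a superform" where
  "diff1 a = (\<lambda>(p, q). case p of 0 \<Rightarrow> 0 | Suc p' \<Rightarrow> d_prime (a (p', q)))"

definition diff2 :: "(nat \<times> nat \<Rightarrow> 'a::euclidean_space superform) \<Rightarrow> nat \<times> nat \<Rightarrow> 'a superform" where
  "diff2 a = (\<lambda>(p, q). case q of 0 \<Rightarrow> 0 | Suc q' \<Rightarrow> d_second (a (p, q')))"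

definition total_diff :: "(nat \<times> nat \<Rightarrow> 'a::euclidean_space superform) \<Rightarrow> nat \<times> nat \<Rightarrow> 'a superform" where
  "total_diff a i = diff1 a i + diff2 a i"

lemma diff1_simps [simp]: "diff1 a (0, q) = 0" "diff1 a (Suc p, q) = d_prime (a (p, q))"
  and diff2_simps [simp]: "diff2 a (p, 0) = 0" "diff2 a (p, Suc q) = d_second (a (p, q))"
  by (simp_all add: diff1_def diff2_def)

lemma total_diff_0: "total_diff 0 = 0"
proof
  fix i :: "nat \<times> nat"
  obtain p q where "i = (p, q)" by (cases i)
  then show "total_diff 0 i = (0 :: nat \<times> nat \<Rightarrow> 'a superform) i"
    by (cases p; cases q) (simp_all add: total_diff_def)
qed

context cell_complex
begin

abbreviation X :: "'a set" where "X \<equiv> support C"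

lemma rel_open_X: "rel_open X"
  unfolding rel_open_def by (intro exI[of _ UNIV]) simp

definition total_reps :: "nat \<Rightarrow> (nat \<times> nat \<Rightarrow> 'a superform) set" where
  "total_reps k = {a. \<forall>p q. p + q = k \<longrightarrow> a (p, q) \<in> reps p q X}"

definition total_null :: "nat \<Rightarrow> (nat \<times> nat \<Rightarrow> 'a superform) set" where
  "total_null k = {a. \<forall>p q. p + q = k \<longrightarrow> a (p, q) \<in> null p q X}"

lemma total_repsD: "a \<in> total_reps k \<Longrightarrow> p + q = k \<Longrightarrow> a (p, q) \<in> reps p q X"
  and total_nullD: "a \<in> total_null k \<Longrightarrow> p + q = k \<Longrightarrow> a (p, q) \<in> null p q X"
  by (auto simp: total_reps_def total_null_def)

lemma subspace_total_reps: "subspace (total_reps k)"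
  unfolding real_vector.subspace_def total_reps_def
  by (auto intro: reps_add reps_scale reps_0[OF rel_open_X])

lemma subspace_total_null: "subspace (total_null k)"
  unfolding real_vector.subspace_def total_null_def
  by (auto intro: null_add null_scale null_0)

lemma diff1_reps: "a \<in> total_reps k \<Longrightarrow> p + q = Suc k \<Longrightarrow> diff1 a (p, q) \<in> reps p q X"
  by (cases p) (auto intro: reps_0[OF rel_open_X] d_prime_reps total_repsD)

lemma diff2_reps: "a \<in> total_reps k \<Longrightarrow> p + q = Suc k \<Longrightarrow> diff2 a (p, q) \<in> reps p q X"
  by (cases q) (auto intro: reps_0[OF rel_open_X] d_second_reps total_repsD)

lemma total_diff_reps: "a \<in> total_reps k \<Longrightarrow> total_diff a \<in> total_reps (Suc k)"
  using diff1_reps diff2_reps by (auto simp: total_reps_def[of "Suc k"] total_diff_def intro!: reps_add)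

lemma linear_mod_total_diff: "linear_mod (total_reps k) (total_null (Suc k)) total_diff"
proof -
  have "linear_mod (total_reps k) (null p q X) (\<lambda>a. total_diff a (p, q))" if pq: "p + q = Suc k" for p q
    unfolding total_diff_def
  proof (rule linear_mod_plus[OF _ _ subspace_null])
    show "linear_mod (total_reps k) (null p q X) (\<lambda>a. diff1 a (p, q))"
    proof (cases p)
      case (Suc n)
      show ?thesis unfolding Suc diff1_simps
        by (rule linear_mod_comp[OF linear_mod_d_prime]) (use total_repsD pq Suc in auto)
    qed (simp add: linear_mod_def null_0)
    show "linear_mod (total_reps k) (null p q X) (\<lambda>a. diff2 a (p, q))"
    proof (cases q)
      case (Suc n)
      show ?thesis unfolding Suc diff2_simps
        by (rule linear_mod_comp[OF linear_mod_d_second]) (use total_repsD pq Suc in auto)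
    qed (simp add: linear_mod_def null_0)
  qed
  then show ?thesis by (simp add: linear_mod_def total_null_def)
qed

lemma total_diff_total_diff:
  assumes a: "a \<in> total_reps k"
  shows "total_diff (total_diff a) \<in> total_null (Suc (Suc k))"
proof -
  have 1: "d_prime (total_diff a (p, q)) - d_prime (diff2 a (p, q)) \<in> null (Suc p) q X"
    if pq: "p + q = Suc k" for p q
  proof -
    have "d_prime (diff1 a (p, q)) \<in> null (Suc p) q X"
    proof (cases p)
      case (Suc n)
      then show ?thesis using d_prime_d_prime_null[OF total_repsD[OF a, of n q]] pq by simp
    qed (simp add: null_0)
    from null_add[OF d_prime_add_null[OF diff1_reps[OF a pq] diff2_reps[OF a pq]] this]
    show ?thesis by (simp add: total_diff_def algebra_simps)
  qed
  have 2: "d_second (total_diff a (p, q)) - d_second (diff1 a (p, q)) \<in> null p (Suc q) X"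
    if pq: "p + q = Suc k" for p q
  proof -
    have "d_second (diff2 a (p, q)) \<in> null p (Suc q) X"
    proof (cases q)
      case (Suc n)
      then show ?thesis using d_second_d_second_null[OF total_repsD[OF a, of p n]] pq by simp
    qed (simp add: null_0)
    from null_add[OF d_second_add_null[OF diff1_reps[OF a pq] diff2_reps[OF a pq]] this]
    show ?thesis by (simp add: total_diff_def algebra_simps)
  qed
  have "total_diff (total_diff a) (p, q) \<in> null p q X" if pq: "p + q = Suc (Suc k)" for p q
  proof (cases p)
    case 0
    then obtain n where n: "q = Suc n" using pq by (cases q) auto
    then show ?thesis using 2[of 0 n] pq 0 by (simp add: total_diff_def[of "total_diff a"])
  next
    case p: (Suc m)
    show ?thesis
    proof (cases q)
      case 0
      then show ?thesis using 1[of m 0] pq p by (simp add: total_diff_def[of "total_diff a"])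
    next
      case q: (Suc n)
      have A: "d_prime (total_diff a (m, q)) - d_prime (d_second (a (m, n))) \<in> null p q X"
        using 1[of m q] pq p q by simp
      have B: "d_second (total_diff a (p, n)) - d_second (d_prime (a (m, n))) \<in> null p q X"
        using 2[of p n] pq p q by simp
      have "d_prime (d_second (a (m, n))) + d_second (d_prime (a (m, n))) \<in> null p q X"
        using d_prime_d_second_null[OF total_repsD[OF a, of m n]] pq p q by simp
      then have "(d_prime (total_diff a (m, q)) - d_prime (d_second (a (m, n))))
          + (d_second (total_diff a (p, n)) - d_second (d_prime (a (m, n))))
          + (d_prime (d_second (a (m, n))) + d_second (d_prime (a (m, n)))) \<in> null p q X"
        by (rule null_add[OF null_add[OF A B]])
      then show ?thesis unfolding total_diff_def[of "total_diff a"] p q by (simp add: algebra_simps)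
    qed
  qed
  then show ?thesis unfolding total_null_def by simp
qed

definition total_closed :: "nat \<Rightarrow> (nat \<times> nat \<Rightarrow> 'a superform) set" where
  "total_closed k = {a \<in> total_reps k. total_diff a \<in> total_null (Suc k)}"

fun total_exact :: "nat \<Rightarrow> (nat \<times> nat \<Rightarrow> 'a superform) set" where
  "total_exact 0 = total_reps 0 \<inter> total_null 0"
| "total_exact (Suc k) = {a \<in> total_reps (Suc k). \<exists>b\<in>total_reps k. a - total_diff b \<in> total_null (Suc k)}"

lemmas total_reps_closed = subspace_0[OF subspace_total_reps] subspace_add[OF subspace_total_reps]
    subspace_mul[OF subspace_total_reps] subspace_diff[OF subspace_total_reps]
  and total_null_closed = subspace_0[OF subspace_total_null] subspace_add[OF subspace_total_null]
    subspace_mul[OF subspace_total_null] subspace_diff[OF subspace_total_null]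

lemma subspace_total_closed: "subspace (total_closed k)"
  unfolding total_closed_def
  by (rule subspace_linear_mod_kernel[OF linear_mod_total_diff subspace_total_reps subspace_total_null])

lemma subspace_total_exact: "subspace (total_exact k)"
proof (cases k)
  case 0
  then show ?thesis using subspace_inter[OF subspace_total_reps subspace_total_null] by simp
next
  case (Suc j)
  show ?thesis unfolding Suc total_exact.simps
    by (rule subspace_linear_mod_image[OF linear_mod_total_diff subspace_total_reps subspace_total_null
          subspace_total_reps])
qed

definition filtration :: "nat \<Rightarrow> nat \<Rightarrow> (nat \<times> nat \<Rightarrow> 'a superform) set" where
  "filtration k s = {a \<in> total_closed k. \<forall>p q. p + q = k \<and> q < s \<longrightarrow> a (p, q) \<in> null p q X}"

lemma subspace_filtration: "subspace (filtration k s)"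
  using subspace_total_closed[of k] unfolding real_vector.subspace_def filtration_def
  by (auto intro: null_add null_scale null_0)

lemma filtration_leading_closed:
  assumes a: "a \<in> filtration k s" and k: "p + s = k"
  shows "a (p, s) \<in> closed_forms p s X"
proof -
  have r: "a \<in> total_reps k" and d: "total_diff a \<in> total_null (Suc k)"
    using a unfolding filtration_def total_closed_def by auto
  have "diff2 a (Suc p, s) \<in> null (Suc p) s X"
  proof (cases s)
    case (Suc n)
    have "a (Suc p, n) \<in> null (Suc p) n X" using a k Suc unfolding filtration_def by simp
    then show ?thesis using d_second_null[OF total_repsD[OF r, of "Suc p" n]] k Suc by simp
  qed (simp add: null_0)
  moreover have "d_prime (a (p, s)) + diff2 a (Suc p, s) \<in> null (Suc p) s X"
    using total_nullD[OF d, of "Suc p" s] k by (simp add: total_diff_def)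
  ultimately have "d_prime (a (p, s)) \<in> null (Suc p) s X"
    using null_diff by fastforce
  then show ?thesis unfolding closed_forms_def using total_repsD[OF r k] by simp
qed

text \<open>If the leading entry is \<open>d' \<beta>\<close>, subtracting the total differential of \<open>\<beta>\<close> removes it and
  otherwise only changes the entries further down the filtration.\<close>

lemma filtration_step:
  assumes a: "a \<in> filtration k s" and k: "p + s = k" and ex: "a (p, s) \<in> exact_forms p s X"
  shows "\<exists>a'\<in>filtration k (Suc s). a - a' \<in> total_exact k"
proof (cases p)
  case 0
  have "a (p', q) \<in> null p' q X" if "p' + q = k" "q < Suc s" for p' q
  proof (cases "q < s")
    case True
    then show ?thesis using a that unfolding filtration_def by simp
  next
    case False
    then have "q = s" "p' = 0" using that k 0 by auto
    then show ?thesis using ex 0 by simp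
  qed
  then have "a \<in> filtration k (Suc s)" using a unfolding filtration_def by simp
  moreover have "a - a \<in> total_exact k" using subspace_0[OF subspace_total_exact] by simp
  ultimately show ?thesis by blast
next
  case (Suc n)
  obtain \<beta> where \<beta>: "\<beta> \<in> reps n s X" "a (p, s) - d_prime \<beta> \<in> null p s X" using ex unfolding Suc by auto
  define b where "b = (\<lambda>i. if i = (n, s) then \<beta> else 0)"
  have k': "k = Suc (n + s)" using k Suc by simp
  have b: "b \<in> total_reps (n + s)"
    unfolding total_reps_def b_def using \<beta>(1) reps_0[OF rel_open_X] by simp
  have r: "a \<in> total_reps k" and d: "total_diff a \<in> total_null (Suc k)"
    using a unfolding filtration_def total_closed_def by auto
  have db: "total_diff b \<in> total_reps k" unfolding k' by (rule total_diff_reps[OF b])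
  have ddb: "total_diff (total_diff b) \<in> total_null (Suc k)" unfolding k' by (rule total_diff_total_diff[OF b])
  have bz: "total_diff b (p', q) = 0" if "q < s" for p' q
    using that by (cases p'; cases q) (auto simp: total_diff_def b_def)
  have bs: "total_diff b (Suc n, s) = d_prime \<beta>"
    by (cases s) (auto simp: total_diff_def b_def)
  let ?a = "a - total_diff b"
  have cl: "a \<in> total_closed k" using r d unfolding total_closed_def by simp
  have "total_diff b \<in> total_closed k" using db ddb unfolding total_closed_def by simp
  then have "?a \<in> total_closed k" using cl subspace_diff[OF subspace_total_closed] by blast
  moreover have "?a (p', q) \<in> null p' q X" if "p' + q = k" "q < Suc s" for p' q
  proof (cases "q < s")
    case True
    then show ?thesis using a that bz[OF True] unfolding filtration_def by simp
  next
    case False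
    then have "q = s" "p' = Suc n" using that k' by auto
    then show ?thesis using \<beta>(2) bs Suc by simp
  qed
  ultimately have "?a \<in> filtration k (Suc s)" unfolding filtration_def by simp
  moreover have "a - ?a \<in> total_exact k"
  proof -
    have "total_diff b - total_diff b \<in> total_null k" using total_null_closed(1) by simp
    then have "total_diff b \<in> total_exact k"
      unfolding k' total_exact.simps mem_Collect_eq
      using b db[unfolded k'] by (intro conjI bexI[of _ b]) (simp_all add: k')
    then show ?thesis by simp
  qed
  ultimately show ?thesis by blast
qed

theorem fin_codim_total: "fin_codim (total_closed k) (total_exact k)"
proof -
  have top: "filtration k (Suc k) \<subseteq> total_exact k"
  proof
    fix a assume a: "a \<in> filtration k (Suc k)"
    have r: "a \<in> total_reps k" using a unfolding filtration_def total_closed_def by auto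
    have n: "a \<in> total_null k" using a unfolding filtration_def total_null_def by simp
    show "a \<in> total_exact k"
    proof (cases k)
      case 0
      then show ?thesis using r n by simp
    next
      case (Suc j)
      have "a - total_diff 0 \<in> total_null (Suc j)" unfolding total_diff_0 using n Suc by simp
      then show ?thesis unfolding Suc total_exact.simps mem_Collect_eq
        using r total_reps_closed(1)[of j] Suc by (intro conjI bexI[of _ 0]) simp_all
    qed
  qed
  have "s \<le> Suc k \<Longrightarrow> fin_codim (filtration k s) (total_exact k)" for s
  proof (induction s rule: inc_induct)
    case base
    show ?case using fin_codim_mono[OF fin_codim_self[OF subspace_total_exact]] top by blast
  next
    case (step s)
    define p where "p = k - s"
    have ps: "p + s = k" using step.hyps unfolding p_def by simp
    let ?N = "{a \<in> filtration k s. a (p, s) \<in> exact_forms p s X}"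
    have "fin_codim (filtration k s) ?N"
    proof (rule fin_codim_pullback[where P = "\<lambda>a \<alpha>. a \<in> filtration k s \<and> \<alpha> = a (p, s)"])
      show "fin_codim (closed_forms p s X) (exact_forms p s X)"
        using finite_rows_support unfolding finite_rows_def by blast
    qed (use filtration_leading_closed[OF _ ps] subspace_filtration[of k s]
        in \<open>auto simp: real_vector.subspace_def\<close>)
    moreover have "fin_codim ?N (total_exact k)"
    proof (rule fin_codim_pullback[OF step.IH, where P = "\<lambda>a a'. a - a' \<in> total_exact k"])
      show "\<exists>a'\<in>filtration k (Suc s). a - a' \<in> total_exact k" if "a \<in> ?N" for a
        using filtration_step[OF _ ps] that by blast
      show "0 - 0 \<in> total_exact k" using subspace_0[OF subspace_total_exact] by simp
      show "x + y - (x' + y') \<in> total_exact k" if "x - x' \<in> total_exact k" "y - y' \<in> total_exact k" for x x' y y'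
        using subspace_add[OF subspace_total_exact that] by (simp add: algebra_simps)
      show "c *\<^sub>R x - c *\<^sub>R x' \<in> total_exact k" if "x - x' \<in> total_exact k" for c x x'
        using subspace_mul[OF subspace_total_exact that] by (simp add: scaleR_diff_right)
      show "m \<in> total_exact k" if "m - m' \<in> total_exact k" "m' \<in> total_exact k" for m m'
        using subspace_add[OF subspace_total_exact that] by simp
    qed
    ultimately show ?case by (rule fin_codim_trans)
  qed
  then have "fin_codim (filtration k 0) (total_exact k)" by simp
  moreover have "filtration k 0 = total_closed k" unfolding filtration_def by auto
  ultimately show ?thesis by simp
qed

section \<open>Passage to classes\<close>

abbreviation sform_class :: "nat \<Rightarrow> nat \<Rightarrow> 'a superform \<Rightarrow> 'a superform set" where
  "sform_class p q \<alpha> \<equiv> same_superform C X p q `` {\<alpha>}"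

lemma carrier_representatives: "carrier (representatives C X p q) = reps p q X"
  by (simp add: representatives_def reps_def)

lemma same_superform_iff:
  "(\<alpha>, \<beta>) \<in> same_superform C X p q \<longleftrightarrow> \<alpha> \<in> reps p q X \<and> \<beta> \<in> reps p q X \<and> \<alpha> - \<beta> \<in> null p q X"
  by (simp add: same_superform_def carrier_representatives null_def)

lemma lin_surj_representatives: "lin_surj (reps p q X) (\<lambda>\<alpha>. \<alpha>) (representatives C X p q)"
  unfolding lin_surj_def carrier_representatives using subspace_reps[OF rel_open_X]
  by (auto simp: representatives_def fun_eq_iff)

lemma equiv_same_superform: "equiv (reps p q X) (same_superform C X p q)"
proof -
  have "same_superform C X p q \<subseteq> reps p q X \<times> reps p q X"
    by (rule subrelI) (simp add: same_superform_iff)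
  then show ?thesis
    using equiv_of_subspace[of "same_superform C X p q" "\<lambda>\<alpha>. \<alpha>" "reps p q X" "null p q X"] subspace_null
    by (simp add: same_superform_iff)
qed

lemma lin_surj_superforms_on: "lin_surj (reps p q X) (sform_class p q) (superforms_on C X p q)"
  unfolding superforms_on_def
  by (rule lin_surj_quotient[OF lin_surj_representatives _ _ subspace_null])
     (auto simp: carrier_representatives equiv_same_superform same_superform_iff)

lemma sform_class_eq_iff:
  "\<alpha> \<in> reps p q X \<Longrightarrow> \<beta> \<in> reps p q X \<Longrightarrow> sform_class p q \<alpha> = sform_class p q \<beta> \<longleftrightarrow> \<alpha> - \<beta> \<in> null p q X"
  using eq_equiv_class_iff[OF equiv_same_superform] by (simp add: same_superform_iff)

lemma d_prime_on_class:
  assumes \<alpha>: "\<alpha> \<in> reps p q X"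
  shows "d_prime_on C X p q (sform_class p q \<alpha>) = sform_class (Suc p) q (d_prime \<alpha>)"
proof -
  have "sform_class (Suc p) q (d_prime \<beta>) = sform_class (Suc p) q (d_prime \<alpha>)" if "\<beta> \<in> sform_class p q \<alpha>" for \<beta>
  proof -
    have \<beta>: "\<beta> \<in> reps p q X" "\<alpha> - \<beta> \<in> null p q X" using that by (auto simp: same_superform_iff)
    have "(d_prime \<alpha>, d_prime \<beta>) \<in> same_superform C X (Suc p) q"
      using d_prime_cong_null[OF \<alpha> \<beta>] d_prime_reps \<alpha> \<beta> by (simp add: same_superform_iff)
    then show ?thesis using equiv_class_eq[OF equiv_same_superform] by blast
  qed
  moreover have "\<alpha> \<in> sform_class p q \<alpha>" using \<alpha> null_0 by (simp add: same_superform_iff)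
  ultimately show ?thesis unfolding d_prime_on_def by blast
qed

lemma d_second_on_class:
  assumes \<alpha>: "\<alpha> \<in> reps p q X"
  shows "d_second_on C X p q (sform_class p q \<alpha>) = sform_class p (Suc q) (d_second \<alpha>)"
proof -
  have "sform_class p (Suc q) (d_second \<beta>) = sform_class p (Suc q) (d_second \<alpha>)" if "\<beta> \<in> sform_class p q \<alpha>" for \<beta>
  proof -
    have \<beta>: "\<beta> \<in> reps p q X" "\<alpha> - \<beta> \<in> null p q X" using that by (auto simp: same_superform_iff)
    have "(d_second \<alpha>, d_second \<beta>) \<in> same_superform C X p (Suc q)"
      using d_second_cong_null[OF \<alpha> \<beta>] d_second_reps \<alpha> \<beta> by (simp add: same_superform_iff)
    then show ?thesis using equiv_class_eq[OF equiv_same_superform] by blast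
  qed
  moreover have "\<alpha> \<in> sform_class p q \<alpha>" using \<alpha> null_0 by (simp add: same_superform_iff)
  ultimately show ?thesis unfolding d_second_on_def by blast
qed

definition total_class :: "nat \<Rightarrow> (nat \<times> nat \<Rightarrow> 'a superform) \<Rightarrow> nat \<times> nat \<Rightarrow> 'a superform set" where
  "total_class k a = (\<lambda>i\<in>{(p, q). p + q = k}. (case i of (p, q) \<Rightarrow> sform_class p q) (a i))"

lemma lin_surj_total: "lin_surj (total_reps k) (total_class k) (total_superforms C X k)"
proof -
  have "total_reps k = {a. \<forall>i\<in>{(p, q). p + q = k}. a i \<in> (case i of (p, q) \<Rightarrow> reps p q X)}"
    unfolding total_reps_def by auto
  then show ?thesis
    unfolding total_superforms_def total_class_def
    using lin_surj_direct_sum[of "{(p, q). p + q = k}" "\<lambda>(p, q). reps p q X" "\<lambda>(p, q). sform_class p q"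
        "\<lambda>(p, q). superforms_on C X p q"] lin_surj_superforms_on
    by auto
qed

lemma total_class_eq_iff:
  assumes "a \<in> total_reps k" "b \<in> total_reps k"
  shows "total_class k a = total_class k b \<longleftrightarrow> a - b \<in> total_null k"
proof -
  have "total_class k a = total_class k b \<longleftrightarrow> (\<forall>p q. p + q = k \<longrightarrow> sform_class p q (a (p, q)) = sform_class p q (b (p, q)))"
    unfolding total_class_def restrict_def fun_eq_iff by (auto split: prod.splits)
  also have "\<dots> \<longleftrightarrow> a - b \<in> total_null k"
    unfolding total_null_def using sform_class_eq_iff total_repsD[OF assms(1)] total_repsD[OF assms(2)] by simp
  finally show ?thesis .
qed

lemma total_d_class:
  assumes a: "a \<in> total_reps k"
  shows "total_d C X k (total_class k a) = total_class (Suc k) (total_diff a)"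
proof
  fix i :: "nat \<times> nat"
  obtain p q where i: "i = (p, q)" by (cases i)
  show "total_d C X k (total_class k a) i = total_class (Suc k) (total_diff a) i"
  proof (cases "p + q = Suc k")
    case False
    then show ?thesis unfolding i total_d_def total_class_def by simp
  next
    case True
    have zero: "\<zero>\<^bsub>superforms_on C X p q\<^esub> = sform_class p q 0"
      and add: "\<And>x y. x \<in> reps p q X \<Longrightarrow> y \<in> reps p q X \<Longrightarrow>
        sform_class p q (x + y) = sform_class p q x \<oplus>\<^bsub>superforms_on C X p q\<^esub> sform_class p q y"
      using lin_surj_superforms_on[of p q] unfolding lin_surj_def by auto
    have "(case p of 0 \<Rightarrow> \<zero>\<^bsub>superforms_on C X p q\<^esub> | Suc p' \<Rightarrow> d_prime_on C X p' q (total_class k a (p', q)))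
        = sform_class p q (diff1 a (p, q))"
    proof (cases p)
      case (Suc n)
      then show ?thesis
        using d_prime_on_class[OF total_repsD[OF a, of n q]] True by (simp add: total_class_def)
    qed (use zero in simp)
    moreover have "(case q of 0 \<Rightarrow> \<zero>\<^bsub>superforms_on C X p q\<^esub> | Suc q' \<Rightarrow> d_second_on C X p q' (total_class k a (p, q')))
        = sform_class p q (diff2 a (p, q))"
    proof (cases q)
      case (Suc n)
      then show ?thesis
        using d_second_on_class[OF total_repsD[OF a, of p n]] True by (simp add: total_class_def)
    qed (use zero in simp)
    ultimately have "total_d C X k (total_class k a) (p, q) =
        sform_class p q (diff1 a (p, q)) \<oplus>\<^bsub>superforms_on C X p q\<^esub> sform_class p q (diff2 a (p, q))"
      unfolding total_d_def using True by simp
    also have "\<dots> = sform_class p q (total_diff a (p, q))"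
      unfolding total_diff_def using add[OF diff1_reps[OF a True] diff2_reps[OF a True]] by simp
    finally show ?thesis unfolding i total_class_def using True by simp
  qed
qed

lemma total_surj: "carrier (total_superforms C X k) = total_class k ` total_reps k"
  and total_zero: "\<zero>\<^bsub>total_superforms C X k\<^esub> = total_class k 0"
  and total_add: "a \<in> total_reps k \<Longrightarrow> b \<in> total_reps k \<Longrightarrow>
    total_class k a \<oplus>\<^bsub>total_superforms C X k\<^esub> total_class k b = total_class k (a + b)"
  using lin_surj_total[of k] unfolding lin_surj_def by auto

lemma cocycles_eq: "cocycles C X k = total_class k ` total_closed k"
proof -
  have "total_d C X k (total_class k a) = \<zero>\<^bsub>total_superforms C X (Suc k)\<^esub> \<longleftrightarrow> total_diff a \<in> total_null (Suc k)"
    if a: "a \<in> total_reps k" for a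
    unfolding total_d_class[OF a] total_zero
    using total_class_eq_iff[OF total_diff_reps[OF a] total_reps_closed(1)] by simp
  then show ?thesis unfolding cocycles_def total_surj total_closed_def by auto
qed

lemma lin_surj_cocycles:
  "lin_surj (total_closed k) (total_class k) ((total_superforms C X k)\<lparr>carrier := cocycles C X k\<rparr>)"
proof -
  have "total_closed k \<subseteq> total_reps k" unfolding total_closed_def by auto
  then show ?thesis
    using lin_surj_total[of k] subspace_total_closed[of k] unfolding lin_surj_def
    by (auto simp: cocycles_eq subset_iff)
qed

lemma cohomologous_iff:
  assumes a: "a \<in> total_closed k" and b: "b \<in> total_closed k"
  shows "(\<exists>c\<in>coboundaries C X k. total_class k a = total_class k b \<oplus>\<^bsub>total_superforms C X k\<^esub> c)
    \<longleftrightarrow> a - b \<in> total_exact k"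
proof -
  have r: "a \<in> total_reps k" "b \<in> total_reps k" using a b unfolding total_closed_def by auto
  note ab = total_reps_closed(4)[OF r]
  show ?thesis
  proof (cases k)
    case 0
    have "(\<exists>c\<in>coboundaries C X k. total_class k a = total_class k b \<oplus>\<^bsub>total_superforms C X k\<^esub> c)
        \<longleftrightarrow> total_class k a = total_class k b"
      using total_add[OF r(2) total_reps_closed(1)] total_zero[of k] unfolding coboundaries_def 0 by simp
    then show ?thesis using total_class_eq_iff[OF r] ab 0 by simp
  next
    case (Suc j)
    have cob: "coboundaries C X k = (\<lambda>e. total_class k (total_diff e)) ` total_reps j"
      unfolding coboundaries_def Suc
      by (simp add: total_surj image_image total_d_class cong: image_cong)
    have "total_class k a = total_class k b \<oplus>\<^bsub>total_superforms C X k\<^esub> total_class k (total_diff e)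
        \<longleftrightarrow> a - b - total_diff e \<in> total_null k" if e: "e \<in> total_reps j" for e
    proof -
      have de: "total_diff e \<in> total_reps k" unfolding Suc by (rule total_diff_reps[OF e])
      show ?thesis unfolding total_add[OF r(2) de]
        using total_class_eq_iff[OF r(1) total_reps_closed(2)[OF r(2) de]] by (simp add: diff_diff_eq)
    qed
    then have "(\<exists>c\<in>coboundaries C X k. total_class k a = total_class k b \<oplus>\<^bsub>total_superforms C X k\<^esub> c)
        \<longleftrightarrow> (\<exists>e\<in>total_reps j. a - b - total_diff e \<in> total_null k)"
      unfolding cob by simp
    then show ?thesis using ab by (simp add: Suc)
  qed
qed

lemma cohomology_fin_dim:
  "vectorspace real_ring (cohomology C X k) \<and> vectorspace.fin_dim real_ring (cohomology C X k)"
proof -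
  define E where "E = {(z, z'). z \<in> cocycles C X k \<and> z' \<in> cocycles C X k \<and>
    (\<exists>b\<in>coboundaries C X k. z = z' \<oplus>\<^bsub>total_superforms C X k\<^esub> b)}"
  have E_iff: "(total_class k a, total_class k b) \<in> E \<longleftrightarrow> a - b \<in> total_exact k"
    if "a \<in> total_closed k" "b \<in> total_closed k" for a b
    using cohomologous_iff[OF that] that unfolding E_def by (auto simp: cocycles_eq)
  have E: "equiv (cocycles C X k) E"
    unfolding cocycles_eq
    by (rule equiv_of_subspace[OF _ E_iff subspace_total_exact]) (auto simp: E_def cocycles_eq)
  have surj: "lin_surj (total_closed k) (\<lambda>a. E `` {total_class k a}) (cohomology C X k)"
    unfolding cohomology_def E_def[symmetric]
    by (rule lin_surj_quotient[OF lin_surj_cocycles _ E_iff subspace_total_exact]) (use E in simp_all)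
  obtain n :: nat and v where v: "\<And>i. i < n \<Longrightarrow> v i \<in> total_closed k"
    and sp: "\<And>m. m \<in> total_closed k \<Longrightarrow> \<exists>c. m - (\<Sum>i<n. c i *\<^sub>R v i) \<in> total_exact k"
    using fin_codim_spanning[OF fin_codim_total subspace_total_exact] by blast
  have "vectorspace.fin_dim real_ring (cohomology C X k)"
  proof (rule lin_surj_fin_dim[OF surj v])
    fix m assume m: "m \<in> total_closed k"
    obtain c where c: "m - (\<Sum>i<n. c i *\<^sub>R v i) \<in> total_exact k" using sp[OF m] by blast
    have "(\<Sum>i<n. c i *\<^sub>R v i) \<in> total_closed k"
      using v by (intro subspace_sum subspace_mul subspace_total_closed) auto
    from E_iff[OF m this] c have "(total_class k m, total_class k (\<Sum>i<n. c i *\<^sub>R v i)) \<in> E" by simp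
    then show "\<exists>c. E `` {total_class k m} = E `` {total_class k (\<Sum>i<n. c i *\<^sub>R v i)}"
      using equiv_class_eq[OF E] by blast
  qed
  then show ?thesis using lin_surj_vectorspace[OF surj] by blast
qed

end

theorem theorem3p14:
  fixes C :: "(real ^ 'r) set set" and k :: nat
  assumes "polyhedral_complex C"
  shows "vectorspace real_ring (cohomology C (support C) k) \<and>
         vectorspace.fin_dim real_ring (cohomology C (support C) k)"
proof -
  interpret cell_complex C using assms by (rule cell_complex.intro)
  show ?thesis by (rule cohomology_fin_dim)
qed

end
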